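(* Let $(V,h)$ be an oriented eight-dimensional Euclidean vector space and let $\Phi\in\wedge^4_+V^*$ be a nonzero self-dual four-form. The following statements are equivalent: (a) $\Phi$ is a conformal $\mathrm{Spin}(7)_+$ form on $(V,h)$. (b) The polyform $$\alpha=\frac{1}{16}\left[\frac{1}{\sqrt{14}}|\Phi|_h+\Phi+\frac{1}{\sqrt{14}}|\Phi|_h\,\nu_h\right]\in\wedge V^*$$ is the positive square of a nonzero spinor of positive chirality, i.e. there is $\xi\in\Sigma^+\setminus\{0\}$ with $\alpha=\mathcal{E}^{+}_\gamma(\xi)$. (c) $\Phi$ satisfies the algebraic equation $$\sqrt{14}\,\Phi\,\Delta_2^h\,\Phi+12\,|\Phi|_h\,\Phi=0 .$$ In particular, there is a one-to-one correspondence between the set of conformal $\mathrm{Spin}(7)_+$ forms on $(V,h)$ and the set of nonzero self-dual solutions $\Phi\in\wedge^4_+V^*$ of the equation in (c).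
   Context: Forms. $h$ induces on $\wedge V^*=\bigoplus_{k=0}^8\wedge^kV^*$ (whose elements are called polyforms) the determinant scalar product $\langle\cdot,\cdot\rangle_h$, for which the $e^{i_1}\wedge\cdots\wedge e^{i_k}$ ($i_1<\dots<i_k$, $0\le k\le 8$) are orthonormal whenever $(e^1,\dots,e^8)$ is an orthonormal basis of $V^*$; $|\cdot|_h$ is its norm, $\nu_h$ is the volume form, $*_h$ the Hodge operator, and $\wedge^4_+V^*=\{\omega\in\wedge^4V^*: *_h\omega=\omega\}$ is the space of self-dual four-forms. For polyforms $\alpha,\beta$, $$\alpha\,\Delta_2^h\,\beta=\tfrac12 h^{a_1b_1}h^{a_2b_2}(\iota_{e_{a_1}}\iota_{e_{a_2}}\alpha)\wedge(\iota_{e_{b_1}}\iota_{e_{b_2}}\beta)$$ for any basis $(e_a)$ of $V$ with dual basis $(e^a)$ (summation implied, $h^{ab}=h^*(e^a,e^b)$). $\mathrm{Spin}(7)$ forms. On $\mathbb{R}^8$ with its standard metric $h_0$ and orientation, write $e^{ijkl}=e^i\wedge e^j\wedge e^k\wedge e^l$ and set $$\Phi_0=e^{1234}+e^{1256}+e^{1278}+e^{1357}-e^{1368}-e^{1458}-e^{1467}+e^{5678}+e^{3478}+e^{3456}+e^{2468}-e^{2457}-e^{2358}-e^{2367}.$$ A $\mathrm{Spin}(7)_+$ form on $V$ is a four-form $\Phi=f^*\Phi_0$ with $f:V\to\mathbb{R}^8$ an orientation-preserving linear isomorphism; it induces the Euclidean metric $h_\Phi=f^*h_0$ (independent of the choice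 of $f$). It is a conformal $\mathrm{Spin}(7)_+$ form on $(V,h)$ if $h_\Phi=c\,h$ for some $c>0$. Spinors. $\diamond_h$ is the geometric product on $\wedge V^*$: the unique associative unital bilinear product with $\alpha\diamond_h\beta=\alpha\wedge\beta+\iota_{\alpha^\sharp}\beta$ for $\alpha\in V^*$, $\beta\in\wedge V^*$, where $\alpha^\sharp\in V$ is $h$-dual to $\alpha$; $(\wedge V^*,\diamond_h)$ is identified with the Clifford algebra $\mathrm{Cl}(V^*,h^* )$ with convention $v^2=h^*(v,v)$. $\Sigma$ is an irreducible real Clifford module (of dimension 16) with representation $\gamma$, and $\Psi_h^\gamma:(\wedge V^*,\diamond_h)\to(\mathrm{End}(\Sigma),\circ)$ is the corresponding isomorphism of unital algebras. $\mathscr{B}$ is a scalar product on $\Sigma$ for which $\Psi_h^\gamma(v)$ is symmetric for all $v\in V^*$. $\Sigma^\pm$ are the $\pm1$ eigenspaces of $\Psi_h^\gamma(\nu_h)$ (spinors of positive/negative chirality). The positive square of $\xi\in\Sigma$ is $\mathcal{E}_\gamma^+(\xi)=(\Psi_h^\gamma)^{-1}(\xi\otimes\xi^* )$, where $\xi^*=\mathscr{B}(\xi,\cdot)$ and $(\xi\otimes\xi^* )(\eta)=\mathscr{B}(\xi,\eta)\xi$.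
   Formalization: The model form is taken to be −Φ₀ instead of Φ₀: with the stated conventions Φ₀ Δ₂ Φ₀ = +12 Φ₀ and |Φ₀| = √14, so Φ₀ satisfies (a) but not (c); (b), (c) and the correspondence are unchanged. *)

theory Defs
  imports "HOL-Analysis.Analysis"
begin

section \<open>Polyforms on a Euclidean space\<close>

text \<open>
  A polyform on \<open>'a\<close> is a function on lists of vectors; its degree \<open>k\<close> component is its
  restriction to the lists of length \<open>k\<close>, which has to be an alternating multilinear form. Since
  alternating forms of degree greater than the dimension vanish, \<open>polyforms\<close> is the exterior
  algebra of the dual of \<open>'a\<close>. The metric \<open>h\<close> is the inner product of the type class.
\<close>

type_synonym 'a polyform = "'a list \<Rightarrow> real"

definition polyforms :: "'a::real_vector polyform set" where
  "polyforms = {\<alpha>. (\<forall>xs i. i < length xs \<longrightarrow> linear (\<lambda>v. \<alpha> (xs[i := v]))) \<and>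
                    (\<forall>xs. \<not> distinct xs \<longrightarrow> \<alpha> xs = 0)}"

definition forms :: "nat \<Rightarrow> 'a::real_vector polyform set" where
  "forms k = {\<alpha> \<in> polyforms. \<forall>xs. length xs \<noteq> k \<longrightarrow> \<alpha> xs = 0}"

definition one_form :: "'a polyform" where
  "one_form xs = (if xs = [] then 1 else 0)"

text \<open>The sign of the permutation of \<open>{..<n}\<close> that lists \<open>S\<close> increasingly and then its complement.\<close>

definition shuffle_sign :: "nat \<Rightarrow> nat set \<Rightarrow> real" where
  "shuffle_sign n S = (-1) ^ card {(i, j). i \<in> S \<and> j \<in> {..<n} - S \<and> j < i}"

text \<open>
  Normalised by \<open>(\<alpha> \<and> \<beta>)(v, w) = \<alpha>(v) \<beta>(w) - \<alpha>(w) \<beta>(v)\<close> for one-forms.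
\<close>

definition wedge :: "'a polyform \<Rightarrow> 'a polyform \<Rightarrow> 'a polyform" where
  "wedge \<alpha> \<beta> xs = (\<Sum>S\<in>Pow {..<length xs}.
     shuffle_sign (length xs) S * \<alpha> (nths xs S) * \<beta> (nths xs ({..<length xs} - S)))"

definition interior_prod :: "'a \<Rightarrow> 'a polyform \<Rightarrow> 'a polyform" where
  "interior_prod v \<alpha> xs = \<alpha> (v # xs)"

definition pullback :: "('a \<Rightarrow> 'b) \<Rightarrow> 'b polyform \<Rightarrow> 'a polyform" where
  "pullback f \<omega> xs = \<omega> (map f xs)"

text \<open>
  The determinant scalar product, for which the forms \<open>e\<^sup>I\<close> with \<open>I\<close> increasing are orthonormal:
  summing over all lists of distinct elements of the orthonormal \<open>Basis\<close> counts every increasing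
  multi-index of length \<open>k\<close> exactly \<open>k!\<close> times.
\<close>

definition form_inner :: "'a::euclidean_space polyform \<Rightarrow> 'a polyform \<Rightarrow> real" where
  "form_inner \<alpha> \<beta> =
     (\<Sum>xs | set xs \<subseteq> Basis \<and> distinct xs. \<alpha> xs * \<beta> xs / fact (length xs))"

definition form_norm :: "'a::euclidean_space polyform \<Rightarrow> real" where
  "form_norm \<alpha> = sqrt (form_inner \<alpha> \<alpha>)"

text \<open>
  The product \<open>\<Delta>\<^sub>2\<close>, evaluated in the orthonormal \<open>Basis\<close>, where \<open>h\<^sup>a\<^sup>b\<close> is the identity matrix;
  the expression does not depend on the basis.
\<close>

definition Delta2 :: "'a::euclidean_space polyform \<Rightarrow> 'a polyform \<Rightarrow> 'a polyform" where
  "Delta2 \<alpha> \<beta> xs = 1 / 2 * (\<Sum>a\<in>Basis. \<Sum>b\<in>Basis.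
     wedge (interior_prod a (interior_prod b \<alpha>)) (interior_prod a (interior_prod b \<beta>)) xs)"

section \<open>Orientation, volume form and Hodge operator\<close>

text \<open>
  An orientation is given by its set of positively oriented ordered bases, namely those on which
  some nonzero form of top degree is positive.
\<close>

definition orientation :: "'a::euclidean_space list set \<Rightarrow> bool" where
  "orientation ori \<longleftrightarrow>
     (\<exists>\<omega> \<in> forms DIM('a). \<omega> \<noteq> (\<lambda>_. 0) \<and> ori = {xs. 0 < \<omega> xs})"

definition orthonormal_list :: "'a::real_inner list \<Rightarrow> bool" where
  "orthonormal_list xs \<longleftrightarrow>
     (\<forall>i<length xs. \<forall>j<length xs. xs ! i \<bullet> xs ! j = (if i = j then 1 else 0))"

definition volume_form :: "'a::euclidean_space list set \<Rightarrow> 'a polyform" where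
  "volume_form ori =
     (THE \<nu>. \<nu> \<in> forms DIM('a) \<and> (\<forall>xs\<in>ori. orthonormal_list xs \<longrightarrow> \<nu> xs = 1))"

text \<open>
  The Hodge operator, characterised by \<open>\<alpha> \<and> *\<beta> = \<langle>\<alpha>, \<beta>\<rangle> \<nu>\<close> for \<open>\<alpha>\<close>, \<open>\<beta>\<close> of equal degree. In
  components, for \<open>\<beta>\<close> of degree \<open>k\<close>, it is \<open>1/k!\<close> times the full contraction of \<open>\<beta>\<close> with the first
  \<open>k\<close> slots of \<open>\<nu>\<close>.
\<close>

definition hodge :: "'a::euclidean_space list set \<Rightarrow> 'a polyform \<Rightarrow> 'a polyform" where
  "hodge ori \<beta> xs = (\<Sum>ys | set ys \<subseteq> Basis \<and> distinct ys.
     \<beta> ys * volume_form ori (ys @ xs) / fact (length ys))"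

definition self_dual_4forms :: "'a::euclidean_space list set \<Rightarrow> 'a polyform set" where
  "self_dual_4forms ori = {\<omega> \<in> forms 4. hodge ori \<omega> = \<omega>}"

section \<open>Spin(7) forms\<close>

text \<open>
  The index type of \<open>real ^ 8\<close> is the ring of integers modulo 8, so the eighth coordinate is the one
  with index \<open>8 = 0\<close>.
\<close>

definition coord_form :: "8 \<Rightarrow> (real ^ 8) polyform" where
  "coord_form i xs = (case xs of [v] \<Rightarrow> v $ i | _ \<Rightarrow> 0)"

definition std_form :: "8 list \<Rightarrow> (real ^ 8) polyform" where
  "std_form is = foldr wedge (map coord_form is) one_form"

definition std_orientation :: "(real ^ 8) list set" where
  "std_orientation = {xs. 0 < std_form [1, 2, 3, 4, 5, 6, 7, 8] xs}"

definition Phi0 :: "(real ^ 8) polyform" where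
  "Phi0 xs = std_form [1,2,3,4] xs + std_form [1,2,5,6] xs + std_form [1,2,7,8] xs
     + std_form [1,3,5,7] xs - std_form [1,3,6,8] xs - std_form [1,4,5,8] xs
     - std_form [1,4,6,7] xs + std_form [5,6,7,8] xs + std_form [3,4,7,8] xs
     + std_form [3,4,5,6] xs + std_form [2,4,6,8] xs - std_form [2,4,5,7] xs
     - std_form [2,3,5,8] xs - std_form [2,3,6,7] xs"

text \<open>
  The overall sign of the model form matters, as \<open>Phi0\<close> and \<open>- Phi0\<close> lie in different orbits of the
  orientation-preserving linear maps. One computes \<open>Delta2 Phi0 Phi0 = 12 Phi0\<close>, while the
  equation \<open>sqrt 14 Delta2 \<Phi> \<Phi> + 12 |\<Phi>| \<Phi> = 0\<close> and the square
  \<open>1/16 (1 + \<Phi> + \<nu>)\<close> of a unit spinor of positive chirality (\<open>|\<Phi>| = sqrt 14\<close>)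
  require \<open>Delta2 \<Phi> \<Phi> = - 12 \<Phi>\<close>. So with the geometric product normalised by
  \<open>\<alpha> \<diamondop> \<beta> = \<alpha> \<and> \<beta> + \<iota> \<beta>\<close>, where \<open>e\<^sup>1\<^sup>2\<^sup>3\<^sup>4 \<diamondop> e\<^sup>1\<^sup>2\<^sup>5\<^sup>6 = - e\<^sup>3\<^sup>4\<^sup>5\<^sup>6\<close>, the form that is
  the square of a spinor is \<open>- Phi0\<close>. The source uses \<open>Phi0\<close>; its sign is corrected here.
\<close>

definition spin7_model :: "(real ^ 8) polyform" where
  "spin7_model xs = - Phi0 xs"

definition oriented_iso :: "'a::euclidean_space list set \<Rightarrow> ('a \<Rightarrow> real ^ 8) \<Rightarrow> bool" where
  "oriented_iso ori f \<longleftrightarrow> linear f \<and> bij f \<and> (\<forall>xs\<in>ori. map f xs \<in> std_orientation)"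

definition spin7_pos_form :: "'a::euclidean_space list set \<Rightarrow> 'a polyform \<Rightarrow> bool" where
  "spin7_pos_form ori \<Phi> \<longleftrightarrow> (\<exists>f. oriented_iso ori f \<and> \<Phi> = pullback f spin7_model)"

text \<open>The choice of \<open>f\<close> below does not affect the metric (nor does the sign of the model form).\<close>

definition spin7_metric :: "'a::euclidean_space list set \<Rightarrow> 'a polyform \<Rightarrow> 'a \<Rightarrow> 'a \<Rightarrow> real" where
  "spin7_metric ori \<Phi> v w =
     (let f = (SOME f. oriented_iso ori f \<and> \<Phi> = pullback f spin7_model) in f v \<bullet> f w)"

definition conformal_spin7_pos_form :: "'a::euclidean_space list set \<Rightarrow> 'a polyform \<Rightarrow> bool" where
  "conformal_spin7_pos_form ori \<Phi> \<longleftrightarrow>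
     spin7_pos_form ori \<Phi> \<and> (\<exists>c>0. \<forall>v w. spin7_metric ori \<Phi> v w = c * (v \<bullet> w))"

section \<open>Geometric product and spinors\<close>

definition sharp :: "'a::euclidean_space polyform \<Rightarrow> 'a" where
  "sharp \<alpha> = (\<Sum>b\<in>Basis. \<alpha> [b] *\<^sub>R b)"

text \<open>
  Any two products with this property agree on \<open>polyforms\<close>; nothing is required elsewhere.
\<close>

definition geometric_product ::
    "('a::euclidean_space polyform \<Rightarrow> 'a polyform \<Rightarrow> 'a polyform) \<Rightarrow> bool" where
  "geometric_product gp \<longleftrightarrow>
     (\<forall>\<alpha>\<in>polyforms. \<forall>\<beta>\<in>polyforms. gp \<alpha> \<beta> \<in> polyforms) \<and>
     (\<forall>\<alpha>\<in>polyforms. \<forall>\<beta>\<in>polyforms. \<forall>\<gamma>\<in>polyforms. \<forall>a b.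
        gp (\<lambda>xs. a * \<alpha> xs + b * \<beta> xs) \<gamma> = (\<lambda>xs. a * gp \<alpha> \<gamma> xs + b * gp \<beta> \<gamma> xs) \<and>
        gp \<gamma> (\<lambda>xs. a * \<alpha> xs + b * \<beta> xs) = (\<lambda>xs. a * gp \<gamma> \<alpha> xs + b * gp \<gamma> \<beta> xs)) \<and>
     (\<forall>\<alpha>\<in>polyforms. \<forall>\<beta>\<in>polyforms. \<forall>\<gamma>\<in>polyforms. gp (gp \<alpha> \<beta>) \<gamma> = gp \<alpha> (gp \<beta> \<gamma>)) \<and>
     (\<forall>\<alpha>\<in>polyforms. gp one_form \<alpha> = \<alpha> \<and> gp \<alpha> one_form = \<alpha>) \<and>
     (\<forall>\<alpha>\<in>forms 1. \<forall>\<beta>\<in>polyforms.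
        gp \<alpha> \<beta> = (\<lambda>xs. wedge \<alpha> \<beta> xs + interior_prod (sharp \<alpha>) \<beta> xs))"

definition clifford_module ::
    "('a::euclidean_space polyform \<Rightarrow> 'a polyform \<Rightarrow> 'a polyform) \<Rightarrow>
     ('a polyform \<Rightarrow> 's::real_vector \<Rightarrow> 's) \<Rightarrow> bool" where
  "clifford_module gp \<Psi> \<longleftrightarrow>
     (\<forall>\<alpha>\<in>polyforms. linear (\<Psi> \<alpha>)) \<and>
     (\<forall>\<alpha>\<in>polyforms. \<forall>\<beta>\<in>polyforms. \<forall>a b.
        \<Psi> (\<lambda>xs. a * \<alpha> xs + b * \<beta> xs) = (\<lambda>\<xi>. a *\<^sub>R \<Psi> \<alpha> \<xi> + b *\<^sub>R \<Psi> \<beta> \<xi>)) \<and>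
     \<Psi> one_form = id \<and>
     (\<forall>\<alpha>\<in>polyforms. \<forall>\<beta>\<in>polyforms. \<Psi> (gp \<alpha> \<beta>) = \<Psi> \<alpha> \<circ> \<Psi> \<beta>)"

definition irreducible_module :: "('a::real_vector polyform \<Rightarrow> 's::real_vector \<Rightarrow> 's) \<Rightarrow> bool" where
  "irreducible_module \<Psi> \<longleftrightarrow>
     (\<exists>\<xi>::'s. \<xi> \<noteq> 0) \<and>
     (\<forall>U. subspace U \<and> (\<forall>\<alpha>\<in>polyforms. \<Psi> \<alpha> ` U \<subseteq> U) \<longrightarrow> U = {0} \<or> U = UNIV)"

text \<open>The inner product of the type \<open>'s\<close> of spinors plays the role of the scalar product \<open>\<B>\<close>.\<close>

definition covectors_symmetric ::
    "('a::real_vector polyform \<Rightarrow> 's::real_inner \<Rightarrow> 's) \<Rightarrow> bool" where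
  "covectors_symmetric \<Psi> \<longleftrightarrow> (\<forall>\<alpha>\<in>forms 1. \<forall>\<xi> \<eta>. \<Psi> \<alpha> \<xi> \<bullet> \<eta> = \<xi> \<bullet> \<Psi> \<alpha> \<eta>)"

definition positive_chirality ::
    "'a::euclidean_space list set \<Rightarrow> ('a polyform \<Rightarrow> 's::real_vector \<Rightarrow> 's) \<Rightarrow> 's set" where
  "positive_chirality ori \<Psi> = {\<xi>. \<Psi> (volume_form ori) \<xi> = \<xi>}"

definition positive_square ::
    "('a::real_vector polyform \<Rightarrow> 's::real_inner \<Rightarrow> 's) \<Rightarrow> 's \<Rightarrow> 'a polyform" where
  "positive_square \<Psi> \<xi> = inv_into polyforms \<Psi> (\<lambda>\<eta>. (\<xi> \<bullet> \<eta>) *\<^sub>R \<xi>)"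

end

theory Submission
  imports Defs "HOL-Combinatorics.Multiset_Permutations"
begin

text \<open>
  The link between the three conditions is the algebra of operators on spinors, of which the polyforms
  with the geometric product are a copy.

  The geometric square of a self-dual four-form \<open>\<Phi>\<close> is \<open>|\<Phi>|\<^sup>2 (1 + \<nu>) - \<Phi> \<Delta>\<^sub>2 \<Phi>\<close>
  (\<open>clifford_square_self_dual\<close>): in the product of the monomials of two four-element index sets, sets
  with an odd intersection anticommute and cancel, an intersection of two indices gives the terms of
  \<open>\<Delta>\<^sub>2\<close>, and equal or complementary sets give the remaining part. With \<open>\<kappa> = |\<Phi>| / sqrt 14\<close>, the
  quadratic equation thus says that the operator \<open>E\<close> of \<open>\<alpha> = 1/16 (\<kappa> + \<Phi> + \<kappa> \<nu>)\<close> satisfies \<open>E\<^sup>2 = \<kappa> E\<close>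
  (\<open>spinor_polyform_idempotent_iff\<close>). Monomials are orthogonal for the Hilbert-Schmidt product, so the
  norm of \<open>E\<close> is \<open>\<kappa>\<close>; a spinor \<open>\<xi>\<close> in the image of \<open>E\<close> with \<open>|\<xi>|\<^sup>2 = \<kappa>\<close> accounts for all of this norm, and
  \<open>E = \<xi> \<otimes> \<xi>\<^sup>*\<close> (\<open>rank_one_if_norm\<close>). Conversely, \<open>\<xi> \<otimes> \<xi>\<^sup>*\<close> satisfies this equation.

  The index sets of the model form are, together with the empty and the full set, the words of the
  extended Hamming code. In a positive orthonormal frame the sixteen signed monomials of
  \<open>1 + \<Phi>\<^sub>0 + \<nu>\<close>, where \<open>\<Phi>\<^sub>0\<close> is the model form in the frame, form a commutative group with four
  generators, and the operator of this polyform is sixteen times the projection to the spinors fixed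
  by the group. Every such frame has a nonzero fixed spinor (\<open>adapted_spinor_exists\<close>). Every nonzero positive spinor is
  fixed by the group of some frame, which is built by means of the triple cross product
  \<open>\<gamma> w \<xi> = \<gamma> x \<gamma> y \<gamma> z \<xi>\<close> (\<open>adapted_frame_exists\<close>). So \<open>\<alpha>\<close> is the square of a positive spinor
  exactly if \<open>\<Phi>\<close> is a positive multiple of the model form in a positive orthonormal frame
  (\<open>adapted_square\<close>).

  Such multiples are the conformal \<open>Spin(7)\<close> forms (\<open>conformal_spin7_pos_form_iff\<close>). Here it has to be
  shown that a \<open>Spin(7)\<close> form determines its metric (\<open>cayley_form_metric\<close>): if two metrics induce the
  same form, one takes a frame that is orthogonal for both and compares the norms and the
  self-duality of the form with respect to them.

  Nothing is computed with the geometric product beyond multiplication by covectors, which inserts or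
  removes an index (\<open>\<Psi>_covector_mono_op\<close>); the multiplication table of the monomials and all
  frame-independence statements follow from this and from traces.
\<close>

section \<open>Reordering signs\<close>

text \<open>
  For disjoint sets this is the sign of the permutation that sorts the elements of \<open>A\<close> followed by
  those of \<open>B\<close>. On overlapping sets it is multiplicative for symmetric differences in both arguments,
  which makes it the structure constant of the Clifford algebra in the basis of monomials.
\<close>

definition reorder_sign :: "nat set \<Rightarrow> nat set \<Rightarrow> real" where
  "reorder_sign A B = (\<Prod>i\<in>A. \<Prod>j\<in>B. if j < i then -1 else 1)"

lemma reorder_sign_cases: "reorder_sign A B = 1 \<or> reorder_sign A B = -1"
proof -
  have *: "(\<Prod>i\<in>C. g i) = 1 \<or> (\<Prod>i\<in>C. g i) = -1"
    if "\<And>i. g i = 1 \<or> g i = (-1::real)" for g and C :: "nat set"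
  proof (induction C rule: infinite_finite_induct)
    case (insert x F)
    then show ?case using that[of x] by auto
  qed auto
  show ?thesis
    unfolding reorder_sign_def by (intro * ) auto
qed

lemma reorder_sign_square [simp]: "reorder_sign A B * reorder_sign A B = 1"
  using reorder_sign_cases[of A B] by auto

lemma reorder_sign_empty [simp]: "reorder_sign {} B = 1" "reorder_sign A {} = 1"
  by (simp_all add: reorder_sign_def)

lemma prod_sym_diff:
  fixes g :: "nat \<Rightarrow> real"
  assumes "finite A" "finite B" "\<And>i. g i * g i = 1"
  shows "prod g (sym_diff A B) = prod g A * prod g B"
proof -
  have 1: "prod g A = prod g (A - B) * prod g (A \<inter> B)"
    using prod.Int_Diff[OF assms(1), of g B] by (simp add: mult.commute)
  have 2: "prod g B = prod g (B - A) * prod g (A \<inter> B)"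
    using prod.Int_Diff[OF assms(2), of g A] by (simp add: mult.commute Int_commute)
  have 3: "prod g (A \<inter> B) * prod g (A \<inter> B) = 1"
    using assms(3) by (simp flip: prod.distrib)
  have "prod g (sym_diff A B) = prod g (A - B) * prod g (B - A)"
    using assms by (intro prod.union_disjoint) auto
  then show ?thesis
    using 3 unfolding 1 2 by (simp add: algebra_simps)
qed

lemma reorder_sign_swap_prod:
  "reorder_sign A B = (\<Prod>j\<in>B. \<Prod>i\<in>A. if j < i then -1 else 1)"
  unfolding reorder_sign_def by (rule prod.swap)

lemma reorder_sign_sym_diff_right:
  assumes "finite B" "finite C"
  shows "reorder_sign A (sym_diff B C) = reorder_sign A B * reorder_sign A C"
  unfolding reorder_sign_swap_prod
  by (rule prod_sym_diff) (use assms in \<open>auto simp flip: prod.distrib intro!: prod.neutral\<close>)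

lemma reorder_sign_Un_left:
  assumes "finite A" "finite B" "A \<inter> B = {}"
  shows "reorder_sign (A \<union> B) C = reorder_sign A C * reorder_sign B C"
  unfolding reorder_sign_def using assms by (intro prod.union_disjoint) auto

lemma reorder_sign_Un_right:
  assumes "finite B" "finite C" "B \<inter> C = {}"
  shows "reorder_sign A (B \<union> C) = reorder_sign A B * reorder_sign A C"
  unfolding reorder_sign_swap_prod using assms by (intro prod.union_disjoint) auto

lemma reorder_sign_insert_left:
  assumes "finite A" "i \<notin> A"
  shows "reorder_sign (insert i A) C = reorder_sign {i} C * reorder_sign A C"
  using reorder_sign_Un_left[of "{i}" A C] assms by simp

lemma reorder_sign_insert_right:
  assumes "finite B" "i \<notin> B"
  shows "reorder_sign A (insert i B) = reorder_sign A {i} * reorder_sign A B"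
  using reorder_sign_Un_right[of "{i}" B A] assms by simp

lemma reorder_sign_below:
  assumes "\<And>i j. i \<in> A \<Longrightarrow> j \<in> B \<Longrightarrow> i \<le> j"
  shows "reorder_sign A B = 1"
  unfolding reorder_sign_def using assms by (intro prod.neutral ballI) force+

lemma reorder_sign_commute:
  assumes "finite A" "finite B"
  shows "reorder_sign A B * reorder_sign B A = (-1) ^ (card A * card B + card (A \<inter> B))"
proof -
  have "reorder_sign A B * reorder_sign B A = (\<Prod>i\<in>A. \<Prod>j\<in>B. if i = j then 1 else -1)"
    unfolding reorder_sign_def[of A B] reorder_sign_swap_prod[of B A] prod.distrib[symmetric]
    by (intro prod.cong refl) auto
  also have "\<dots> = (\<Prod>i\<in>A. (-1) ^ card B * (if i \<in> B then -1 else 1))"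
  proof (rule prod.cong[OF refl])
    fix i assume "i \<in> A"
    have "(\<Prod>j\<in>B. if i = j then 1 else -1::real) = (\<Prod>j\<in>B. -1 * (if j = i then -1 else 1))"
      by (intro prod.cong) auto
    also have "\<dots> = (-1) ^ card B * (if i \<in> B then -1 else 1)"
      unfolding prod.distrib using assms by (simp add: prod.delta)
    finally show "(\<Prod>j\<in>B. if i = j then 1 else -1::real) = (-1) ^ card B * (if i \<in> B then -1 else 1)" .
  qed
  also have "\<dots> = (-1) ^ (card A * card B + card (A \<inter> B))"
    unfolding prod.distrib using assms
    by (simp add: prod.If_cases power_add mult.commute Int_def flip: power_mult)
  finally show ?thesis .
qed

lemma reorder_sign_swap:
  assumes "finite A" "finite B"
  shows "reorder_sign A B = (-1) ^ (card A * card B + card (A \<inter> B)) * reorder_sign B A"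
  unfolding reorder_sign_commute[OF assms, symmetric] by (simp add: mult.assoc)

lemma reorder_sign_self:
  assumes "finite A"
  shows "reorder_sign A A = (-1) ^ (card A choose 2)"
  using assms
proof (induction A rule: finite_linorder_max_induct)
  case (insert b A)
  then have b: "b \<notin> A" by auto
  have "reorder_sign (insert b A) (insert b A)
      = reorder_sign {b} {b} * reorder_sign {b} A * (reorder_sign A {b} * reorder_sign A A)"
    using insert b reorder_sign_insert_right[of A b "{b}"] reorder_sign_insert_right[of A b A]
    by (simp add: reorder_sign_insert_left[of A b])
  also have "reorder_sign {b} {b} = 1" by (simp add: reorder_sign_def)
  also have "reorder_sign A {b} = 1" using insert by (intro reorder_sign_below) auto
  also have "reorder_sign {b} A = (-1) ^ card A"
    using insert by (simp add: reorder_sign_def)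
  finally show ?case
    using insert b by (simp add: power_add numeral_2_eq_2)
qed (simp add: numeral_2_eq_2)

lemma shuffle_sign_eq_reorder_sign:
  assumes "S \<subseteq> {..<n}"
  shows "shuffle_sign n S = reorder_sign S ({..<n} - S)"
proof -
  have fin: "finite S" using assms finite_subset by blast
  have "reorder_sign S ({..<n} - S)
      = (\<Prod>(i, j)\<in>S \<times> ({..<n} - S). if j < i then -1 else 1)"
    unfolding reorder_sign_def by (simp add: prod.cartesian_product)
  also have "\<dots> = (\<Prod>p\<in>{(i, j). i \<in> S \<and> j \<in> {..<n} - S \<and> j < i}. -1)"
    using fin by (intro prod.mono_neutral_cong_right) (auto split: if_splits)
  finally show ?thesis by (simp add: shuffle_sign_def)
qed

section \<open>Alternating forms and their wedge product\<close>

lemma polyform_linear: "\<alpha> \<in> polyforms \<Longrightarrow> i < length xs \<Longrightarrow> linear (\<lambda>v. \<alpha> (xs[i := v]))"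
  by (simp add: polyforms_def)

lemma polyform_eq_0: "\<alpha> \<in> polyforms \<Longrightarrow> \<not> distinct xs \<Longrightarrow> \<alpha> xs = 0"
  by (simp add: polyforms_def)

lemma polyform_linear_Cons: "\<alpha> \<in> polyforms \<Longrightarrow> linear (\<lambda>v. \<alpha> (v # xs))"
  using polyform_linear[of \<alpha> 0 "undefined # xs"] by simp

lemma interior_prod_polyform:
  assumes "\<alpha> \<in> polyforms"
  shows "interior_prod v \<alpha> \<in> polyforms"
  using polyform_linear[OF assms, of "Suc _" "v # _"] polyform_eq_0[OF assms]
  by (auto simp: polyforms_def interior_prod_def)

lemma zero_polyform: "(\<lambda>_. 0) \<in> polyforms"
  by (simp add: polyforms_def Real_Vector_Spaces.linear_iff)

lemma scale_polyform:
  assumes "\<alpha> \<in> polyforms"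
  shows "(\<lambda>xs. a * \<alpha> xs) \<in> polyforms"
proof -
  have "linear (\<lambda>v. a * \<alpha> (xs[i := v]))" if "i < length xs" for xs i
    using linear_compose_scale_right[OF polyform_linear[OF assms that], of a] by simp
  then show ?thesis using polyform_eq_0[OF assms] by (auto simp: polyforms_def)
qed

lemma add_polyform:
  assumes "\<alpha> \<in> polyforms" "\<beta> \<in> polyforms"
  shows "(\<lambda>xs. \<alpha> xs + \<beta> xs) \<in> polyforms"
  using assms by (auto simp: polyforms_def intro: linear_compose_add)

lemma sum_polyform:
  assumes "\<And>i. i \<in> I \<Longrightarrow> \<alpha> i \<in> polyforms"
  shows "(\<lambda>xs. \<Sum>i\<in>I. \<alpha> i xs) \<in> polyforms"
  using assms
  by (induction I rule: infinite_finite_induct) (auto intro: zero_polyform add_polyform)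

lemma diff_polyform:
  assumes "\<alpha> \<in> polyforms" "\<beta> \<in> polyforms"
  shows "(\<lambda>xs. \<alpha> xs - \<beta> xs) \<in> polyforms"
  using add_polyform[OF assms(1) scale_polyform[OF assms(2), of "-1"]] by simp

text \<open>
  The weight \<open>(-1)\<^sup>k\<close> is the sign in the antiderivation rule for contractions; indicator functions
  extract homogeneous parts.
\<close>

lemma degree_weighted_polyform:
  assumes "\<alpha> \<in> polyforms"
  shows "(\<lambda>xs. w (length xs) * \<alpha> xs) \<in> polyforms"
proof -
  have "linear (\<lambda>v. w (length xs) * \<alpha> (xs[i := v]))" if "i < length xs" for xs i
    using linear_compose_scale_right[OF polyform_linear[OF assms that], of "w (length xs)"] by simp
  then show ?thesis using polyform_eq_0[OF assms] by (auto simp: polyforms_def)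
qed

lemma one_form_polyform: "one_form \<in> polyforms"
  by (auto simp: polyforms_def one_form_def Real_Vector_Spaces.linear_iff)

lemma polyform_swap:
  assumes "\<alpha> \<in> polyforms"
  shows "\<alpha> (a # b # xs) = - \<alpha> (b # a # xs)"
proof -
  have lin1: "\<alpha> ((u + v) # ys) = \<alpha> (u # ys) + \<alpha> (v # ys)" for u v ys
    using linear_add[OF polyform_linear_Cons[OF assms]] .
  have lin2: "\<alpha> (w # (u + v) # ys) = \<alpha> (w # u # ys) + \<alpha> (w # v # ys)" for u v w ys
    using linear_add[OF polyform_linear_Cons[OF interior_prod_polyform[OF assms, of w]]]
    by (simp add: interior_prod_def)
  have "0 = \<alpha> ((a + b) # (a + b) # xs)"
    using polyform_eq_0[OF assms] by simp
  also have "\<dots> = \<alpha> (a # b # xs) + \<alpha> (b # a # xs)"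
    using polyform_eq_0[OF assms] by (simp add: lin1 lin2)
  finally show ?thesis by simp
qed

lemma polyform_move:
  assumes "\<alpha> \<in> polyforms"
  shows "\<alpha> (a # xs @ ys) = (-1) ^ length xs * \<alpha> (xs @ a # ys)"
  using assms
proof (induction xs arbitrary: \<alpha>)
  case (Cons x xs)
  have "\<alpha> (a # x # xs @ ys) = - interior_prod x \<alpha> (a # xs @ ys)"
    using polyform_swap[OF Cons.prems, of a x "xs @ ys"] by (simp add: interior_prod_def)
  also have "\<dots> = - ((-1) ^ length xs * interior_prod x \<alpha> (xs @ a # ys))"
    using Cons.IH[OF interior_prod_polyform[OF Cons.prems]] by simp
  finally show ?case by (simp add: interior_prod_def)
qed simp

lemma nths_split:
  assumes "i < length e"
  shows "nths e A = nths e (A \<inter> {..<i}) @ (if i \<in> A then [e ! i] else []) @ nths e (A \<inter> {i<..})"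
  using assms
proof (induction e arbitrary: i A)
  case (Cons x e)
  show ?case
  proof (cases i)
    case (Suc k)
    have "nths e {j. Suc j \<in> A} = nths e ({j. Suc j \<in> A} \<inter> {..<k})
      @ (if Suc k \<in> A then [e ! k] else []) @ nths e ({j. Suc j \<in> A} \<inter> {k<..})"
      using Cons.IH[of k "{j. Suc j \<in> A}"] Cons.prems Suc by simp
    moreover have "{j. Suc j \<in> A} \<inter> {..<k} = {j. Suc j \<in> A \<inter> {..<i}}"
      "{j. Suc j \<in> A} \<inter> {k<..} = {j. Suc j \<in> A \<inter> {i<..}}"
      using Suc by auto
    ultimately show ?thesis using Suc by (simp add: nths_Cons)
  qed (auto simp: nths_Cons intro!: arg_cong[where f = "nths e"])
qed simp

lemma length_nths_subset: "S \<subseteq> {..<length e} \<Longrightarrow> length (nths e S) = card S"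
  unfolding length_nths by (rule arg_cong[of _ _ card]) auto

lemma reorder_sign_singleton: "finite T \<Longrightarrow> reorder_sign {i} T = (-1) ^ card (T \<inter> {..<i})"
  by (simp add: reorder_sign_def prod.If_cases Int_def lessThan_def)

text \<open>
  Moving the new argument to its place in the increasing order costs one sign for every smaller index.
\<close>

lemma polyform_Cons_nths:
  assumes "\<alpha> \<in> polyforms" "i < length e" "T \<subseteq> {..<length e}"
  shows "\<alpha> (e ! i # nths e T)
       = (if i \<in> T then 0 else reorder_sign {i} T * \<alpha> (nths e (insert i T)))"
proof (cases "i \<in> T")
  case True
  then have "e ! i \<in> set (nths e T)" using assms by (auto simp: set_nths)
  then show ?thesis using True polyform_eq_0[OF assms(1)] by simp
next
  case False
  have fin: "finite T" using assms finite_subset by blast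
  have 1: "nths e T = nths e (T \<inter> {..<i}) @ nths e (T \<inter> {i<..})"
    using nths_split[OF assms(2), of T] False by simp
  have "insert i T \<inter> {..<i} = T \<inter> {..<i}" "insert i T \<inter> {i<..} = T \<inter> {i<..}" by auto
  then have 2: "nths e (insert i T) = nths e (T \<inter> {..<i}) @ e ! i # nths e (T \<inter> {i<..})"
    using nths_split[OF assms(2), of "insert i T"] by simp
  have "length (nths e (T \<inter> {..<i})) = card (T \<inter> {..<i})"
    using assms by (intro length_nths_subset) auto
  then show ?thesis
    using polyform_move[OF assms(1), of "e ! i" "nths e (T \<inter> {..<i})" "nths e (T \<inter> {i<..})"] False fin
    by (simp add: 1 2 reorder_sign_singleton)
qed

lemma reorder_sign_Suc [simp]: "reorder_sign (Suc ` A) (Suc ` B) = reorder_sign A B"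
  by (simp add: reorder_sign_def prod.reindex)

lemma sum_Pow_insert_0_Suc:
  fixes f :: "nat set \<Rightarrow> 'b::comm_monoid_add"
  assumes "finite T"
  shows "(\<Sum>S\<in>Pow (insert 0 (Suc ` T)). f S)
    = (\<Sum>S\<in>Pow T. f (insert 0 (Suc ` S))) + (\<Sum>S\<in>Pow T. f (Suc ` S))"
proof -
  have inj: "inj_on (image Suc) A" for A
    by (rule inj_onI) (simp add: inj_image_eq_iff)
  have inj2: "inj_on (insert 0) (Pow (Suc ` T))"
    by (rule inj_onI) (auto simp: set_eq_iff)
  have "(\<Sum>S\<in>Pow (insert 0 (Suc ` T)). f S)
    = (\<Sum>S\<in>Pow (Suc ` T). f S) + (\<Sum>S\<in>insert 0 ` Pow (Suc ` T). f S)"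
    unfolding Pow_insert using assms by (intro sum.union_disjoint) auto
  also have "(\<Sum>S\<in>insert 0 ` Pow (Suc ` T). f S) = (\<Sum>S\<in>Pow (Suc ` T). f (insert 0 S))"
    using inj2 by (simp add: sum.reindex)
  also have "Pow (Suc ` T) = image Suc ` Pow T"
    by (simp add: image_Pow_surj)
  finally show ?thesis
    by (simp add: sum.reindex[OF inj] add.commute)
qed

lemma wedge_Nil [simp]: "wedge \<alpha> \<beta> [] = \<alpha> [] * \<beta> []"
  by (simp add: wedge_def shuffle_sign_def)

text \<open>Contraction is an antiderivation; with \<open>wedge_Nil\<close> this determines the wedge product.\<close>

lemma wedge_Cons:
  "wedge \<alpha> \<beta> (x # xs) = wedge (interior_prod x \<alpha>) \<beta> xs
     + wedge (\<lambda>ys. (-1) ^ length ys * \<alpha> ys) (interior_prod x \<beta>) xs"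
proof -
  define m where "m = length xs"
  have U: "{..<Suc m} = insert 0 (Suc ` {..<m})"
    by (simp add: lessThan_Suc_eq_insert_0)
  have nths1: "nths (x # xs) (insert 0 (Suc ` S)) = x # nths xs S" for S
    by (simp add: nths_Cons image_iff)
  have nths2: "nths (x # xs) (Suc ` S) = nths xs S" for S
    by (simp add: nths_Cons image_iff)
  have D1: "insert 0 (Suc ` {..<m}) - insert 0 (Suc ` S) = Suc ` ({..<m} - S)"
    and D2: "insert 0 (Suc ` {..<m}) - Suc ` S = insert 0 (Suc ` ({..<m} - S))" for S
    by auto
  have sign1: "shuffle_sign (Suc m) (insert 0 (Suc ` S)) = shuffle_sign m S"
    if "S \<subseteq> {..<m}" for S
  proof -
    have "finite S" using that finite_subset by blast
    moreover have "insert 0 (Suc ` S) \<subseteq> {..<Suc m}" using that by auto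
    ultimately show ?thesis
      using that reorder_sign_below[of "{0}" "Suc ` ({..<m} - S)"] reorder_sign_insert_left[of "Suc ` S" 0]
      by (simp add: shuffle_sign_eq_reorder_sign U D1 del: lessThan_Suc)
  qed
  have sign2: "shuffle_sign (Suc m) (Suc ` S) = (-1) ^ card S * shuffle_sign m S"
    if "S \<subseteq> {..<m}" for S
  proof -
    have "finite S" using that finite_subset by blast
    moreover have "Suc ` S \<subseteq> {..<Suc m}" using that by auto
    moreover have "reorder_sign (Suc ` S) {0} = (-1) ^ card S"
      by (simp add: reorder_sign_def prod.reindex)
    ultimately show ?thesis
      using that
      by (simp add: shuffle_sign_eq_reorder_sign U D2 reorder_sign_insert_right[of "Suc ` ({..<m} - S)" 0] del: lessThan_Suc)
  qed
  have "wedge \<alpha> \<beta> (x # xs)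
     = (\<Sum>S\<in>Pow {..<m}. shuffle_sign m S * \<alpha> (x # nths xs S) * \<beta> (nths xs ({..<m} - S)))
     + (\<Sum>S\<in>Pow {..<m}. shuffle_sign m S * ((-1) ^ card S * \<alpha> (nths xs S))
         * \<beta> (x # nths xs ({..<m} - S)))"
    unfolding wedge_def list.size add_Suc_right add_0_right m_def[symmetric]
    by (simp add: U sum_Pow_insert_0_Suc nths1 nths2 D1 D2 del: lessThan_Suc)
      (intro arg_cong2[of _ _ _ _ "(+)"] sum.cong refl;
        simp add: sign1 sign2 flip: U del: lessThan_Suc)
  also have "(\<Sum>S\<in>Pow {..<m}. shuffle_sign m S * ((-1) ^ card S * \<alpha> (nths xs S))
         * \<beta> (x # nths xs ({..<m} - S)))
     = wedge (\<lambda>ys. (-1) ^ length ys * \<alpha> ys) (interior_prod x \<beta>) xs"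
    unfolding wedge_def m_def[symmetric] interior_prod_def
    by (intro sum.cong refl) (simp add: length_nths_subset m_def)
  finally show ?thesis
    by (simp add: wedge_def m_def interior_prod_def)
qed

lemma wedge_add_left: "wedge (\<lambda>xs. \<alpha> xs + \<alpha>' xs) \<beta> xs = wedge \<alpha> \<beta> xs + wedge \<alpha>' \<beta> xs"
  by (simp add: wedge_def algebra_simps sum.distrib)

lemma wedge_add_right: "wedge \<alpha> (\<lambda>xs. \<beta> xs + \<beta>' xs) xs = wedge \<alpha> \<beta> xs + wedge \<alpha> \<beta>' xs"
  by (simp add: wedge_def algebra_simps sum.distrib)

lemma wedge_scale_left: "wedge (\<lambda>xs. a * \<alpha> xs) \<beta> xs = a * wedge \<alpha> \<beta> xs"
  by (simp add: wedge_def algebra_simps sum_distrib_left)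

lemma wedge_scale_right: "wedge \<alpha> (\<lambda>xs. a * \<beta> xs) xs = a * wedge \<alpha> \<beta> xs"
  by (simp add: wedge_def algebra_simps sum_distrib_left)

lemma linear_wedge_interior:
  assumes "\<alpha> \<in> polyforms"
  shows "linear (\<lambda>v. wedge (interior_prod v \<alpha>) \<beta> xs)"
    and "linear (\<lambda>v. wedge \<beta> (interior_prod v \<alpha>) xs)"
proof -
  have *: "interior_prod (u + v) \<alpha> = (\<lambda>ys. interior_prod u \<alpha> ys + interior_prod v \<alpha> ys)"
    "interior_prod (a *\<^sub>R u) \<alpha> = (\<lambda>ys. a * interior_prod u \<alpha> ys)" for u v a
    using linear_add[OF polyform_linear_Cons[OF assms]]
      linear_scale[OF polyform_linear_Cons[OF assms]]
    by (auto simp: interior_prod_def)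
  show "linear (\<lambda>v. wedge (interior_prod v \<alpha>) \<beta> xs)"
    "linear (\<lambda>v. wedge \<beta> (interior_prod v \<alpha>) xs)"
    by (rule linearI; simp add: * wedge_add_left wedge_scale_left wedge_add_right wedge_scale_right)+
qed

lemma interior_prod_sign_twist:
  "interior_prod x (\<lambda>ys. (-1) ^ length ys * \<alpha> ys) = (\<lambda>ys. - ((-1) ^ length ys * interior_prod x \<alpha> ys))"
  by (simp add: interior_prod_def fun_eq_iff)

text \<open>
  By the antiderivation rule, linearity in the slots and vanishing on repeated vectors pass from
  shorter to longer lists. If the repeated vector is the first one, it is moved inwards by the
  antisymmetry in the first two slots.
\<close>

lemma wedge_polyform:
  assumes "\<alpha> \<in> polyforms" "\<beta> \<in> polyforms"
  shows "wedge \<alpha> \<beta> \<in> polyforms"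
proof -
  have twist: "(\<lambda>ys. (-1) ^ length ys * \<alpha> ys) \<in> polyforms" if "\<alpha> \<in> polyforms" for \<alpha> :: "'a polyform"
    using degree_weighted_polyform[OF that] .
  have lin: "linear (\<lambda>v. wedge \<alpha> \<beta> (xs[i := v]))"
    if "\<alpha> \<in> polyforms" "\<beta> \<in> polyforms" "i < length xs" for xs i and \<alpha> \<beta> :: "'a polyform"
    using that
  proof (induction xs arbitrary: i \<alpha> \<beta>)
    case (Cons x xs)
    show ?case
    proof (cases i)
      case 0
      then show ?thesis
        by (simp add: wedge_Cons linear_compose_add linear_wedge_interior Cons.prems)
    next
      case (Suc k)
      then show ?thesis
        using Cons.prems
        by (auto simp: wedge_Cons intro!: linear_compose_add Cons.IH interior_prod_polyform twist)
    qed
  qed simp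
  have swap: "wedge \<alpha> \<beta> (x # y # xs) = - wedge \<alpha> \<beta> (y # x # xs)"
    if "\<alpha> \<in> polyforms" "\<beta> \<in> polyforms" for x y xs and \<alpha> \<beta> :: "'a polyform"
  proof -
    have anti: "interior_prod x (interior_prod y \<alpha>) = (\<lambda>ys. -1 * interior_prod y (interior_prod x \<alpha>) ys)"
      if "\<alpha> \<in> polyforms" for \<alpha> :: "'a polyform"
      by (simp add: interior_prod_def fun_eq_iff polyform_swap[OF that, of y x])
    have "wedge (\<lambda>ys. - \<alpha>' ys) \<beta>' zs = - wedge \<alpha>' \<beta>' zs" for \<alpha>' \<beta>' :: "'a polyform" and zs
      using wedge_scale_left[of "-1"] by simp
    moreover have "wedge \<alpha>' (\<lambda>ys. - \<beta>' ys) zs = - wedge \<alpha>' \<beta>' zs" for \<alpha>' \<beta>' :: "'a polyform" and zs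
      using wedge_scale_right[of _ "-1"] by simp
    ultimately show ?thesis
      using that
      by (simp add: wedge_Cons interior_prod_sign_twist anti wedge_scale_left wedge_scale_right)
  qed
  have "wedge \<alpha> \<beta> xs = 0"
    if "\<alpha> \<in> polyforms" "\<beta> \<in> polyforms" "\<not> distinct xs" for xs and \<alpha> \<beta> :: "'a polyform"
    using that
  proof (induction "length xs" arbitrary: xs \<alpha> \<beta>)
    case (Suc n)
    then obtain x ys where xs: "xs = x # ys" by (cases xs) auto
    have tail: "wedge \<alpha> \<beta> (z # zs) = 0" if "length zs = n" "\<not> distinct zs" for z zs
      using that Suc by (simp add: wedge_Cons interior_prod_polyform twist)
    show ?case
    proof (cases "distinct ys")
      case False
      then show ?thesis using tail Suc xs by simp
    next
      case True
      then have "x \<in> set ys" using Suc.prems xs by simp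
      then obtain y zs where ys: "ys = y # zs" by (cases ys) auto
      show ?thesis
      proof (cases "x = y")
        case True
        then show ?thesis using swap[OF Suc.prems(1,2), of x x zs] xs ys by simp
      next
        case False
        then have "\<not> distinct (x # zs)" using \<open>x \<in> set ys\<close> ys by simp
        then show ?thesis
          using swap[OF Suc.prems(1,2), of x y zs] tail[of "x # zs" y] Suc.hyps(2) xs ys by simp
      qed
    qed
  qed simp
  with lin assms show ?thesis by (auto simp: polyforms_def)
qed

text \<open>
  By induction on the list of vectors: the subsets that contain the first index and those that do not
  correspond to the two terms of the antiderivation rule.
\<close>

lemma wedge_nths:
  assumes "T \<subseteq> {..<length e}"
  shows "wedge \<alpha> \<beta> (nths e T)
    = (\<Sum>S\<in>Pow T. reorder_sign S (T - S) * \<alpha> (nths e S) * \<beta> (nths e (T - S)))"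
  using assms
proof (induction e arbitrary: T \<alpha> \<beta>)
  case (Cons x e)
  define T' where "T' = {j. Suc j \<in> T}"
  have T': "T' \<subseteq> {..<length e}" using Cons.prems by (auto simp: T'_def)
  then have fin: "finite T'" using finite_subset by blast
  have finS: "finite S" if "S \<subseteq> T'" for S using that fin finite_subset by blast
  have nths1: "nths (x # e) (insert 0 (Suc ` S)) = x # nths e S" for S
    by (simp add: nths_Cons image_iff)
  have nths2: "nths (x # e) (Suc ` S) = nths e S" for S
    by (simp add: nths_Cons image_iff)
  show ?case
  proof (cases "0 \<in> T")
    case False
    then have T: "T = Suc ` T'" unfolding T'_def by (auto simp: image_iff) (metis not0_implies_Suc)
    have inj: "inj_on (image Suc) (Pow T')" by (rule inj_onI) (simp add: inj_image_eq_iff)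
    have Pow: "Pow T = image Suc ` Pow T'" unfolding T by (simp add: image_Pow_surj)
    show ?thesis
      unfolding Pow by (simp add: sum.reindex[OF inj] T nths2 Cons.IH[OF T'] flip: image_set_diff)
  next
    case True
    then have T: "T = insert 0 (Suc ` T')" unfolding T'_def by (auto simp: image_iff) (metis not0_implies_Suc)
    have D1: "insert 0 (Suc ` T') - insert 0 (Suc ` S) = Suc ` (T' - S)"
      and D2: "insert 0 (Suc ` T') - Suc ` S = insert 0 (Suc ` (T' - S))" for S
      by auto
    have sign1: "reorder_sign (insert 0 (Suc ` S)) (Suc ` B) = reorder_sign S B" if "S \<subseteq> T'" for S B
      using reorder_sign_below[of "{0}" "Suc ` B"] finS[OF that] by (simp add: reorder_sign_insert_left[of "Suc ` S" 0])
    have sign2: "reorder_sign (Suc ` S) (insert 0 (Suc ` (T' - S)))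
        = (-1) ^ length (nths e S) * reorder_sign S (T' - S)" if "S \<subseteq> T'" for S
      using that fin T' length_nths_subset[of S e]
      by (simp add: reorder_sign_insert_right[of "Suc ` (T' - S)" 0]) (simp add: reorder_sign_def prod.reindex)
    show ?thesis
      unfolding T by (simp add: nths1 nths2 wedge_Cons sum_Pow_insert_0_Suc[OF fin] D1 D2 Cons.IH[OF T']
          sign1 sign2 interior_prod_def mult.commute mult.left_commute)
  qed
qed simp

section \<open>Orthonormal frames\<close>

definition frame :: "'a::euclidean_space list \<Rightarrow> bool" where
  "frame e \<longleftrightarrow> orthonormal_list e \<and> length e = DIM('a)"

lemma frame_inner:
  fixes e :: "'a::euclidean_space list"
  assumes "frame e" "i < DIM('a)" "j < DIM('a)"
  shows "e ! i \<bullet> e ! j = (if i = j then 1 else 0)"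
  using assms by (simp add: frame_def orthonormal_list_def)

lemma frame_length: "frame (e :: 'a::euclidean_space list) \<Longrightarrow> length e = DIM('a)"
  by (simp add: frame_def)

lemma orthonormal_list_distinct:
  fixes e :: "'a::euclidean_space list"
  assumes "orthonormal_list e"
  shows "distinct e"
  unfolding distinct_conv_nth
proof (intro allI impI notI)
  fix i j assume ij: "i < length e" "j < length e" "i \<noteq> j" "e ! i = e ! j"
  have "e ! i \<bullet> e ! j = 0" using assms ij(1-3) by (simp add: orthonormal_list_def)
  moreover have "e ! i \<bullet> e ! i = 1" using assms ij(1) by (simp add: orthonormal_list_def)
  ultimately show False using ij(4) by simp
qed

text \<open>
  An orthonormal list of full length spans the space, so that a vector orthogonal to it vanishes.
\<close>

lemma frame_eqI:
  fixes e :: "'a::euclidean_space list"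
  assumes "frame e" "\<And>i. i < DIM('a) \<Longrightarrow> v \<bullet> e ! i = w \<bullet> e ! i"
  shows "v = w"
proof -
  have dist: "distinct e" using assms orthonormal_list_distinct by (auto simp: frame_def)
  have "pairwise orthogonal (set e)" "0 \<notin> set e"
    using frame_inner[OF assms(1)] frame_length[OF assms(1)]
    by (fastforce simp: pairwise_def orthogonal_def in_set_conv_nth)+
  then have "independent (set e)" by (rule pairwise_orthogonal_independent)
  then have "span (set e) = UNIV"
    using dist frame_length[OF assms(1)]
    by (metis card_eq_dim dim_UNIV distinct_card dim_eq_full dim_eq_card_independent)
  then have in_span: "v - w \<in> span (set e)" by simp
  have orth: "orthogonal (v - w) x" if "x \<in> set e" for x
    using that assms(2) frame_length[OF assms(1)]
    by (auto simp: in_set_conv_nth orthogonal_def inner_diff_left)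
  have "orthogonal (v - w) (v - w)"
    by (rule orthogonal_to_span[OF in_span orth])
  then show ?thesis by (simp add: orthogonal_def)
qed

lemma frame_expansion:
  fixes e :: "'a::euclidean_space list"
  assumes "frame e"
  shows "v = (\<Sum>i<DIM('a). (v \<bullet> e ! i) *\<^sub>R e ! i)"
proof (rule frame_eqI[OF assms])
  fix j assume j: "j < DIM('a)"
  have "(\<Sum>i<DIM('a). (v \<bullet> e ! i) *\<^sub>R e ! i) \<bullet> e ! j
      = (\<Sum>i<DIM('a). if i = j then v \<bullet> e ! i else 0)"
    unfolding inner_sum_left using frame_inner[OF assms _ j] by (intro sum.cong) auto
  then show "v \<bullet> e ! j = (\<Sum>i<DIM('a). (v \<bullet> e ! i) *\<^sub>R e ! i) \<bullet> e ! j"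
    using j by simp
qed

lemma frame_inner_sum:
  fixes e :: "'a::euclidean_space list"
  assumes "frame e"
  shows "v \<bullet> w = (\<Sum>i<DIM('a). (v \<bullet> e ! i) * (w \<bullet> e ! i))"
  by (subst frame_expansion[OF assms, of v], subst inner_sum_left) (simp add: inner_commute)

lemma Basis_frame:
  obtains e :: "'a::euclidean_space list" where "frame e" "set e = Basis"
proof -
  obtain e :: "'a list" where e: "set e = Basis" "distinct e"
    using finite_distinct_list[OF finite_Basis] by blast
  then have "length e = DIM('a)" by (metis distinct_card)
  moreover have "e ! i \<in> Basis" if "i < length e" for i using that e(1) nth_mem by blast
  ultimately have "frame e"
    unfolding frame_def orthonormal_list_def using e(2)
    by (simp add: inner_Basis nth_eq_iff_index_eq)
  then show ?thesis using that e by blast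
qed

text \<open>
  An alternating form is determined by its coefficients: expand the first argument in the frame
  and recurse on the contraction with each frame vector.
\<close>

lemma polyform_eqI:
  fixes e :: "'a::euclidean_space list"
  assumes e: "frame e" and "\<alpha> \<in> polyforms" "\<beta> \<in> polyforms"
    and eq: "\<And>T. T \<subseteq> {..<DIM('a)} \<Longrightarrow> \<alpha> (nths e T) = \<beta> (nths e T)"
  shows "\<alpha> = \<beta>"
proof -
  have vanish: "\<delta> xs = 0"
    if "\<delta> \<in> polyforms" "\<And>T. T \<subseteq> {..<DIM('a)} \<Longrightarrow> \<delta> (nths e T) = 0" for \<delta> :: "'a polyform" and xs
    using that
  proof (induction xs arbitrary: \<delta>)
    case Nil
    then show ?case using Nil.prems(2)[of "{}"] by simp
  next
    case (Cons x xs)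
    have step: "\<delta> (e ! i # xs) = 0" if i: "i < DIM('a)" for i
    proof -
      have "interior_prod (e ! i) \<delta> (nths e T) = 0" if "T \<subseteq> {..<DIM('a)}" for T
        using polyform_Cons_nths[OF Cons.prems(1), of i e T] Cons.prems(2)[of "insert i T"] that i
          frame_length[OF e]
        by (simp add: interior_prod_def)
      then have "interior_prod (e ! i) \<delta> xs = 0"
        by (rule Cons.IH[OF interior_prod_polyform[OF Cons.prems(1)]])
      then show ?thesis by (simp add: interior_prod_def)
    qed
    have lin: "linear (\<lambda>v. \<delta> (v # xs))" by (rule polyform_linear_Cons[OF Cons.prems(1)])
    have "\<delta> (x # xs) = \<delta> ((\<Sum>i<DIM('a). (x \<bullet> e ! i) *\<^sub>R e ! i) # xs)"
      by (subst frame_expansion[OF e, of x]) simp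
    also have "\<dots> = (\<Sum>i<DIM('a). (x \<bullet> e ! i) *\<^sub>R \<delta> (e ! i # xs))"
      unfolding linear_sum[OF lin] linear_scale[OF lin] ..
    also have "\<dots> = 0" using step by simp
    finally show ?case .
  qed
  have "\<alpha> xs - \<beta> xs = 0" for xs
    by (rule vanish[OF diff_polyform[OF assms(2,3)]]) (simp add: eq)
  then show ?thesis by (simp add: fun_eq_iff)
qed

section \<open>Monomials\<close>

definition covector :: "'a::real_inner \<Rightarrow> 'a polyform" where
  "covector v xs = (case xs of [w] \<Rightarrow> v \<bullet> w | _ \<Rightarrow> 0)"

lemma covector_form: "covector v \<in> forms 1"
proof -
  have "linear (\<lambda>w. covector v (xs[i := w]))" if "i < length xs" for xs i
  proof (cases "length xs = 1")
    case True
    then obtain x where "xs = [x]" by (cases xs) auto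
    then show ?thesis using that
      by (auto simp: covector_def inner_add_right intro!: linearI)
  next
    case False
    then have "covector v (xs[i := w]) = 0" for w
      by (cases "xs[i := w]"; cases "tl (xs[i := w])")
        (auto simp: covector_def split: list.splits dest!: arg_cong[of _ _ length])
    then show ?thesis by (simp add: Real_Vector_Spaces.linear_iff)
  qed
  then show ?thesis
    by (auto simp: forms_def polyforms_def covector_def split: list.splits)
qed

lemma form_polyform: "\<alpha> \<in> forms k \<Longrightarrow> \<alpha> \<in> polyforms"
  by (simp add: forms_def)

lemma form_eq_0: "\<alpha> \<in> forms k \<Longrightarrow> length xs \<noteq> k \<Longrightarrow> \<alpha> xs = 0"
  by (simp add: forms_def)

lemma sharp_covector: "sharp (covector v) = v"
  by (simp add: sharp_def covector_def euclidean_representation)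

lemma nths_insert_single: "i < length e \<Longrightarrow> nths e {i} = [e ! i]"
proof -
  assume i: "i < length e"
  have "{i} \<inter> {..<i} = {}" "{i} \<inter> {i<..} = {}" by auto
  then show ?thesis using nths_split[OF i, of "{i}"] by simp
qed

lemma covector_nths:
  fixes e :: "'a::euclidean_space list"
  assumes e: "frame e" and "S \<subseteq> {..<DIM('a)}" "i < DIM('a)"
  shows "covector (e ! i) (nths e S) = (if S = {i} then 1 else 0)"
proof (cases "card S = 1")
  case True
  then obtain j where "S = {j}" by (auto simp: card_1_singleton_iff)
  then show ?thesis
    using assms frame_inner[OF e assms(3), of j]
    by (simp add: nths_insert_single frame_length covector_def)
next
  case False
  then have "length (nths e S) \<noteq> 1"
    using assms by (simp add: length_nths_subset frame_length)
  then show ?thesis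
    using False form_eq_0[OF covector_form, of "nths e S"] by auto
qed

lemma wedge_covector_nths:
  fixes e :: "'a::euclidean_space list"
  assumes e: "frame e" and T: "T \<subseteq> {..<DIM('a)}" and i: "i < DIM('a)"
  shows "wedge (covector (e ! i)) \<beta> (nths e T)
    = (if i \<in> T then reorder_sign {i} (T - {i}) * \<beta> (nths e (T - {i})) else 0)"
proof -
  have fin: "finite T" using T finite_subset by blast
  have "wedge (covector (e ! i)) \<beta> (nths e T)
    = (\<Sum>S\<in>Pow T. if S = {i} then reorder_sign S (T - S) * \<beta> (nths e (T - S)) else 0)"
    using T frame_length[OF e]
    by (subst wedge_nths) (auto intro!: sum.cong simp: covector_nths[OF e _ i])
  also have "\<dots> = (if i \<in> T then reorder_sign {i} (T - {i}) * \<beta> (nths e (T - {i})) else 0)"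
    using fin by (simp add: sum.delta)
  finally show ?thesis .
qed

definition monomial :: "'a::real_inner list \<Rightarrow> nat list \<Rightarrow> 'a polyform" where
  "monomial e is = foldr wedge (map (\<lambda>i. covector (e ! i)) is) one_form"

lemma monomial_polyform: "monomial e is \<in> polyforms"
  unfolding monomial_def
  by (induction "is")
    (simp_all add: one_form_polyform wedge_polyform form_polyform[OF covector_form])

lemma monomial_nths:
  fixes e :: "'a::euclidean_space list"
  assumes e: "frame e" and "sorted_wrt (<) is" "set is \<subseteq> {..<DIM('a)}" "T \<subseteq> {..<DIM('a)}"
  shows "monomial e is (nths e T) = (if T = set is then 1 else 0)"
  using assms(2-)
proof (induction "is" arbitrary: T)
  case Nil
  show ?case
  proof (cases "T = {}")
    case False
    then have "length (nths e T) \<noteq> 0"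
      using Nil frame_length[OF e] finite_subset[OF Nil(3)] by (simp add: length_nths_subset)
    then show ?thesis using False by (simp add: monomial_def one_form_def)
  qed (simp add: monomial_def one_form_def)
next
  case (Cons i "is")
  have "monomial e (i # is) (nths e T)
      = (if i \<in> T then reorder_sign {i} (T - {i}) * monomial e is (nths e (T - {i})) else 0)"
    using Cons.prems wedge_covector_nths[OF e, of T i "monomial e is"]
    by (simp add: monomial_def)
  also have "\<dots> = (if i \<in> T then reorder_sign {i} (T - {i}) * (if T - {i} = set is then 1 else 0) else 0)"
  proof -
    have "monomial e is (nths e (T - {i})) = (if T - {i} = set is then 1 else 0)"
      using Cons.prems by (intro Cons.IH) auto
    then show ?thesis by simp
  qed
  also have "\<dots> = (if T = set (i # is) then 1 else 0)"
  proof (cases "i \<in> T \<and> T - {i} = set is")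
    case True
    moreover have "reorder_sign {i} (set is) = 1"
      using Cons.prems by (intro reorder_sign_below) force
    ultimately show ?thesis by auto
  next
    case False
    moreover have "i \<notin> set is" using Cons.prems by auto
    ultimately have "T \<noteq> set (i # is)" by auto
    then show ?thesis using False by auto
  qed
  finally show ?case .
qed

section \<open>Traces of linear operators\<close>

definition op_inner :: "('s::euclidean_space \<Rightarrow> 's) \<Rightarrow> ('s \<Rightarrow> 's) \<Rightarrow> real" where
  "op_inner A B = (\<Sum>b\<in>Basis. A b \<bullet> B b)"

definition op_trace :: "('s::euclidean_space \<Rightarrow> 's) \<Rightarrow> real" where
  "op_trace A = (\<Sum>b\<in>Basis. A b \<bullet> b)"

text \<open>
  Both sides expand to the same double sum of products of matrix entries.
\<close>

lemma op_trace_commute: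
  fixes A B :: "'s::euclidean_space \<Rightarrow> 's"
  assumes "linear A" "linear B"
  shows "op_trace (\<lambda>x. A (B x)) = op_trace (\<lambda>x. B (A x))"
proof -
  have expand: "op_trace (\<lambda>x. F (G x)) = (\<Sum>b\<in>Basis. \<Sum>c\<in>Basis. (G b \<bullet> c) * (F c \<bullet> b))"
    if "linear F" for F G :: "'s \<Rightarrow> 's"
  proof -
    have "F (G b) = (\<Sum>c\<in>Basis. (G b \<bullet> c) *\<^sub>R F c)" for b
      using linear_sum[OF that, of "\<lambda>c. (G b \<bullet> c) *\<^sub>R c" Basis] linear_scale[OF that]
      by (simp add: euclidean_representation)
    then show ?thesis by (simp add: op_trace_def inner_sum_left)
  qed
  show ?thesis
    unfolding expand[OF assms(1)] expand[OF assms(2)]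
    by (subst sum.swap) (simp add: mult.commute)
qed

lemma op_inner_self_eq_0:
  fixes A :: "'s::euclidean_space \<Rightarrow> 's"
  assumes "linear A" "op_inner A A = 0"
  shows "A x = 0"
proof -
  have "A b = 0" if "b \<in> Basis" for b
    using assms(2) that by (simp add: op_inner_def sum_nonneg_eq_0_iff)
  then show ?thesis
    by (rule linear_eq_on_span[OF assms(1) linear_zero, where B = Basis]) auto
qed

lemma monomial_set_nths:
  fixes e :: "'a::euclidean_space list"
  assumes "frame e" "S \<subseteq> {..<DIM('a)}" "T \<subseteq> {..<DIM('a)}"
  shows "monomial e (sorted_list_of_set S) (nths e T) = (if T = S then 1 else 0)"
  using assms finite_subset[OF assms(2)]
  by (subst monomial_nths) (auto simp: strict_sorted_list_of_set)

section \<open>The Clifford module\<close>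

locale spinor_module =
  fixes ori :: "'a::euclidean_space list set"
    and gp :: "'a polyform \<Rightarrow> 'a polyform \<Rightarrow> 'a polyform"
    and \<Psi> :: "'a polyform \<Rightarrow> 's::euclidean_space \<Rightarrow> 's"
  assumes dim8: "DIM('a) = 8"
    and ori: "orientation ori"
    and gp: "geometric_product gp"
    and module: "clifford_module gp \<Psi>"
    and dim16: "DIM('s) = 16"
    and symmetric: "covectors_symmetric \<Psi>"
begin

lemma linear_\<Psi>: "\<alpha> \<in> polyforms \<Longrightarrow> linear (\<Psi> \<alpha>)"
  using module by (simp add: clifford_module_def)

lemma \<Psi>_one: "\<Psi> one_form \<xi> = \<xi>"
  using module by (simp add: clifford_module_def)

lemma \<Psi>_gp: "\<alpha> \<in> polyforms \<Longrightarrow> \<beta> \<in> polyforms \<Longrightarrow> \<Psi> (gp \<alpha> \<beta>) \<xi> = \<Psi> \<alpha> (\<Psi> \<beta> \<xi>)"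
  using module by (simp add: clifford_module_def)

lemma \<Psi>_combination:
  assumes "\<alpha> \<in> polyforms" "\<beta> \<in> polyforms"
  shows "\<Psi> (\<lambda>xs. a * \<alpha> xs + b * \<beta> xs) \<xi> = a *\<^sub>R \<Psi> \<alpha> \<xi> + b *\<^sub>R \<Psi> \<beta> \<xi>"
proof -
  have "\<Psi> (\<lambda>xs. a * \<alpha> xs + b * \<beta> xs) = (\<lambda>\<xi>. a *\<^sub>R \<Psi> \<alpha> \<xi> + b *\<^sub>R \<Psi> \<beta> \<xi>)"
    using module assms unfolding clifford_module_def by blast
  then show ?thesis by simp
qed

lemma \<Psi>_add:
  assumes "\<alpha> \<in> polyforms" "\<beta> \<in> polyforms"
  shows "\<Psi> (\<lambda>xs. \<alpha> xs + \<beta> xs) \<xi> = \<Psi> \<alpha> \<xi> + \<Psi> \<beta> \<xi>"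
  using \<Psi>_combination[OF assms, of 1 1] by simp

lemma \<Psi>_diff:
  assumes "\<alpha> \<in> polyforms" "\<beta> \<in> polyforms"
  shows "\<Psi> (\<lambda>xs. \<alpha> xs - \<beta> xs) \<xi> = \<Psi> \<alpha> \<xi> - \<Psi> \<beta> \<xi>"
  using \<Psi>_combination[OF assms, of 1 "-1"] by simp

lemma \<Psi>_scale:
  assumes "\<alpha> \<in> polyforms"
  shows "\<Psi> (\<lambda>xs. a * \<alpha> xs) \<xi> = a *\<^sub>R \<Psi> \<alpha> \<xi>"
  using \<Psi>_combination[OF assms assms, of a 0] by simp

lemma \<Psi>_sum:
  assumes "\<And>i. i \<in> I \<Longrightarrow> \<alpha> i \<in> polyforms"
  shows "\<Psi> (\<lambda>xs. \<Sum>i\<in>I. c i * \<alpha> i xs) \<xi> = (\<Sum>i\<in>I. c i *\<^sub>R \<Psi> (\<alpha> i) \<xi>)"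
  using assms
proof (induction I rule: infinite_finite_induct)
  case (insert i I)
  then show ?case by (simp add: \<Psi>_add \<Psi>_scale scale_polyform sum_polyform)
qed (use \<Psi>_scale[OF one_form_polyform, of 0] in simp_all)

lemma gp_covector:
  assumes "\<beta> \<in> polyforms"
  shows "gp (covector v) \<beta> = (\<lambda>xs. wedge (covector v) \<beta> xs + interior_prod v \<beta> xs)"
  using gp assms covector_form[of v] unfolding geometric_product_def
  by (metis sharp_covector)

definition mono_op :: "'a list \<Rightarrow> nat set \<Rightarrow> 's \<Rightarrow> 's" where
  "mono_op e S = \<Psi> (monomial e (sorted_list_of_set S))"

lemma linear_mono_op: "linear (mono_op e S)"
  unfolding mono_op_def by (rule linear_\<Psi>[OF monomial_polyform])

lemma mono_op_empty: "mono_op e {} \<xi> = \<xi>"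
  by (simp add: mono_op_def monomial_def \<Psi>_one)

lemma \<Psi>_expansion:
  assumes e: "frame e" and \<alpha>: "\<alpha> \<in> polyforms"
  shows "\<Psi> \<alpha> \<xi> = (\<Sum>S\<in>Pow {..<DIM('a)}. \<alpha> (nths e S) *\<^sub>R mono_op e S \<xi>)"
proof -
  have "\<alpha> = (\<lambda>xs. \<Sum>S\<in>Pow {..<DIM('a)}. \<alpha> (nths e S) * monomial e (sorted_list_of_set S) xs)"
  proof (rule polyform_eqI[OF e \<alpha>])
    show "(\<lambda>xs. \<Sum>S\<in>Pow {..<DIM('a)}. \<alpha> (nths e S) * monomial e (sorted_list_of_set S) xs) \<in> polyforms"
      by (intro sum_polyform scale_polyform monomial_polyform)
    fix T assume T: "T \<subseteq> {..<DIM('a)}"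
    have "(\<Sum>S\<in>Pow {..<DIM('a)}. \<alpha> (nths e S) * monomial e (sorted_list_of_set S) (nths e T))
        = (\<Sum>S\<in>Pow {..<DIM('a)}. if S = T then \<alpha> (nths e S) else 0)"
      using e T by (intro sum.cong refl) (simp add: monomial_set_nths)
    then show "\<alpha> (nths e T)
        = (\<Sum>S\<in>Pow {..<DIM('a)}. \<alpha> (nths e S) * monomial e (sorted_list_of_set S) (nths e T))"
      using T by simp
  qed
  then have "\<Psi> \<alpha> \<xi> = \<Psi> (\<lambda>xs. \<Sum>S\<in>Pow {..<DIM('a)}. \<alpha> (nths e S) * monomial e (sorted_list_of_set S) xs) \<xi>"
    by simp
  then show ?thesis
    by (simp add: \<Psi>_sum monomial_polyform mono_op_def)
qed

text \<open>
  Clifford multiplication by a frame covector permutes the monomials up to sign, since the wedge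
  part inserts the index and the contraction part removes it.
\<close>

lemma \<Psi>_covector_mono_op:
  assumes e: "frame e" and i: "i < DIM('a)" and S: "S \<subseteq> {..<DIM('a)}"
  shows "\<Psi> (covector (e ! i)) (mono_op e S \<xi>) = reorder_sign {i} S *\<^sub>R mono_op e (sym_diff {i} S) \<xi>"
proof -
  let ?m = "\<lambda>S. monomial e (sorted_list_of_set S)"
  have fin: "finite S" using S finite_subset by blast
  have cov: "covector (e ! i) \<in> polyforms" by (rule form_polyform[OF covector_form])
  have "gp (covector (e ! i)) (?m S) = (\<lambda>xs. reorder_sign {i} S * ?m (sym_diff {i} S) xs)"
  proof (rule polyform_eqI[OF e])
    show "gp (covector (e ! i)) (?m S) \<in> polyforms"
      using gp cov monomial_polyform by (auto simp: geometric_product_def)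
    show "(\<lambda>xs. reorder_sign {i} S * ?m (sym_diff {i} S) xs) \<in> polyforms"
      by (intro scale_polyform monomial_polyform)
    fix T assume T: "T \<subseteq> {..<DIM('a)}"
    then have finT: "finite T" using finite_subset by blast
    have sign: "reorder_sign {i} (sym_diff {i} A) = reorder_sign {i} A" if "finite A" for A
      using reorder_sign_sym_diff_right[of "{i}" A "{i}"] that
      by (simp add: reorder_sign_def)
    have "gp (covector (e ! i)) (?m S) (nths e T)
        = reorder_sign {i} T * (if sym_diff {i} T = S then 1 else 0)"
    proof -
      have "sym_diff {i} T \<subseteq> {..<DIM('a)}" using T i by auto
      then have val: "?m S (nths e (sym_diff {i} T)) = (if sym_diff {i} T = S then 1 else 0)"
        by (rule monomial_set_nths[OF e S])
      have int: "interior_prod (e ! i) (?m S) (nths e T)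
          = (if i \<in> T then 0 else reorder_sign {i} T * ?m S (nths e (insert i T)))"
        unfolding interior_prod_def
        using T i by (intro polyform_Cons_nths monomial_polyform) (simp_all add: frame_length[OF e])
      show ?thesis
      proof (cases "i \<in> T")
        case True
        then have eq: "sym_diff {i} T = T - {i}" by auto
        show ?thesis
          using val sign[OF finT] True unfolding eq
          by (simp add: gp_covector monomial_polyform wedge_covector_nths[OF e T i] int)
      next
        case False
        then have eq: "sym_diff {i} T = insert i T" by auto
        show ?thesis
          using val False unfolding eq
          by (simp add: gp_covector monomial_polyform wedge_covector_nths[OF e T i] int)
      qed
    qed
    also have "\<dots> = reorder_sign {i} S * (if T = sym_diff {i} S then 1 else 0)"
    proof (cases "sym_diff {i} T = S")
      case True
      then have T': "T = sym_diff {i} S" by auto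
      have "reorder_sign {i} S = reorder_sign {i} T" using sign[OF finT] True by simp
      then show ?thesis unfolding if_P[OF True] if_P[OF T'] by simp
    next
      case False
      then have T': "T \<noteq> sym_diff {i} S" by auto
      show ?thesis unfolding if_not_P[OF False] if_not_P[OF T'] by simp
    qed
    also have "\<dots> = reorder_sign {i} S * ?m (sym_diff {i} S) (nths e T)"
      using e T S i by (subst monomial_set_nths) auto
    finally show "gp (covector (e ! i)) (?m S) (nths e T)
        = reorder_sign {i} S * ?m (sym_diff {i} S) (nths e T)" .
  qed
  then have "\<Psi> (gp (covector (e ! i)) (?m S)) \<xi> = reorder_sign {i} S *\<^sub>R \<Psi> (?m (sym_diff {i} S)) \<xi>"
    by (simp add: \<Psi>_scale monomial_polyform)
  then show ?thesis
    by (simp add: \<Psi>_gp cov monomial_polyform mono_op_def)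
qed

lemma mono_op_singleton:
  assumes "frame e" "i < DIM('a)"
  shows "mono_op e {i} = \<Psi> (covector (e ! i))"
  using \<Psi>_covector_mono_op[OF assms, of "{}"] by (auto simp: mono_op_empty)

lemma mono_op_mult:
  assumes e: "frame e" and S: "S \<subseteq> {..<DIM('a)}" and T: "T \<subseteq> {..<DIM('a)}"
  shows "mono_op e S (mono_op e T \<xi>) = reorder_sign S T *\<^sub>R mono_op e (sym_diff S T) \<xi>"
proof -
  have "finite S" using S finite_subset by blast
  then show ?thesis
    using S
  proof (induction S rule: finite_linorder_min_induct)
    case empty
    then show ?case by (simp add: mono_op_empty)
  next
    case (insert i S)
    have i: "i < DIM('a)" "i \<notin> S" and sub: "S \<subseteq> {..<DIM('a)}" using insert by auto
    have finT: "finite T" using T finite_subset by blast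
    have "sym_diff {i} S = insert i S" using i by auto
    moreover have "reorder_sign {i} S = 1" using insert by (intro reorder_sign_below) auto
    ultimately have split: "mono_op e (insert i S) \<eta> = \<Psi> (covector (e ! i)) (mono_op e S \<eta>)" for \<eta>
      using \<Psi>_covector_mono_op[OF e i(1) sub] by simp
    have lin: "linear (\<Psi> (covector (e ! i)))"
      by (rule linear_\<Psi>[OF form_polyform[OF covector_form]])
    have "sym_diff S T \<subseteq> {..<DIM('a)}" using sub T by auto
    then have "mono_op e (insert i S) (mono_op e T \<xi>)
      = (reorder_sign S T * reorder_sign {i} (sym_diff S T)) *\<^sub>R mono_op e (sym_diff {i} (sym_diff S T)) \<xi>"
      using insert sub by (simp add: split linear_scale[OF lin] \<Psi>_covector_mono_op[OF e i(1)])
    also have "reorder_sign {i} (sym_diff S T) = reorder_sign {i} T"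
      using reorder_sign_sym_diff_right[of S T "{i}"] insert.hyps finT \<open>reorder_sign {i} S = 1\<close> by simp
    also have "reorder_sign S T * reorder_sign {i} T = reorder_sign (insert i S) T"
      using reorder_sign_insert_left[of S i T] insert.hyps i by simp
    also have "sym_diff {i} (sym_diff S T) = sym_diff (insert i S) T" using i by auto
    finally show ?case .
  qed
qed

lemma covector_symmetric: "\<Psi> (covector v) \<xi> \<bullet> \<eta> = \<xi> \<bullet> \<Psi> (covector v) \<eta>"
  using symmetric covector_form by (auto simp: covectors_symmetric_def)

lemma mono_op_adjoint:
  assumes e: "frame e" and S: "S \<subseteq> {..<DIM('a)}"
  shows "mono_op e S \<xi> \<bullet> \<eta> = reorder_sign S S * (\<xi> \<bullet> mono_op e S \<eta>)"
proof -
  have "finite S" using S finite_subset by blast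
  then show ?thesis
    using S
  proof (induction S arbitrary: \<xi> \<eta> rule: finite_linorder_min_induct)
    case empty
    then show ?case by (simp add: mono_op_empty)
  next
    case (insert i S)
    have i: "i < DIM('a)" "i \<notin> S" and sub: "S \<subseteq> {..<DIM('a)}" using insert by auto
    have 0: "sym_diff {i} S = insert i S" "sym_diff S {i} = insert i S" using i by auto
    have 1: "reorder_sign {i} S = 1" using insert by (intro reorder_sign_below) auto
    have 2: "mono_op e (insert i S) \<eta> = \<Psi> (covector (e ! i)) (mono_op e S \<eta>)" for \<eta>
      using \<Psi>_covector_mono_op[OF e i(1) sub] 0 1 by simp
    have 3: "mono_op e S (\<Psi> (covector (e ! i)) \<eta>) = reorder_sign S {i} *\<^sub>R mono_op e (insert i S) \<eta>" for \<eta>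
      using mono_op_mult[OF e sub, of "{i}" \<eta>] i 0 mono_op_singleton[OF e i(1)] by simp
    have "mono_op e (insert i S) \<xi> \<bullet> \<eta>
        = reorder_sign S S * reorder_sign S {i} * (\<xi> \<bullet> mono_op e (insert i S) \<eta>)"
      using insert sub by (simp add: 2[of \<xi>] covector_symmetric 3)
    also have "reorder_sign S S * reorder_sign S {i} = reorder_sign (insert i S) (insert i S)"
      using reorder_sign_insert_left[of S i "insert i S"] reorder_sign_insert_right[of S i S]
        reorder_sign_insert_right[of S i "{i}"] insert.hyps i 1
      by (simp add: reorder_sign_def)
    finally show ?case .
  qed
qed

end

section \<open>Sums over ordered and unordered frames\<close>

text \<open>
  One sign serves for all alternating forms, so it cancels in a product of two of them.
\<close>

lemma polyform_permute:
  assumes "mset ys = mset zs"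
  shows "\<exists>s::real. s * s = 1 \<and> (\<forall>\<alpha>\<in>polyforms. \<alpha> ys = s * \<alpha> zs)"
  using assms
proof (induction ys arbitrary: zs)
  case Nil
  then show ?case by (intro exI[of _ 1]) simp
next
  case (Cons y ys)
  then have "y \<in> set zs" by (metis list.set_intros(1) set_mset_mset)
  then obtain us vs where zs: "zs = us @ y # vs" by (meson split_list)
  then obtain s :: real where s: "s * s = 1" "\<And>\<alpha>. \<alpha> \<in> polyforms \<Longrightarrow> \<alpha> ys = s * \<alpha> (us @ vs)"
    using Cons.IH[of "us @ vs"] Cons.prems by auto
  have "\<alpha> (y # ys) = s * (-1) ^ length us * \<alpha> zs" if "\<alpha> \<in> polyforms" for \<alpha> :: "'a polyform"
    using s(2)[OF interior_prod_polyform[OF that, of y]] polyform_move[OF that, of y us vs]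
    by (simp add: interior_prod_def zs)
  moreover have "s * (-1) ^ length us * (s * (-1) ^ length us) = 1"
    using s(1) by (simp add: power2_eq_square[symmetric] power_mult_distrib flip: power_mult)
  ultimately show ?case by blast
qed

text \<open>
  The weights \<open>1 / k!\<close> compensate for the orderings of a set of \<open>k\<close> basis vectors.
\<close>

lemma sum_distinct_lists_Basis:
  fixes G :: "'a::euclidean_space list \<Rightarrow> real"
  assumes e: "frame e" "set e = Basis"
    and G: "\<And>ys zs. mset ys = mset zs \<Longrightarrow> G ys = G zs"
  shows "(\<Sum>xs | set xs \<subseteq> Basis \<and> distinct xs. G xs / fact (length xs))
    = (\<Sum>S\<in>Pow {..<DIM('a)}. G (nths e S))"
proof -
  let ?A = "{xs. set xs \<subseteq> (Basis :: 'a set) \<and> distinct xs}"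
  have dist: "distinct e" using e(1) orthonormal_list_distinct by (auto simp: frame_def)
  have len: "length e = DIM('a)" by (rule frame_length[OF e(1)])
  have finA: "finite ?A" by (rule finite_subset_distinct) simp
  have "(\<Sum>xs\<in>?A. G xs / fact (length xs))
      = (\<Sum>B\<in>Pow Basis. \<Sum>xs\<in>{xs \<in> ?A. set xs = B}. G xs / fact (length xs))"
    by (rule sum.group[symmetric]) (use finA in auto)
  also have "Pow (Basis :: 'a set) = (\<lambda>S. set (nths e S)) ` Pow {..<DIM('a)}"
  proof -
    have "set (nths e S) = (!) e ` S" if "S \<in> Pow {..<DIM('a)}" for S
      using that len by (auto simp: set_nths)
    then have "(\<lambda>S. set (nths e S)) ` Pow {..<DIM('a)} = image ((!) e) ` Pow {..<DIM('a)}"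
      by (intro image_cong) auto
    also have "\<dots> = Pow ((!) e ` {..<DIM('a)})" by (rule image_Pow_surj) simp
    also have "(!) e ` {..<DIM('a)} = Basis"
      using len e(2) by (auto simp: set_conv_nth)
    finally show ?thesis by simp
  qed
  also have "(\<Sum>B\<in>(\<lambda>S. set (nths e S)) ` Pow {..<DIM('a)}. \<Sum>xs\<in>{xs \<in> ?A. set xs = B}. G xs / fact (length xs))
     = (\<Sum>S\<in>Pow {..<DIM('a)}. \<Sum>xs\<in>{xs \<in> ?A. set xs = set (nths e S)}. G xs / fact (length xs))"
  proof (rule sum.reindex_cong[OF _ refl refl])
    show "inj_on (\<lambda>S. set (nths e S)) (Pow {..<DIM('a)})"
    proof (rule inj_onI)
      fix S T assume S: "S \<in> Pow {..<DIM('a)}" and T: "T \<in> Pow {..<DIM('a)}"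
        and eq: "set (nths e S) = set (nths e T)"
      have *: "set (nths e S) = (!) e ` S" if "S \<in> Pow {..<DIM('a)}" for S
        using that len by (auto simp: set_nths)
      have "inj_on ((!) e) {..<DIM('a)}" using dist len by (simp add: inj_on_nth)
      then show "S = T" using eq S T unfolding *[OF S] *[OF T]
        by (simp add: inj_on_image_eq_iff)
    qed
  qed
  also have "\<dots> = (\<Sum>S\<in>Pow {..<DIM('a)}. G (nths e S))"
  proof (rule sum.cong[OF refl])
    fix S assume "S \<in> Pow {..<DIM('a)}"
    have distS: "distinct (nths e S)" using dist by simp
    have "set (nths e S) \<subseteq> Basis" using e(2) set_nths_subset by fast
    then have perms: "{xs \<in> ?A. set xs = set (nths e S)} = permutations_of_set (set (nths e S))"
      by (auto simp: permutations_of_set_def)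
    have "(\<Sum>xs\<in>permutations_of_set (set (nths e S)). G xs / fact (length xs))
        = (\<Sum>xs\<in>permutations_of_set (set (nths e S)). G (nths e S) / fact (card (set (nths e S))))"
    proof (rule sum.cong[OF refl])
      fix xs assume "xs \<in> permutations_of_set (set (nths e S))"
      then have xs: "set xs = set (nths e S)" "distinct xs" by (auto simp: permutations_of_set_def)
      then have "mset xs = mset (nths e S)" using distS by (simp add: set_eq_iff_mset_eq_distinct)
      then show "G xs / fact (length xs) = G (nths e S) / fact (card (set (nths e S)))"
        using G[of xs "nths e S"] xs by (simp add: distinct_card[symmetric])
    qed
    then show "(\<Sum>xs\<in>{xs \<in> ?A. set xs = set (nths e S)}. G xs / fact (length xs)) = G (nths e S)"
      unfolding perms by simp
  qed
  finally show ?thesis .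
qed

lemma sum_distinct_lists_polyforms:
  fixes \<alpha> \<beta> :: "'a::euclidean_space polyform"
  assumes e: "frame e" "set e = Basis" and "\<alpha> \<in> polyforms" "\<beta> \<in> polyforms"
  shows "(\<Sum>xs | set xs \<subseteq> Basis \<and> distinct xs. \<alpha> xs * \<beta> xs / fact (length xs))
    = (\<Sum>S\<in>Pow {..<DIM('a)}. \<alpha> (nths e S) * \<beta> (nths e S))"
proof (rule sum_distinct_lists_Basis[OF e])
  fix ys zs :: "'a list" assume "mset ys = mset zs"
  then obtain s :: real where "s * s = 1" "\<alpha> ys = s * \<alpha> zs" "\<beta> ys = s * \<beta> zs"
    using polyform_permute assms by blast
  then show "\<alpha> ys * \<beta> ys = \<alpha> zs * \<beta> zs" by (simp add: algebra_simps)
qed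

lemma nths_insert_min:
  assumes "i < length e" "\<And>j. j \<in> S \<Longrightarrow> i < j"
  shows "nths e (insert i S) = e ! i # nths e S"
proof -
  have "insert i S \<inter> {..<i} = {}" "insert i S \<inter> {i<..} = S" using assms(2) by force+
  then show ?thesis using nths_split[OF assms(1), of "insert i S"] by simp
qed

lemma append_polyform:
  assumes "\<alpha> \<in> polyforms"
  shows "(\<lambda>xs. \<alpha> (ys @ xs)) \<in> polyforms"
  using assms
proof (induction ys arbitrary: \<alpha>)
  case (Cons y ys)
  show ?case using Cons.IH[OF interior_prod_polyform[OF Cons.prems, of y]]
    by (simp add: interior_prod_def)
qed simp

lemma prepend_polyform:
  assumes "\<alpha> \<in> polyforms"
  shows "(\<lambda>xs. \<alpha> (xs @ ys)) \<in> polyforms"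
proof -
  have "linear (\<lambda>v. \<alpha> (xs[i := v] @ ys))" if "i < length xs" for xs i
    using polyform_linear[OF assms, of i "xs @ ys"] that by (simp add: list_update_append1)
  then show ?thesis using polyform_eq_0[OF assms] by (auto simp: polyforms_def)
qed

lemma polyform_nths_append:
  assumes "\<alpha> \<in> polyforms" "S \<subseteq> {..<length e}" "T \<subseteq> {..<length e}"
  shows "\<alpha> (nths e S @ nths e T)
    = (if S \<inter> T = {} then reorder_sign S T * \<alpha> (nths e (S \<union> T)) else 0)"
proof -
  have "finite S" using assms finite_subset by blast
  then show ?thesis
    using assms(1,2)
  proof (induction S arbitrary: \<alpha> rule: finite_linorder_min_induct)
    case (insert i S)
    have i: "i < length e" "i \<notin> S" and sub: "S \<union> T \<subseteq> {..<length e}" "S \<subseteq> {..<length e}"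
      using insert assms(3) by auto
    have finT: "finite T" using assms(3) finite_subset by blast
    have 1: "reorder_sign {i} S = 1" using insert by (intro reorder_sign_below) auto
    have "\<alpha> (nths e (insert i S) @ nths e T) = interior_prod (e ! i) \<alpha> (nths e S @ nths e T)"
      using insert by (simp add: nths_insert_min interior_prod_def)
    also have "\<dots> = (if S \<inter> T = {} then reorder_sign S T * \<alpha> (e ! i # nths e (S \<union> T)) else 0)"
      using insert.IH[OF interior_prod_polyform[OF insert.prems(1), of "e ! i"] sub(2)]
      by (simp add: interior_prod_def)
    also have "\<dots> = (if insert i S \<inter> T = {} then reorder_sign (insert i S) T * \<alpha> (nths e (insert i S \<union> T)) else 0)"
    proof (cases "insert i S \<inter> T = {}")
      case True
      then have "reorder_sign {i} (S \<union> T) = reorder_sign {i} T"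
        using insert.hyps finT 1 reorder_sign_Un_right[of S T "{i}"] by auto
      then show ?thesis
        using True i insert.hyps polyform_Cons_nths[OF insert.prems(1) i(1) sub(1)]
          reorder_sign_insert_left[of S i T] by auto
    next
      case False
      then show ?thesis
        using i polyform_Cons_nths[OF insert.prems(1) i(1) sub(1)] by auto
    qed
    finally show ?case .
  qed simp
qed

lemma form_if_nths:
  fixes e :: "'a::euclidean_space list"
  assumes e: "frame e" and \<alpha>: "\<alpha> \<in> polyforms"
    and 0: "\<And>T. T \<subseteq> {..<DIM('a)} \<Longrightarrow> card T \<noteq> k \<Longrightarrow> \<alpha> (nths e T) = 0"
  shows "\<alpha> \<in> forms k"
proof -
  have eq: "(\<lambda>xs. (if length xs = k then 1 else 0) * \<alpha> xs) = \<alpha>"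
  proof (rule polyform_eqI[OF e degree_weighted_polyform[OF \<alpha>] \<alpha>])
    fix T assume "T \<subseteq> {..<DIM('a)}"
    then show "(if length (nths e T) = k then 1 else 0) * \<alpha> (nths e T) = \<alpha> (nths e T)"
      using 0[of T] frame_length[OF e] by (simp add: length_nths_subset)
  qed
  have "\<alpha> xs = 0" if "length xs \<noteq> k" for xs
    using fun_cong[OF eq, of xs] that by simp
  then show ?thesis using \<alpha> by (simp add: forms_def)
qed

lemma form_nths_eq_0:
  fixes e :: "'a::euclidean_space list"
  assumes "frame e" "\<alpha> \<in> forms k" "T \<subseteq> {..<DIM('a)}" "card T \<noteq> k"
  shows "\<alpha> (nths e T) = 0"
  using assms by (intro form_eq_0[OF assms(2)]) (simp add: length_nths_subset frame_length)

lemma form_eqI: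
  fixes e :: "'a::euclidean_space list"
  assumes "frame e" "\<alpha> \<in> forms k" "\<beta> \<in> forms k"
    and "\<And>T. T \<subseteq> {..<DIM('a)} \<Longrightarrow> card T = k \<Longrightarrow> \<alpha> (nths e T) = \<beta> (nths e T)"
  shows "\<alpha> = \<beta>"
proof (rule polyform_eqI[OF assms(1)])
  show "\<alpha> \<in> polyforms" "\<beta> \<in> polyforms" using assms by (auto simp: forms_def)
  show "\<alpha> (nths e T) = \<beta> (nths e T)" if "T \<subseteq> {..<DIM('a)}" for T
    using assms that form_nths_eq_0[OF assms(1,2) that] form_nths_eq_0[OF assms(1,3) that]
    by (cases "card T = k") auto
qed

definition from_coeffs :: "'a::euclidean_space list \<Rightarrow> (nat set \<Rightarrow> real) \<Rightarrow> 'a polyform" where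
  "from_coeffs e c xs = (\<Sum>S\<in>Pow {..<DIM('a)}. c S * monomial e (sorted_list_of_set S) xs)"

lemma from_coeffs_polyform: "from_coeffs e c \<in> polyforms"
proof -
  have "from_coeffs e c = (\<lambda>xs. \<Sum>S\<in>Pow {..<DIM('a)}. c S * monomial e (sorted_list_of_set S) xs)"
    by (simp add: fun_eq_iff from_coeffs_def)
  then show ?thesis by (simp only:) (intro sum_polyform scale_polyform monomial_polyform)
qed

lemma from_coeffs_nths:
  fixes e :: "'a::euclidean_space list"
  assumes "frame e" "T \<subseteq> {..<DIM('a)}"
  shows "from_coeffs e c (nths e T) = c T"
proof -
  have "from_coeffs e c (nths e T) = (\<Sum>S\<in>Pow {..<DIM('a)}. if S = T then c S else 0)"
    unfolding from_coeffs_def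
    using assms by (intro sum.cong refl) (simp add: monomial_set_nths)
  then show ?thesis using assms by simp
qed

section \<open>Coefficients as traces\<close>

context spinor_module
begin

text \<open>
  Every index set but the empty one has a covector that anticommutes with its monomial: an element of
  the set if its size is even, and one of the complement if it is odd. The full set is even, so the
  complement of an odd set is not empty.
\<close>

lemma mono_op_trace:
  assumes e: "frame e" and S: "S \<subseteq> {..<DIM('a)}"
  shows "op_trace (mono_op e S) = (if S = {} then 16 else 0)"
proof (cases "S = {}")
  case True
  then show ?thesis
    by (simp add: op_trace_def mono_op_empty inner_Basis dim16)
next
  case False
  have fin: "finite S" using S finite_subset by blast
  obtain i where i: "i < DIM('a)" "odd (card S + card ({i} \<inter> S))"
  proof (cases "even (card S)")
    case True
    obtain i where "i \<in> S" using False by blast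
    then show ?thesis using True that[of i] S by auto
  next
    case odd: False
    then have "S \<noteq> {..<DIM('a)}" using dim8 by auto
    then obtain i where "i < DIM('a)" "i \<notin> S" using S by auto
    then show ?thesis using odd that[of i] by auto
  qed
  have sub: "{i} \<subseteq> {..<DIM('a)}" using i by simp
  have sign: "reorder_sign S {i} = - reorder_sign {i} S"
    using reorder_sign_swap[of S "{i}"] fin i by (simp add: Int_commute)
  have sq: "mono_op e {i} (mono_op e {i} \<xi>) = \<xi>" for \<xi>
    using mono_op_mult[OF e sub sub, of \<xi>] by (simp add: mono_op_empty reorder_sign_def)
  have anti: "mono_op e S (mono_op e {i} \<xi>) = - mono_op e {i} (mono_op e S \<xi>)" for \<xi>
  proof -
    have "sym_diff S {i} = sym_diff {i} S" by auto
    then have "mono_op e {i} (mono_op e S \<xi>) = reorder_sign {i} S *\<^sub>R mono_op e (sym_diff S {i}) \<xi>"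
      using mono_op_mult[OF e sub S, of \<xi>] by simp
    then show ?thesis using mono_op_mult[OF e S sub, of \<xi>] sign by simp
  qed
  have "op_trace (mono_op e S) = op_trace (\<lambda>x. mono_op e {i} (mono_op e {i} (mono_op e S x)))"
    by (simp add: sq)
  also have "\<dots> = op_trace (\<lambda>x. mono_op e {i} (mono_op e S (mono_op e {i} x)))"
    using op_trace_commute[OF linear_mono_op[of e "{i}"]
        linear_compose[OF linear_mono_op[of e S] linear_mono_op[of e "{i}"]]]
    by (simp add: o_def)
  also have "\<dots> = - op_trace (mono_op e S)"
    by (simp add: anti linear_neg[OF linear_mono_op] sq op_trace_def sum_negf)
  finally show ?thesis using False by simp
qed

lemma mono_op_inner:
  assumes e: "frame e" and S: "S \<subseteq> {..<DIM('a)}" and T: "T \<subseteq> {..<DIM('a)}"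
  shows "op_inner (mono_op e S) (mono_op e T) = (if S = T then 16 else 0)"
proof -
  have "op_inner (mono_op e S) (mono_op e T)
      = (\<Sum>b\<in>Basis. reorder_sign S S * reorder_sign S T * (mono_op e (sym_diff S T) b \<bullet> b))"
    unfolding op_inner_def
    by (intro sum.cong refl) (simp add: mono_op_adjoint[OF e S] mono_op_mult[OF e S T] inner_commute)
  also have "\<dots> = reorder_sign S S * reorder_sign S T * op_trace (mono_op e (sym_diff S T))"
    by (simp add: op_trace_def sum_distrib_left)
  also have "op_trace (mono_op e (sym_diff S T)) = (if sym_diff S T = {} then 16 else 0)"
    using S T by (intro mono_op_trace[OF e]) auto
  also have "sym_diff S T = {} \<longleftrightarrow> S = T" by auto
  finally show ?thesis by simp
qed

lemma op_inner_\<Psi>_mono_op: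
  assumes e: "frame e" and \<alpha>: "\<alpha> \<in> polyforms" and T: "T \<subseteq> {..<DIM('a)}"
  shows "op_inner (\<Psi> \<alpha>) (mono_op e T) = 16 * \<alpha> (nths e T)"
proof -
  have "op_inner (\<Psi> \<alpha>) (mono_op e T)
      = (\<Sum>S\<in>Pow {..<DIM('a)}. \<alpha> (nths e S) * op_inner (mono_op e S) (mono_op e T))"
    unfolding op_inner_def
    by (simp add: \<Psi>_expansion[OF e \<alpha>] inner_sum_left sum_distrib_left) (rule sum.swap)
  also have "\<dots> = (\<Sum>S\<in>Pow {..<DIM('a)}. if S = T then 16 * \<alpha> (nths e S) else 0)"
    using T by (intro sum.cong refl) (simp add: mono_op_inner[OF e])
  finally show ?thesis using T by simp
qed

text \<open>
  The normalised Hilbert-Schmidt product of operators is the determinant product of polyforms;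
  since the left-hand side refers to no frame, it shows that the right-hand side is independent
  of the frame, and that the representation is faithful.
\<close>

lemma op_inner_\<Psi>:
  assumes e: "frame e" and \<alpha>: "\<alpha> \<in> polyforms" and \<beta>: "\<beta> \<in> polyforms"
  shows "op_inner (\<Psi> \<alpha>) (\<Psi> \<beta>) = 16 * (\<Sum>S\<in>Pow {..<DIM('a)}. \<alpha> (nths e S) * \<beta> (nths e S))"
proof -
  have "op_inner (\<Psi> \<alpha>) (\<Psi> \<beta>)
      = (\<Sum>S\<in>Pow {..<DIM('a)}. \<beta> (nths e S) * op_inner (\<Psi> \<alpha>) (mono_op e S))"
    unfolding op_inner_def
    by (simp add: \<Psi>_expansion[OF e \<beta>] inner_sum_right sum_distrib_left) (rule sum.swap)
  also have "\<dots> = (\<Sum>S\<in>Pow {..<DIM('a)}. 16 * (\<alpha> (nths e S) * \<beta> (nths e S)))"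
    by (intro sum.cong refl) (simp add: op_inner_\<Psi>_mono_op[OF e \<alpha>])
  finally show ?thesis by (simp add: sum_distrib_left)
qed

lemma \<Psi>_inj:
  assumes "\<alpha> \<in> polyforms" "\<beta> \<in> polyforms" "\<And>\<xi>. \<Psi> \<alpha> \<xi> = \<Psi> \<beta> \<xi>"
  shows "\<alpha> = \<beta>"
proof -
  obtain e :: "'a list" where e: "frame e" using Basis_frame by blast
  have "\<Psi> \<alpha> = \<Psi> \<beta>" using assms(3) by auto
  then show ?thesis
    using op_inner_\<Psi>_mono_op[OF e assms(1)] op_inner_\<Psi>_mono_op[OF e assms(2)]
    by (intro polyform_eqI[OF e assms(1,2)]) simp
qed

lemma form_inner_frame:
  fixes \<alpha> \<beta> :: "'a polyform"
  assumes e: "frame e" and \<alpha>: "\<alpha> \<in> polyforms" and \<beta>: "\<beta> \<in> polyforms"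
  shows "form_inner \<alpha> \<beta> = (\<Sum>S\<in>Pow {..<DIM('a)}. \<alpha> (nths e S) * \<beta> (nths e S))"
proof -
  obtain b :: "'a list" where b: "frame b" "set b = Basis" using Basis_frame by blast
  have "form_inner \<alpha> \<beta> = (\<Sum>S\<in>Pow {..<DIM('a)}. \<alpha> (nths b S) * \<beta> (nths b S))"
    unfolding form_inner_def by (rule sum_distinct_lists_polyforms[OF b \<alpha> \<beta>])
  then show ?thesis using op_inner_\<Psi>[OF b(1) \<alpha> \<beta>] op_inner_\<Psi>[OF e \<alpha> \<beta>] by simp
qed

lemma form_norm_square:
  fixes \<alpha> :: "'a polyform"
  assumes e: "frame e" and \<alpha>: "\<alpha> \<in> polyforms"
  shows "(form_norm \<alpha>)\<^sup>2 = (\<Sum>S\<in>Pow {..<DIM('a)}. (\<alpha> (nths e S))\<^sup>2)"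
  by (simp add: form_norm_def form_inner_frame[OF e \<alpha> \<alpha>] sum_nonneg power2_eq_square)

lemma form_norm_nonneg: "(\<alpha> :: 'a polyform) \<in> polyforms \<Longrightarrow> 0 \<le> form_norm \<alpha>"
proof -
  assume \<alpha>: "\<alpha> \<in> polyforms"
  obtain e :: "'a list" where e: "frame e" using Basis_frame by blast
  show ?thesis
    unfolding form_norm_def form_inner_frame[OF e \<alpha> \<alpha>]
    by (intro real_sqrt_ge_zero sum_nonneg) simp
qed

text \<open>The Clifford product in coefficients: a twisted convolution over symmetric differences.\<close>

definition clifford_coeff :: "(nat set \<Rightarrow> real) \<Rightarrow> (nat set \<Rightarrow> real) \<Rightarrow> nat set \<Rightarrow> real" where
  "clifford_coeff a b J = (\<Sum>S\<in>Pow {..<DIM('a)}. reorder_sign S (sym_diff S J) * a S * b (sym_diff S J))"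

lemma \<Psi>_mult:
  assumes e: "frame e" and \<alpha>: "\<alpha> \<in> polyforms" and \<beta>: "\<beta> \<in> polyforms"
  shows "\<Psi> \<alpha> (\<Psi> \<beta> \<xi>)
    = \<Psi> (from_coeffs e (clifford_coeff (\<lambda>S. \<alpha> (nths e S)) (\<lambda>S. \<beta> (nths e S)))) \<xi>"
proof -
  let ?P = "Pow {..<DIM('a)}"
  let ?a = "\<lambda>S. \<alpha> (nths e S)" and ?b = "\<lambda>S. \<beta> (nths e S)"
  have "\<Psi> \<alpha> (\<Psi> \<beta> \<xi>) = (\<Sum>S\<in>?P. \<Sum>T\<in>?P. (?a S * ?b T) *\<^sub>R mono_op e S (mono_op e T \<xi>))"
    unfolding \<Psi>_expansion[OF e \<alpha>] \<Psi>_expansion[OF e \<beta>]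
    by (simp add: linear_sum[OF linear_mono_op] linear_scale[OF linear_mono_op] scaleR_sum_right)
  also have "\<dots> = (\<Sum>S\<in>?P. \<Sum>T\<in>?P. (reorder_sign S T * ?a S * ?b T) *\<^sub>R mono_op e (sym_diff S T) \<xi>)"
    by (intro sum.cong refl) (simp add: mono_op_mult[OF e] mult.commute mult.left_commute)
  also have "\<dots> = (\<Sum>S\<in>?P. \<Sum>J\<in>?P.
      (reorder_sign S (sym_diff S J) * ?a S * ?b (sym_diff S J)) *\<^sub>R mono_op e J \<xi>)"
  proof (rule sum.cong[OF refl])
    fix S assume S: "S \<in> ?P"
    have inv: "sym_diff S (sym_diff S J) = J" for J by auto
    show "(\<Sum>T\<in>?P. (reorder_sign S T * ?a S * ?b T) *\<^sub>R mono_op e (sym_diff S T) \<xi>)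
        = (\<Sum>J\<in>?P. (reorder_sign S (sym_diff S J) * ?a S * ?b (sym_diff S J)) *\<^sub>R mono_op e J \<xi>)"
      using S by (intro sum.reindex_bij_witness[where i = "sym_diff S" and j = "sym_diff S"])
        (unfold inv, auto)
  qed
  also have "\<dots> = (\<Sum>J\<in>?P. clifford_coeff ?a ?b J *\<^sub>R mono_op e J \<xi>)"
    unfolding clifford_coeff_def by (subst sum.swap) (simp add: scaleR_sum_left)
  also have "\<dots> = \<Psi> (from_coeffs e (clifford_coeff ?a ?b)) \<xi>"
    by (simp add: \<Psi>_expansion[OF e from_coeffs_polyform] from_coeffs_nths[OF e])
  finally show ?thesis .
qed

end

section \<open>The volume form and self-duality\<close>

lemma orthonormal_list_altdef:
  "orthonormal_list xs \<longleftrightarrow> distinct xs \<and> (\<forall>x\<in>set xs. \<forall>y\<in>set xs. x \<bullet> y = (if x = y then 1 else 0))"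
proof
  assume xs: "orthonormal_list xs"
  then have "distinct xs"
    unfolding distinct_conv_nth orthonormal_list_def by (metis zero_neq_one)
  then show "distinct xs \<and> (\<forall>x\<in>set xs. \<forall>y\<in>set xs. x \<bullet> y = (if x = y then 1 else 0))"
    using xs by (auto simp: orthonormal_list_def in_set_conv_nth nth_eq_iff_index_eq)
next
  assume "distinct xs \<and> (\<forall>x\<in>set xs. \<forall>y\<in>set xs. x \<bullet> y = (if x = y then 1 else 0))"
  then show "orthonormal_list xs"
    by (auto simp: orthonormal_list_def nth_eq_iff_index_eq)
qed

lemma interior_prod_form: "\<alpha> \<in> forms (Suc k) \<Longrightarrow> interior_prod v \<alpha> \<in> forms k"
  by (auto simp: forms_def interior_prod_polyform) (simp add: interior_prod_def)

lemma wedge_form: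
  assumes "\<alpha> \<in> forms k" "\<beta> \<in> forms l"
  shows "wedge \<alpha> \<beta> \<in> forms (k + l)"
proof -
  have "wedge \<alpha> \<beta> xs = 0" if "length xs \<noteq> k + l" for xs
    unfolding wedge_def
  proof (rule sum.neutral, rule ballI)
    fix S assume S: "S \<in> Pow {..<length xs}"
    then have "finite S" using finite_subset by blast
    then have "card S + card ({..<length xs} - S) = length xs"
      using S by (simp add: card_Diff_subset) (metis card_lessThan card_mono finite_lessThan le_add_diff_inverse)
    then have "length (nths xs S) \<noteq> k \<or> length (nths xs ({..<length xs} - S)) \<noteq> l"
      using that S by (simp add: length_nths_subset)
    then show "shuffle_sign (length xs) S * \<alpha> (nths xs S) * \<beta> (nths xs ({..<length xs} - S)) = 0"
      using form_eq_0[OF assms(1)] form_eq_0[OF assms(2)] by auto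
  qed
  then show ?thesis using assms by (simp add: forms_def wedge_polyform)
qed

lemma nths_full: "length e = n \<Longrightarrow> nths e {..<n} = e"
  by (rule nths_all) simp

lemma one_form_nths:
  fixes e :: "'a::euclidean_space list"
  assumes "frame e" "T \<subseteq> {..<DIM('a)}"
  shows "one_form (nths e T) = (if T = {} then 1 else 0)"
proof -
  have "finite T" using assms finite_subset by blast
  then have "nths e T = [] \<longleftrightarrow> T = {}"
    using length_nths_subset[of T e] assms frame_length[OF assms(1)] by (metis card_0_eq length_0_conv)
  then show ?thesis by (simp add: one_form_def)
qed

lemma reorder_sign_self_4:
  assumes "card A = 4"
  shows "reorder_sign A A = 1"
  using assms reorder_sign_self[of A] card_gt_0_iff[of A] by (simp add: choose_two)

lemma reorder_sign_complement_4:
  assumes "A \<subseteq> {..<8}" "card A = 4"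
  shows "reorder_sign {..<8} A = reorder_sign ({..<8} - A) A"
    and "reorder_sign A ({..<8} - A) = reorder_sign ({..<8} - A) A"
proof -
  have fin: "finite A" using assms finite_subset by blast
  have "{..<8} = ({..<8} - A) \<union> A" using assms by auto
  then have "reorder_sign {..<8} A = reorder_sign ({..<8} - A) A * reorder_sign A A"
    using reorder_sign_Un_left[of "{..<8} - A" A A] fin by auto
  then show "reorder_sign {..<8} A = reorder_sign ({..<8} - A) A"
    using assms by (simp add: reorder_sign_self_4)
  show "reorder_sign A ({..<8} - A) = reorder_sign ({..<8} - A) A"
    using reorder_sign_swap[of A "{..<8} - A"] fin assms(2) by (simp add: Int_Diff)
qed

context spinor_module
begin

definition positive_frame :: "'a list \<Rightarrow> bool" where
  "positive_frame e \<longleftrightarrow> frame e \<and> e \<in> ori"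

lemma positive_frameD: "positive_frame e \<Longrightarrow> frame e"
  by (simp add: positive_frame_def)

abbreviation top_form :: "'a list \<Rightarrow> 'a polyform" where
  "top_form e \<equiv> monomial e [0..<8]"

lemma top_form_nths:
  assumes "frame e" "T \<subseteq> {..<8}"
  shows "top_form e (nths e T) = (if T = {..<8} then 1 else 0)"
  using monomial_nths[OF assms(1), of "[0..<8]" T] assms(2) dim8
  by (simp add: atLeast0LessThan del: upt_rec_numeral)

lemma top_form_form: "frame e \<Longrightarrow> top_form e \<in> forms 8"
  using top_form_nths dim8 by (intro form_if_nths monomial_polyform) auto

lemma top_form_self: "frame e \<Longrightarrow> top_form e e = 1"
  using top_form_nths[of e "{..<8}"] by (simp add: nths_full frame_length dim8)

text \<open>A form of top degree has only one coefficient in a frame.\<close>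

lemma form8_eq:
  assumes e: "frame e" and \<omega>: "\<omega> \<in> forms 8"
  shows "\<omega> = (\<lambda>xs. \<omega> e * top_form e xs)"
proof (rule polyform_eqI[OF e form_polyform[OF \<omega>] scale_polyform[OF monomial_polyform]])
  fix T assume T: "T \<subseteq> {..<DIM('a)}"
  show "\<omega> (nths e T) = \<omega> e * top_form e (nths e T)"
  proof (cases "T = {..<8}")
    case True
    then show ?thesis using e by (simp add: nths_full frame_length dim8 top_form_self)
  next
    case False
    then have "card T \<noteq> 8"
      using T dim8 by (metis card_lessThan card_subset_eq finite_lessThan)
    then show ?thesis
      using False form_nths_eq_0[OF e \<omega> T] top_form_nths[OF e] T dim8 by simp
  qed
qed

lemma mono_op_full: "mono_op e {..<8} = \<Psi> (top_form e)"
proof -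
  have "sorted_list_of_set {..<8::nat} = [0..<8]"
    by (metis atLeast0LessThan sorted_list_of_set_range)
  then show ?thesis by (simp add: mono_op_def)
qed

lemma top_op_involution:
  assumes e: "frame e"
  shows "\<Psi> (top_form e) (\<Psi> (top_form e) \<xi>) = \<xi>"
  using mono_op_mult[OF e, of "{..<8}" "{..<8}" \<xi>] dim8
  by (simp add: mono_op_full[symmetric] mono_op_empty reorder_sign_self choose_two)

text \<open>
  The top forms of two frames differ by a factor whose square is one, as both act as involutions
  on spinors.
\<close>

lemma top_form_unique:
  assumes e: "positive_frame e" and e': "positive_frame e'"
  shows "top_form e' = top_form e"
proof -
  obtain \<omega> where \<omega>: "\<omega> \<in> forms 8" "\<And>xs. xs \<in> ori \<longleftrightarrow> 0 < \<omega> xs"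
    using ori dim8 by (auto simp: orientation_def)
  define c where "c = top_form e' e"
  have fe: "frame e" "frame e'" using e e' by (auto simp: positive_frame_def)
  have c: "top_form e' = (\<lambda>xs. c * top_form e xs)"
    using form8_eq[OF fe(1) top_form_form[OF fe(2)]] by (simp add: c_def)
  obtain \<xi> :: 's where "\<xi> \<noteq> 0"
    using dim16 by (metis DIM_positive nonempty_Basis nonzero_Basis equals0I)
  have "\<Psi> (top_form e') \<eta> = c *\<^sub>R \<Psi> (top_form e) \<eta>" for \<eta>
    unfolding c by (rule \<Psi>_scale[OF monomial_polyform])
  then have "\<xi> = (c * c) *\<^sub>R \<xi>"
    using top_op_involution[OF fe(1), of \<xi>] top_op_involution[OF fe(2), of \<xi>]
      linear_scale[OF linear_\<Psi>[OF monomial_polyform]] by simp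
  then have "c * c = 1" using \<open>\<xi> \<noteq> 0\<close> by (metis scaleR_cancel_right scaleR_one)
  moreover have "0 < c"
  proof -
    have "\<omega> e = \<omega> e' * c"
      using form8_eq[OF fe(2) \<omega>(1)] by (metis c_def)
    moreover have "0 < \<omega> e" "0 < \<omega> e'" using e e' \<omega>(2) by (auto simp: positive_frame_def)
    ultimately show ?thesis by (simp add: zero_less_mult_iff)
  qed
  ultimately have "c = 1" by (metis abs_of_pos abs_mult_self_eq mult_cancel_left1 abs_1 square_eq_1_iff less_asym neg_less_0_iff_less zero_less_one)
  then show ?thesis using c by simp
qed

lemma positive_frame_iff:
  assumes e: "positive_frame e" and e': "frame e'"
  shows "positive_frame e' \<longleftrightarrow> 0 < top_form e e'"
proof -
  obtain \<omega> where \<omega>: "\<omega> \<in> forms 8" "\<And>xs. xs \<in> ori \<longleftrightarrow> 0 < \<omega> xs"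
    using ori dim8 by (auto simp: orientation_def)
  have "\<omega> e' = \<omega> e * top_form e e'"
    using form8_eq[OF positive_frameD[OF e] \<omega>(1)] by metis
  moreover have "0 < \<omega> e" using e \<omega>(2) by (simp add: positive_frame_def)
  ultimately show ?thesis using \<omega>(2) e' by (simp add: positive_frame_def zero_less_mult_iff)
qed

lemma ori_iff:
  assumes e: "positive_frame e"
  shows "xs \<in> ori \<longleftrightarrow> 0 < top_form e xs"
proof -
  obtain \<omega> where \<omega>: "\<omega> \<in> forms 8" "\<And>xs. xs \<in> ori \<longleftrightarrow> 0 < \<omega> xs"
    using ori dim8 by (auto simp: orientation_def)
  have "\<omega> xs = \<omega> e * top_form e xs"
    using form8_eq[OF positive_frameD[OF e] \<omega>(1)] by metis
  moreover have "0 < \<omega> e" using e \<omega>(2) by (simp add: positive_frame_def)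
  ultimately show ?thesis using \<omega>(2) by (simp add: zero_less_mult_iff)
qed

text \<open>Exchanging two vectors reverses the sign of every form of top degree.\<close>

lemma frame_swap_positive:
  assumes "frame (x # y # zs)"
  shows "positive_frame (x # y # zs) \<or> positive_frame (y # x # zs)"
proof -
  obtain \<omega> where \<omega>: "\<omega> \<in> forms 8" "\<And>xs. xs \<in> ori \<longleftrightarrow> 0 < \<omega> xs" "\<omega> \<noteq> (\<lambda>_. 0)"
    using ori dim8 by (auto simp: orientation_def)
  have "\<omega> (x # y # zs) \<noteq> 0"
    using \<omega>(3) form8_eq[OF assms \<omega>(1)] by (metis mult_zero_left)
  moreover have "\<omega> (y # x # zs) = - \<omega> (x # y # zs)"
    by (rule polyform_swap[OF form_polyform[OF \<omega>(1)]])
  ultimately have "0 < \<omega> (x # y # zs) \<or> 0 < \<omega> (y # x # zs)" by linarith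
  moreover have "frame (y # x # zs)"
    using assms unfolding frame_def orthonormal_list_altdef by auto
  ultimately show ?thesis
    using assms unfolding positive_frame_def \<omega>(2) by blast
qed

lemma positive_Basis_frame:
  obtains e where "positive_frame e" "set e = Basis"
proof -
  obtain e :: "'a list" where e: "frame e" "set e = Basis" by (rule Basis_frame)
  then obtain x y zs where xyz: "e = x # y # zs"
    using frame_length[OF e(1)] dim8 by (cases e; cases "tl e") auto
  then have "set (y # x # zs) = Basis" using e(2) by auto
  then show ?thesis using frame_swap_positive[of x y zs] that e xyz by blast
qed

text \<open>
  Orthonormal lists in the orientation have full length, since forms of degree eight vanish on others,
  so they are positive frames and \<open>top_form_unique\<close> applies.
\<close>

lemma volume_form_eq:
  assumes e: "positive_frame e"
  shows "volume_form ori = top_form e"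
  unfolding volume_form_def
proof (rule the_equality)
  have fe: "frame e" using e by (simp add: positive_frame_def)
  have pos: "positive_frame xs" if "xs \<in> ori" "orthonormal_list xs" for xs
  proof -
    have "length xs = 8"
      using that ori_iff[OF e] form_eq_0[OF top_form_form[OF fe], of xs] by fastforce
    then show ?thesis using that dim8 by (simp add: positive_frame_def frame_def)
  qed
  have "top_form e xs = 1" if "xs \<in> ori" "orthonormal_list xs" for xs
    using top_form_unique[OF e pos[OF that]] top_form_self[OF positive_frameD[OF pos[OF that]]] by simp
  then show "top_form e \<in> forms DIM('a) \<and> (\<forall>xs\<in>ori. orthonormal_list xs \<longrightarrow> top_form e xs = 1)"
    using top_form_form[OF fe] dim8 by simp
  fix \<nu> assume \<nu>: "\<nu> \<in> forms DIM('a) \<and> (\<forall>xs\<in>ori. orthonormal_list xs \<longrightarrow> \<nu> xs = 1)"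
  then have "\<nu> e = 1" using e by (auto simp: positive_frame_def frame_def)
  then show "\<nu> = top_form e" using form8_eq[OF fe, of \<nu>] \<nu> dim8 by simp
qed

abbreviation \<nu> :: "'a polyform" where "\<nu> \<equiv> volume_form ori"

lemma volume_form_polyform: "\<nu> \<in> polyforms"
  by (metis positive_Basis_frame volume_form_eq monomial_polyform)

lemma volume_nths:
  assumes "positive_frame e" "T \<subseteq> {..<8}"
  shows "\<nu> (nths e T) = (if T = {..<8} then 1 else 0)"
  using assms top_form_nths by (simp add: volume_form_eq positive_frameD)

lemma \<Psi>_volume: "positive_frame e \<Longrightarrow> \<Psi> \<nu> = mono_op e {..<8}"
  by (simp add: volume_form_eq mono_op_full)

lemma volume_involution: "\<Psi> \<nu> (\<Psi> \<nu> \<xi>) = \<xi>"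
  by (metis positive_Basis_frame volume_form_eq top_op_involution positive_frameD)

text \<open>
  Multiplication by the full monomial exchanges complementary index sets.
\<close>

lemma volume_op_fixes_iff:
  assumes e: "positive_frame e" and \<Phi>: "\<Phi> \<in> forms 4"
  shows "(\<forall>\<xi>. \<Psi> \<nu> (\<Psi> \<Phi> \<xi>) = \<Psi> \<Phi> \<xi>)
    \<longleftrightarrow> (\<forall>T\<subseteq>{..<8}. card T = 4 \<longrightarrow> \<Phi> (nths e T) = reorder_sign ({..<8} - T) T * \<Phi> (nths e ({..<8} - T)))"
proof -
  have fe: "frame e" and pf: "\<Phi> \<in> polyforms" using e \<Phi> by (auto simp: positive_frame_def forms_def)
  define c where "c = clifford_coeff (\<lambda>S. \<nu> (nths e S)) (\<lambda>S. \<Phi> (nths e S))"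
  have c: "c T = reorder_sign {..<8} ({..<8} - T) * \<Phi> (nths e ({..<8} - T))"
    if T: "T \<subseteq> {..<8}" for T
  proof -
    have "c T = (\<Sum>S\<in>Pow {..<8}. if S = {..<8} then reorder_sign S (sym_diff S T) * \<Phi> (nths e (sym_diff S T)) else 0)"
      unfolding c_def clifford_coeff_def dim8
      using volume_nths[OF e] by (intro sum.cong refl) simp
    also have "\<dots> = reorder_sign {..<8} (sym_diff {..<8} T) * \<Phi> (nths e (sym_diff {..<8} T))"
      by simp
    also have "sym_diff {..<8} T = {..<8} - T" using T by auto
    finally show ?thesis .
  qed
  have card: "card ({..<8} - T) = 8 - card T" if "T \<subseteq> {..<8::nat}" for T
    using that finite_subset[OF that] by (simp add: card_Diff_subset)
  have c4: "c T = reorder_sign ({..<8} - T) T * \<Phi> (nths e ({..<8} - T))"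
    if T: "T \<subseteq> {..<8}" "card T = 4" for T
  proof -
    have "{..<8} - ({..<8} - T) = T" using T by auto
    then show ?thesis
      using reorder_sign_complement_4[of "{..<8} - T"] card[OF T(1)] T c[OF T(1)]
        reorder_sign_complement_4(2)[OF T] by simp
  qed
  have "\<Psi> \<nu> (\<Psi> \<Phi> \<xi>) = \<Psi> (from_coeffs e c) \<xi>" for \<xi>
    unfolding c_def by (rule \<Psi>_mult[OF fe volume_form_polyform pf])
  then have "(\<forall>\<xi>. \<Psi> \<nu> (\<Psi> \<Phi> \<xi>) = \<Psi> \<Phi> \<xi>) \<longleftrightarrow> from_coeffs e c = \<Phi>"
    using \<Psi>_inj[OF from_coeffs_polyform pf] by metis
  also have "\<dots> \<longleftrightarrow> (\<forall>T\<subseteq>{..<8}. c T = \<Phi> (nths e T))"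
    using polyform_eqI[OF fe from_coeffs_polyform pf] from_coeffs_nths[OF fe] dim8 by metis
  also have "\<dots> \<longleftrightarrow> (\<forall>T\<subseteq>{..<8}. card T = 4 \<longrightarrow> c T = \<Phi> (nths e T))"
  proof -
    have "c T = \<Phi> (nths e T)" if "T \<subseteq> {..<8}" "card T \<noteq> 4" for T
      using that card[OF that(1)] c[OF that(1)] form_nths_eq_0[OF fe \<Phi>, of T]
        form_nths_eq_0[OF fe \<Phi>, of "{..<8} - T"] dim8 by auto
    then show ?thesis by blast
  qed
  finally show ?thesis using c4 by metis
qed

lemma hodge_polyform: "hodge ori \<beta> \<in> polyforms"
proof -
  have "hodge ori \<beta> = (\<lambda>xs. \<Sum>ys | set ys \<subseteq> Basis \<and> distinct ys. \<beta> ys / fact (length ys) * \<nu> (ys @ xs))"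
    by (simp add: hodge_def fun_eq_iff)
  then show ?thesis
    by (simp only:) (intro sum_polyform scale_polyform append_polyform volume_form_polyform)
qed

lemma hodge_nths:
  assumes e: "positive_frame e" "set e = Basis" and \<beta>: "\<beta> \<in> polyforms" and T: "T \<subseteq> {..<8}"
  shows "hodge ori \<beta> (nths e T) = reorder_sign ({..<8} - T) T * \<beta> (nths e ({..<8} - T))"
proof -
  have fe: "frame e" using e by (simp add: positive_frame_def)
  have "hodge ori \<beta> (nths e T) = (\<Sum>S\<in>Pow {..<DIM('a)}. \<beta> (nths e S) * \<nu> (nths e S @ nths e T))"
    unfolding hodge_def
    by (rule sum_distinct_lists_polyforms[OF fe e(2) \<beta> prepend_polyform[OF volume_form_polyform]])
  also have "\<dots> = (\<Sum>S\<in>Pow {..<8}. if S = {..<8} - T then reorder_sign S T * \<beta> (nths e S) else 0)"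
    unfolding dim8
  proof (rule sum.cong[OF refl])
    fix S :: "nat set" assume S: "S \<in> Pow {..<8}"
    have "\<nu> (nths e S @ nths e T) = (if S \<inter> T = {} then reorder_sign S T * \<nu> (nths e (S \<union> T)) else 0)"
      using S T frame_length[OF fe] dim8 by (intro polyform_nths_append volume_form_polyform) auto
    also have "\<nu> (nths e (S \<union> T)) = (if S \<union> T = {..<8} then 1 else 0)"
      using S T by (intro volume_nths[OF e(1)]) auto
    also have "(if S \<inter> T = {} then reorder_sign S T * (if S \<union> T = {..<8} then 1 else 0) else 0)
        = (if S = {..<8} - T then reorder_sign S T else 0)"
      using S T by auto
    finally show "\<beta> (nths e S) * \<nu> (nths e S @ nths e T)
        = (if S = {..<8} - T then reorder_sign S T * \<beta> (nths e S) else 0)"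
      by simp
  qed
  finally show ?thesis by simp
qed

text \<open>
  Self-duality is invariance under Clifford multiplication by the volume form, so it can be read
  off in any positive frame.
\<close>

lemma self_dual_iff_volume_op:
  assumes \<Phi>: "\<Phi> \<in> forms 4"
  shows "\<Phi> \<in> self_dual_4forms ori \<longleftrightarrow> (\<forall>\<xi>. \<Psi> \<nu> (\<Psi> \<Phi> \<xi>) = \<Psi> \<Phi> \<xi>)"
proof -
  obtain e where e: "positive_frame e" "set e = Basis" by (rule positive_Basis_frame)
  have fe: "frame e" and pf: "\<Phi> \<in> polyforms" using e \<Phi> by (auto simp: positive_frame_def forms_def)
  have "hodge ori \<Phi> = \<Phi> \<longleftrightarrow> (\<forall>T\<subseteq>{..<8}. hodge ori \<Phi> (nths e T) = \<Phi> (nths e T))"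
    using polyform_eqI[OF fe hodge_polyform pf] dim8 by metis
  also have "\<dots> \<longleftrightarrow> (\<forall>T\<subseteq>{..<8}. card T = 4 \<longrightarrow> hodge ori \<Phi> (nths e T) = \<Phi> (nths e T))"
  proof -
    have "hodge ori \<Phi> (nths e T) = \<Phi> (nths e T)" if T: "T \<subseteq> {..<8}" "card T \<noteq> 4" for T
    proof -
      have "card ({..<8} - T) \<noteq> 4"
        using T finite_subset[OF T(1)] by (simp add: card_Diff_subset)
      then show ?thesis
        using T hodge_nths[OF e pf T(1)] form_nths_eq_0[OF fe \<Phi>, of T]
          form_nths_eq_0[OF fe \<Phi>, of "{..<8} - T"] dim8 by simp
    qed
    then show ?thesis by blast
  qed
  also have "\<dots> \<longleftrightarrow> (\<forall>\<xi>. \<Psi> \<nu> (\<Psi> \<Phi> \<xi>) = \<Psi> \<Phi> \<xi>)"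
    unfolding volume_op_fixes_iff[OF e(1) \<Phi>] using hodge_nths[OF e pf] by metis
  finally show ?thesis using \<Phi> by (simp add: self_dual_4forms_def)
qed

lemma self_dual_nths:
  assumes "positive_frame e" "\<Phi> \<in> self_dual_4forms ori" "T \<subseteq> {..<8}" "card T = 4"
  shows "\<Phi> (nths e T) = reorder_sign ({..<8} - T) T * \<Phi> (nths e ({..<8} - T))"
  using assms volume_op_fixes_iff[OF assms(1)] self_dual_iff_volume_op
  by (auto simp: self_dual_4forms_def)

end

section \<open>The Clifford square of a four-form\<close>

lemma sum_unordered_pairs:
  fixes h :: "nat set \<Rightarrow> real"
  assumes "finite V"
  shows "(\<Sum>i\<in>V. \<Sum>k\<in>V. if i \<noteq> k then h {i, k} else 0) = 2 * (\<Sum>K | K \<subseteq> V \<and> card K = 2. h K)"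
proof -
  let ?D = "{p \<in> V \<times> V. fst p \<noteq> snd p}"
  let ?P = "{K. K \<subseteq> V \<and> card K = 2}"
  have fin: "finite ?D" "finite ?P" using assms by auto
  have "(\<Sum>i\<in>V. \<Sum>k\<in>V. if i \<noteq> k then h {i, k} else 0)
      = (\<Sum>p\<in>V \<times> V. if fst p \<noteq> snd p then h {fst p, snd p} else 0)"
    by (simp add: sum.cartesian_product case_prod_beta)
  also have "\<dots> = (\<Sum>p\<in>?D. h {fst p, snd p})"
    using assms by (subst sum.inter_filter) auto
  also have "\<dots> = (\<Sum>K\<in>?P. \<Sum>p\<in>{p \<in> ?D. {fst p, snd p} = K}. h {fst p, snd p})"
    by (rule sum.group[symmetric]) (use fin in auto)
  also have "\<dots> = (\<Sum>K\<in>?P. 2 * h K)"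
  proof (rule sum.cong[OF refl])
    fix K assume "K \<in> ?P"
    then obtain x y where xy: "K = {x, y}" "x \<noteq> y" "x \<in> V" "y \<in> V"
      by (auto simp: card_2_iff)
    then have "{p \<in> ?D. {fst p, snd p} = K} = {(x, y), (y, x)}"
      by (auto simp: doubleton_eq_iff)
    then show "(\<Sum>p\<in>{p \<in> ?D. {fst p, snd p} = K}. h {fst p, snd p}) = 2 * h K"
      using xy by (simp add: insert_commute)
  qed
  finally show ?thesis by (simp add: sum_distrib_left)
qed

lemma Delta2_form:
  fixes \<alpha> \<beta> :: "'a::euclidean_space polyform"
  assumes "\<alpha> \<in> forms (Suc (Suc k))" "\<beta> \<in> forms (Suc (Suc l))"
  shows "Delta2 \<alpha> \<beta> \<in> forms (k + l)"
proof -
  let ?w = "\<lambda>a b. wedge (interior_prod a (interior_prod b \<alpha>)) (interior_prod a (interior_prod b \<beta>))"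
  have w: "?w a b \<in> forms (k + l)" for a b
    by (intro wedge_form interior_prod_form assms)
  have "Delta2 \<alpha> \<beta> = (\<lambda>xs. 1 / 2 * (\<Sum>a\<in>Basis. \<Sum>b\<in>Basis. ?w a b xs))"
    by (simp add: Delta2_def fun_eq_iff)
  then have "Delta2 \<alpha> \<beta> \<in> polyforms"
    by (simp only:) (intro scale_polyform sum_polyform form_polyform[OF w])
  then show ?thesis
    using form_eq_0[OF w] by (auto simp: forms_def Delta2_def)
qed

text \<open>
  The two contracted indices \<open>K\<close> lie outside of \<open>J\<close>, as both factors are contracted with them and
  every element of \<open>J\<close> is an argument of one factor. The factor \<open>1/2\<close> of the definition accounts for the
  two orders of the contracted indices, and the signs of their contractions cancel as they occur twice.
\<close>

lemma Delta2_nths: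
  fixes \<Phi> :: "'a::euclidean_space polyform"
  assumes e: "frame e" "set e = Basis" and \<Phi>: "\<Phi> \<in> polyforms" and J: "J \<subseteq> {..<DIM('a)}"
  shows "Delta2 \<Phi> \<Phi> (nths e J) = (\<Sum>K | K \<subseteq> {..<DIM('a)} - J \<and> card K = 2. \<Sum>A\<in>Pow J.
      reorder_sign A (J - A) * reorder_sign K A * reorder_sign K (J - A)
        * \<Phi> (nths e (A \<union> K)) * \<Phi> (nths e ((J - A) \<union> K)))"
proof -
  let ?U = "{..<DIM('a)}"
  let ?V = "?U - J"
  have len: "length e = DIM('a)" by (rule frame_length[OF e(1)])
  have dist: "distinct e" using e(1) orthonormal_list_distinct by (auto simp: frame_def)
  let ?\<iota> = "\<lambda>i k. interior_prod (e ! i) (interior_prod (e ! k) \<Phi>)"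
  define t where "t K A = reorder_sign A (J - A) * reorder_sign K A * reorder_sign K (J - A)
      * \<Phi> (nths e (A \<union> K)) * \<Phi> (nths e ((J - A) \<union> K))" for K A
  define h where "h K = (\<Sum>A\<in>Pow J. t K A)" for K
  have Basis_sum: "(\<Sum>a\<in>Basis. f a) = (\<Sum>i\<in>?U. f (e ! i))" for f :: "'a \<Rightarrow> real"
  proof -
    have "(!) e ` ?U = Basis" using len e(2) by (auto simp: set_conv_nth)
    moreover have "inj_on ((!) e) ?U" using dist len by (simp add: inj_on_nth)
    ultimately show ?thesis by (metis sum.reindex_cong)
  qed
  have finJ: "finite J" using J finite_subset by blast
  have coeff: "?\<iota> i k (nths e A)
      = (if i \<noteq> k \<and> i \<notin> A \<and> k \<notin> A
         then reorder_sign {k} {i} * reorder_sign {i, k} A * \<Phi> (nths e (A \<union> {i, k})) else 0)"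
    if "A \<subseteq> J" "i < DIM('a)" "k < DIM('a)" for A i k
  proof -
    have sub: "A \<subseteq> {..<length e}" "insert i A \<subseteq> {..<length e}" and fin: "finite A"
      using that J len finite_subset[OF that(1) finJ] by auto
    have "?\<iota> i k (nths e A)
        = (if i \<in> A then 0 else reorder_sign {i} A * \<Phi> (e ! k # nths e (insert i A)))"
      using polyform_Cons_nths[OF interior_prod_polyform[OF \<Phi>, of "e ! k"] _ sub(1), of i] that len
      by (simp add: interior_prod_def)
    also have "\<Phi> (e ! k # nths e (insert i A))
        = (if k \<in> insert i A then 0 else reorder_sign {k} (insert i A) * \<Phi> (nths e (insert k (insert i A))))"
      using polyform_Cons_nths[OF \<Phi> _ sub(2), of k] that len by simp
    finally show ?thesis
      using fin reorder_sign_insert_right[of A i "{k}"] reorder_sign_insert_left[of "{k}" i A]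
      by (auto simp: insert_commute)
  qed
  have wedge_term: "wedge (?\<iota> i k) (?\<iota> i k) (nths e J)
      = (if i \<notin> J \<and> k \<notin> J then if i \<noteq> k then h {i, k} else 0 else 0)"
    if ik: "i < DIM('a)" "k < DIM('a)" for i k
  proof -
    have "wedge (?\<iota> i k) (?\<iota> i k) (nths e J)
      = (\<Sum>A\<in>Pow J. reorder_sign A (J - A) * ?\<iota> i k (nths e A) * ?\<iota> i k (nths e (J - A)))"
      using J len by (intro wedge_nths) simp
    also have "\<dots> = (\<Sum>A\<in>Pow J. if i \<notin> J \<and> k \<notin> J \<and> i \<noteq> k then t {i, k} A else 0)"
    proof (rule sum.cong[OF refl])
      fix A assume "A \<in> Pow J"
      then have A: "A \<subseteq> J" by simp
      have cA: "?\<iota> i k (nths e A) = (if i \<noteq> k \<and> i \<notin> A \<and> k \<notin> A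
           then reorder_sign {k} {i} * reorder_sign {i, k} A * \<Phi> (nths e (A \<union> {i, k})) else 0)"
        by (rule coeff[OF A ik])
      have cB: "?\<iota> i k (nths e (J - A)) = (if i \<noteq> k \<and> i \<notin> J - A \<and> k \<notin> J - A
           then reorder_sign {k} {i} * reorder_sign {i, k} (J - A) * \<Phi> (nths e ((J - A) \<union> {i, k})) else 0)"
        by (rule coeff[OF _ ik]) auto
      have square: "r * (s * p * x) * (s * q * y) = r * p * q * x * y" if "s * s = 1"
        for r s p q x y :: real
        using that by algebra
      show "reorder_sign A (J - A) * ?\<iota> i k (nths e A) * ?\<iota> i k (nths e (J - A))
          = (if i \<notin> J \<and> k \<notin> J \<and> i \<noteq> k then t {i, k} A else 0)"
        unfolding cA cB t_def using A by (auto simp: square[OF reorder_sign_square])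
    qed
    also have "\<dots> = (if i \<notin> J \<and> k \<notin> J then if i \<noteq> k then h {i, k} else 0 else 0)"
      by (simp add: h_def)
    finally show ?thesis .
  qed
  have "Delta2 \<Phi> \<Phi> (nths e J) = 1 / 2 * (\<Sum>i\<in>?U. \<Sum>k\<in>?U.
      if i \<notin> J \<and> k \<notin> J then if i \<noteq> k then h {i, k} else 0 else 0)"
    unfolding Delta2_def Basis_sum by (simp add: wedge_term)
  also have "(\<Sum>i\<in>?U. \<Sum>k\<in>?U. if i \<notin> J \<and> k \<notin> J then if i \<noteq> k then h {i, k} else 0 else 0)
      = (\<Sum>i\<in>?V. \<Sum>k\<in>?U. if i \<notin> J \<and> k \<notin> J then if i \<noteq> k then h {i, k} else 0 else 0)"
    by (rule sum.mono_neutral_right) auto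
  also have "\<dots> = (\<Sum>i\<in>?V. \<Sum>k\<in>?V. if i \<notin> J \<and> k \<notin> J then if i \<noteq> k then h {i, k} else 0 else 0)"
    by (rule sum.cong[OF refl], rule sum.mono_neutral_right) auto
  also have "\<dots> = (\<Sum>i\<in>?V. \<Sum>k\<in>?V. if i \<noteq> k then h {i, k} else 0)"
    by (intro sum.cong refl) auto
  also have "\<dots> = 2 * (\<Sum>K | K \<subseteq> ?V \<and> card K = 2. h K)"
    by (rule sum_unordered_pairs) simp
  finally show ?thesis by (simp add: h_def t_def)
qed

context spinor_module
begin

text \<open>
  The term of the Clifford square with index sets \<open>S\<close> and \<open>S \<Delta> J\<close>, where \<open>S = A \<union> K\<close> with \<open>A\<close> inside
  and \<open>K\<close> outside of \<open>J\<close>, contains the square of the monomial of \<open>K\<close>, which is \<open>-1\<close>.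
\<close>

lemma clifford_coeff_4:
  fixes \<Phi> :: "'a polyform"
  assumes e: "frame e" "set e = Basis" and \<Phi>: "\<Phi> \<in> forms 4" and J: "J \<subseteq> {..<8}" "card J = 4"
  shows "clifford_coeff (\<lambda>S. \<Phi> (nths e S)) (\<lambda>S. \<Phi> (nths e S)) J = - Delta2 \<Phi> \<Phi> (nths e J)"
proof -
  let ?U = "{..<8::nat}"
  let ?V = "?U - J"
  let ?c = "\<lambda>S. \<Phi> (nths e S)"
  have finJ: "finite J" using J finite_subset by blast
  have pf: "\<Phi> \<in> polyforms" by (rule form_polyform[OF \<Phi>])
  have c0: "?c S = 0" if "S \<subseteq> ?U" "card S \<noteq> 4" for S
    using form_nths_eq_0[OF e(1) \<Phi>, of S] that dim8 by simp
  define g where "g S = reorder_sign S (sym_diff S J) * ?c S * ?c (sym_diff S J)" for S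
  define h where "h K A = reorder_sign A (J - A) * reorder_sign K A * reorder_sign K (J - A) * ?c (A \<union> K) * ?c ((J - A) \<union> K)"
    for K A
  have "clifford_coeff ?c ?c J = (\<Sum>S\<in>Pow ?U. g S)"
    by (simp add: clifford_coeff_def g_def dim8)
  also have "\<dots> = (\<Sum>(K, A)\<in>Pow ?V \<times> Pow J. g (A \<union> K))"
    by (rule sum.reindex_bij_witness[where i = "\<lambda>(K, A). A \<union> K" and j = "\<lambda>S. (S - J, S \<inter> J)"])
      (use J in \<open>auto simp: Int_Diff_Un\<close>)
  also have "\<dots> = (\<Sum>K\<in>Pow ?V. \<Sum>A\<in>Pow J. g (A \<union> K))"
    by (simp add: sum.cartesian_product)
  also have "\<dots> = (\<Sum>K\<in>Pow ?V. \<Sum>A\<in>Pow J. if card K = 2 then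
      - h K A else 0)"
  proof (intro sum.cong refl)
    fix K A assume "K \<in> Pow ?V" "A \<in> Pow J"
    then have K: "K \<subseteq> ?V" and A: "A \<subseteq> J" by auto
    have fin: "finite K" "finite A" "finite (J - A)"
      using K A finJ finite_subset[OF K] finite_subset[OF A] by auto
    have disj: "A \<inter> K = {}" "(J - A) \<inter> K = {}" using K A by auto
    have eq: "sym_diff (A \<union> K) J = (J - A) \<union> K" using K A by auto
    have card1: "card (A \<union> K) = card A + card K" using fin disj by (simp add: card_Un_disjoint)
    have "card (J - A) = 4 - card A" using A J fin by (simp add: card_Diff_subset)
    moreover have "card A \<le> 4" using A J finJ by (metis card_mono)
    ultimately have card2: "card ((J - A) \<union> K) + card A = 4 + card K"
      using fin disj by (simp add: card_Un_disjoint)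
    show "g (A \<union> K) = (if card K = 2 then
      - h K A else 0)"
    proof (cases "card A = 2 \<and> card K = 2")
      case True
      have comm: "reorder_sign A K = reorder_sign K A"
        using reorder_sign_swap[of A K] fin disj True by simp
      have "reorder_sign (A \<union> K) ((J - A) \<union> K)
          = reorder_sign A (J - A) * reorder_sign A K * (reorder_sign K (J - A) * reorder_sign K K)"
        using fin disj by (simp add: reorder_sign_Un_left reorder_sign_Un_right)
      also have "reorder_sign K K = -1" using fin True by (simp add: reorder_sign_self)
      finally show ?thesis using True by (simp add: g_def h_def eq comm)
    next
      case False
      then have "card (A \<union> K) \<noteq> 4 \<or> card ((J - A) \<union> K) \<noteq> 4" using card1 card2 by auto
      then have "?c (A \<union> K) = 0 \<or> ?c ((J - A) \<union> K) = 0"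
        using c0[of "A \<union> K"] c0[of "(J - A) \<union> K"] K A J by blast
      then show ?thesis by (auto simp: g_def h_def eq)
    qed
  qed
  also have "\<dots> = - (\<Sum>K\<in>Pow ?V. if card K = 2 then \<Sum>A\<in>Pow J.
      h K A else 0)"
    unfolding sum_negf[symmetric] by (intro sum.cong refl) (simp add: sum_negf)
  also have "(\<Sum>K\<in>Pow ?V. if card K = 2 then \<Sum>A\<in>Pow J.
      h K A else 0)
    = Delta2 \<Phi> \<Phi> (nths e J)"
    using J dim8 by (simp add: Delta2_nths[OF e pf] h_def sum.inter_filter[symmetric])
  finally show ?thesis .
qed

text \<open>
  Outside of the degrees divisible by four the terms with \<open>S\<close> and \<open>S \<Delta> J\<close> exchanged cancel.
\<close>

lemma clifford_coeff_other:
  fixes \<Phi> :: "'a polyform"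
  assumes e: "frame e" and \<Phi>: "\<Phi> \<in> forms 4" and J: "J \<subseteq> {..<8}" "\<not> 4 dvd card J"
  shows "clifford_coeff (\<lambda>S. \<Phi> (nths e S)) (\<lambda>S. \<Phi> (nths e S)) J = 0"
proof -
  let ?U = "{..<8::nat}"
  let ?c = "\<lambda>S. \<Phi> (nths e S)"
  have finJ: "finite J" using J finite_subset by blast
  have c0: "?c S = 0" if "S \<subseteq> ?U" "card S \<noteq> 4" for S
    using form_nths_eq_0[OF e(1) \<Phi>, of S] that dim8 by simp
  define g where "g S = reorder_sign S (sym_diff S J) * ?c S * ?c (sym_diff S J)" for S
  have inv: "sym_diff (sym_diff S J) J = S" for S by auto
  have anti: "g (sym_diff S J) = - g S" if S: "S \<subseteq> ?U" for S
  proof (cases "card S = 4 \<and> card (sym_diff S J) = 4")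
    case True
    have finS: "finite S" using S finite_subset by blast
    have 1: "card (S - J) + card (S \<inter> J) = 4" "card (J - S) + card (S \<inter> J) = card J"
      using True finS finJ card_Int_Diff[of S J] card_Int_Diff[of J S] by (simp_all add: Int_commute)
    have 2: "card (S - J) + card (J - S) = 4"
      using True finS finJ card_Un_disjoint[of "S - J" "J - S"] by auto
    have "odd (card (S - J))"
    proof
      assume "even (card (S - J))"
      then obtain m where "card (S - J) = 2 * m" by (elim evenE)
      then have "card J = 4 * (2 - m)" using 1 2 by auto
      then show False using J(2) by simp
    qed
    moreover have "S \<inter> sym_diff S J = S - J" by auto
    ultimately have "reorder_sign S (sym_diff S J) = - reorder_sign (sym_diff S J) S"
      using reorder_sign_swap[of S "sym_diff S J"] True finS finJ by simp
    then show ?thesis unfolding g_def inv by simp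
  next
    case False
    then have "?c S = 0 \<or> ?c (sym_diff S J) = 0" using c0[of S] c0[of "sym_diff S J"] S J by auto
    then show ?thesis unfolding g_def inv by auto
  qed
  have "(\<Sum>S\<in>Pow ?U. g S) = (\<Sum>S\<in>Pow ?U. g (sym_diff S J))"
    by (rule sum.reindex_bij_witness[where i = "\<lambda>S. sym_diff S J" and j = "\<lambda>S. sym_diff S J"])
      (unfold inv, use J in auto)
  also have "\<dots> = - (\<Sum>S\<in>Pow ?U. g S)" by (simp add: anti sum_negf)
  finally show ?thesis by (simp add: clifford_coeff_def g_def dim8)
qed

lemma clifford_coeff_empty:
  fixes \<Phi> :: "'a polyform"
  assumes e: "frame e" and \<Phi>: "\<Phi> \<in> forms 4"
  shows "clifford_coeff (\<lambda>S. \<Phi> (nths e S)) (\<lambda>S. \<Phi> (nths e S)) {} = (form_norm \<Phi>)\<^sup>2"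
proof -
  have "reorder_sign S S * \<Phi> (nths e S) * \<Phi> (nths e S) = (\<Phi> (nths e S))\<^sup>2" if "S \<in> Pow {..<DIM('a)}" for S
    using form_nths_eq_0[OF e \<Phi>, of S] that
    by (cases "card S = 4") (auto simp: reorder_sign_self_4 power2_eq_square)
  then show ?thesis
    by (simp add: clifford_coeff_def form_norm_square[OF e form_polyform[OF \<Phi>]])
qed

text \<open>
  Self-duality identifies the coefficients at complementary sets, so the top coefficient of the square
  is the same sum of squares as the scalar one.
\<close>

lemma clifford_coeff_full:
  fixes \<Phi> :: "'a polyform"
  assumes e: "positive_frame e" and \<Phi>: "\<Phi> \<in> self_dual_4forms ori"
  shows "clifford_coeff (\<lambda>S. \<Phi> (nths e S)) (\<lambda>S. \<Phi> (nths e S)) {..<8} = (form_norm \<Phi>)\<^sup>2"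
proof -
  have fe: "frame e" by (rule positive_frameD[OF e])
  have f4: "\<Phi> \<in> forms 4" using \<Phi> by (simp add: self_dual_4forms_def)
  have "reorder_sign S (sym_diff S {..<8}) * \<Phi> (nths e S) * \<Phi> (nths e (sym_diff S {..<8})) = (\<Phi> (nths e S))\<^sup>2"
    if S: "S \<in> Pow {..<8}" for S
  proof (cases "card S = 4")
    case True
    have "sym_diff S {..<8} = {..<8} - S" using S by auto
    moreover have "reorder_sign S ({..<8} - S) * \<Phi> (nths e ({..<8} - S)) = \<Phi> (nths e S)"
      using self_dual_nths[OF e \<Phi>, of S] reorder_sign_complement_4(2)[of S] S True by simp
    ultimately show ?thesis
      by (simp add: power2_eq_square mult.commute mult.left_commute)
  next
    case False
    then show ?thesis using form_nths_eq_0[OF fe f4, of S] S dim8 by simp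
  qed
  then show ?thesis
    by (simp add: clifford_coeff_def form_norm_square[OF fe form_polyform[OF f4]] dim8)
qed

theorem clifford_square_self_dual:
  fixes \<Phi> :: "'a polyform"
  assumes \<Phi>: "\<Phi> \<in> self_dual_4forms ori"
  shows "\<Psi> \<Phi> (\<Psi> \<Phi> \<xi>) = (form_norm \<Phi>)\<^sup>2 *\<^sub>R (\<xi> + \<Psi> \<nu> \<xi>) - \<Psi> (Delta2 \<Phi> \<Phi>) \<xi>"
proof -
  obtain e where e: "positive_frame e" "set e = Basis" by (rule positive_Basis_frame)
  have fe: "frame e" by (rule positive_frameD[OF e(1)])
  have f4: "\<Phi> \<in> forms 4" using \<Phi> by (simp add: self_dual_4forms_def)
  have pf: "\<Phi> \<in> polyforms" by (rule form_polyform[OF f4])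
  have D: "Delta2 \<Phi> \<Phi> \<in> forms 4"
    using Delta2_form[of \<Phi> 2 \<Phi> 2] f4 by (simp add: numeral_eq_Suc)
  let ?N = "(form_norm \<Phi>)\<^sup>2"
  let ?c = "clifford_coeff (\<lambda>S. \<Phi> (nths e S)) (\<lambda>S. \<Phi> (nths e S))"
  have sum_pf: "(\<lambda>xs. ?N * one_form xs + ?N * \<nu> xs) \<in> polyforms"
    by (intro add_polyform scale_polyform one_form_polyform volume_form_polyform)
  have "from_coeffs e ?c = (\<lambda>xs. (?N * one_form xs + ?N * \<nu> xs) - Delta2 \<Phi> \<Phi> xs)"
  proof (rule polyform_eqI[OF fe from_coeffs_polyform diff_polyform[OF sum_pf form_polyform[OF D]]])
    fix J assume J': "J \<subseteq> {..<DIM('a)}"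
    then have J: "J \<subseteq> {..<8}" using dim8 by simp
    then have fin: "finite J" using finite_subset by blast
    have card: "card J \<le> 8" using card_mono[OF _ J] by simp
    have full: "card J = 8 \<longleftrightarrow> J = {..<8}" using card_subset_eq[of "{..<8}" J] J by auto
    have ne: "{} \<noteq> {..<8::nat}" by (metis lessThan_iff empty_iff zero_less_numeral)
    have "?c J = ?N * (if J = {} then 1 else 0) + ?N * (if J = {..<8} then 1 else 0) - Delta2 \<Phi> \<Phi> (nths e J)"
    proof (cases "4 dvd card J")
      case True
      then have "card J = 0 \<or> card J = 4 \<or> card J = 8" using card by (auto elim!: dvdE)
      then consider "J = {}" | "card J = 4" | "J = {..<8}" using fin full by auto
      then show ?thesis
      proof cases
        case 2
        then have "J \<noteq> {}" "J \<noteq> {..<8}" by auto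
        then show ?thesis using clifford_coeff_4[OF fe e(2) f4 J 2] by simp
      qed (use clifford_coeff_empty[OF fe f4] clifford_coeff_full[OF e(1) \<Phi>]
          form_nths_eq_0[OF fe D J'] in \<open>auto simp: dim8 ne ne[symmetric]\<close>)
    next
      case False
      then have "J \<noteq> {}" "J \<noteq> {..<8}" "card J \<noteq> 4" by auto
      then show ?thesis
        using clifford_coeff_other[OF fe f4 J False] form_nths_eq_0[OF fe D J'] by simp
    qed
    then show "from_coeffs e ?c (nths e J)
        = (?N * one_form (nths e J) + ?N * \<nu> (nths e J)) - Delta2 \<Phi> \<Phi> (nths e J)"
      using J J' by (simp add: from_coeffs_nths[OF fe] one_form_nths[OF fe] volume_nths[OF e(1)])
  qed
  then have "\<Psi> \<Phi> (\<Psi> \<Phi> \<xi>) = \<Psi> (\<lambda>xs. (?N * one_form xs + ?N * \<nu> xs) - Delta2 \<Phi> \<Phi> xs) \<xi>"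
    by (simp add: \<Psi>_mult[OF fe pf pf])
  then show ?thesis
    by (simp add: \<Psi>_diff[OF sum_pf form_polyform[OF D]] \<Psi>_combination one_form_polyform
        volume_form_polyform \<Psi>_one scaleR_add_right)
qed

text \<open>
  The representation is faithful, so the equation may be read as one between operators, where the
  formula for the Clifford square replaces \<open>\<Delta>\<^sub>2\<close>.
\<close>

lemma quadratic_equation_iff:
  fixes \<Phi> :: "'a polyform"
  assumes \<Phi>: "\<Phi> \<in> self_dual_4forms ori" and \<kappa>: "form_norm \<Phi> = sqrt 14 * \<kappa>"
  shows "(\<lambda>xs. sqrt 14 * Delta2 \<Phi> \<Phi> xs + 12 * form_norm \<Phi> * \<Phi> xs) = (\<lambda>_. 0)
    \<longleftrightarrow> (\<forall>\<xi>. \<Psi> \<Phi> (\<Psi> \<Phi> \<xi>) = (14 * \<kappa>\<^sup>2) *\<^sub>R (\<xi> + \<Psi> \<nu> \<xi>) + (12 * \<kappa>) *\<^sub>R \<Psi> \<Phi> \<xi>)"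
proof -
  have f4: "\<Phi> \<in> forms 4" using \<Phi> by (simp add: self_dual_4forms_def)
  have pf: "\<Phi> \<in> polyforms" by (rule form_polyform[OF f4])
  have D: "Delta2 \<Phi> \<Phi> \<in> polyforms"
    using Delta2_form[of \<Phi> 2 \<Phi> 2] f4 by (simp add: numeral_eq_Suc forms_def)
  have "(\<lambda>xs. sqrt 14 * Delta2 \<Phi> \<Phi> xs + 12 * form_norm \<Phi> * \<Phi> xs) = (\<lambda>_. 0)
      \<longleftrightarrow> Delta2 \<Phi> \<Phi> = (\<lambda>xs. (- 12 * \<kappa>) * \<Phi> xs)"
  proof -
    have "sqrt 14 * Delta2 \<Phi> \<Phi> xs + 12 * form_norm \<Phi> * \<Phi> xs = sqrt 14 * (Delta2 \<Phi> \<Phi> xs + 12 * \<kappa> * \<Phi> xs)" for xs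
      by (simp add: \<kappa> algebra_simps)
    then show ?thesis by (auto simp: fun_eq_iff add_eq_0_iff2)
  qed
  also have "\<dots> \<longleftrightarrow> (\<forall>\<xi>. \<Psi> (Delta2 \<Phi> \<Phi>) \<xi> = (- 12 * \<kappa>) *\<^sub>R \<Psi> \<Phi> \<xi>)"
    using \<Psi>_inj[OF D scale_polyform[OF pf]] \<Psi>_scale[OF pf] by metis
  also have "\<dots> \<longleftrightarrow> (\<forall>\<xi>. \<Psi> \<Phi> (\<Psi> \<Phi> \<xi>) = (14 * \<kappa>\<^sup>2) *\<^sub>R (\<xi> + \<Psi> \<nu> \<xi>) + (12 * \<kappa>) *\<^sub>R \<Psi> \<Phi> \<xi>)"
  proof -
    have "(form_norm \<Phi>)\<^sup>2 = 14 * \<kappa>\<^sup>2" by (simp add: \<kappa> power_mult_distrib)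
    then have "\<Psi> \<Phi> (\<Psi> \<Phi> \<xi>) = (14 * \<kappa>\<^sup>2) *\<^sub>R (\<xi> + \<Psi> \<nu> \<xi>) - \<Psi> (Delta2 \<Phi> \<Phi>) \<xi>" for \<xi>
      using clifford_square_self_dual[OF \<Phi>, of \<xi>] by simp
    moreover have "X - A = X + B \<longleftrightarrow> A = - B" for X A B :: 's
      by (metis add_left_cancel diff_conv_add_uminus minus_minus)
    ultimately show ?thesis by simp
  qed
  finally show ?thesis .
qed

end

section \<open>The Cayley form of a frame\<close>

text \<open>
  The fourteen words of length four with the signs of the model form. The index \<open>p\<close> stands for the
  coordinate \<open>p + 1\<close>.
\<close>

definition cayley_words :: "(nat list \<times> real) set" where
  "cayley_words =
    {([0,1,2,3], -1), ([0,1,4,5], -1), ([0,1,6,7], -1), ([0,2,4,6], -1), ([0,2,5,7], 1),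
     ([0,3,4,7], 1), ([0,3,5,6], 1), ([4,5,6,7], -1), ([2,3,6,7], -1), ([2,3,4,5], -1),
     ([1,3,5,7], -1), ([1,3,4,6], 1), ([1,2,4,7], 1), ([1,2,5,6], 1)}"

definition cayley_form :: "'a::real_inner list \<Rightarrow> 'a polyform" where
  "cayley_form e xs = (\<Sum>(w, s)\<in>cayley_words. s * monomial e w xs)"

lemma cayley_words_finite: "finite cayley_words"
  by (simp add: cayley_words_def)

lemma cayley_words_word:
  assumes "(w, s) \<in> cayley_words"
  shows "sorted_wrt (<) w" "set w \<subseteq> {..<8}" "card (set w) = 4" "s * s = 1"
  using assms by (auto simp: cayley_words_def)

lemma cayley_words_unique:
  assumes "(w, s) \<in> cayley_words" "(w', s') \<in> cayley_words" "set w = set w'"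
  shows "w = w' \<and> s = s'"
proof -
  have "w = w'"
    using cayley_words_word(1)[OF assms(1)] cayley_words_word(1)[OF assms(2)] assms(3)
      strict_sorted_equal by blast
  then show ?thesis using assms(1,2) by (auto simp: cayley_words_def)
qed

lemma cayley_form_polyform: "cayley_form e \<in> polyforms"
proof -
  have "cayley_form e = (\<lambda>xs. \<Sum>p\<in>cayley_words. snd p * monomial e (fst p) xs)"
    by (simp add: cayley_form_def fun_eq_iff case_prod_beta)
  then show ?thesis by (simp only:) (intro sum_polyform scale_polyform monomial_polyform)
qed

lemma cayley_form_nths:
  fixes e :: "'a::euclidean_space list"
  assumes "frame e" "DIM('a) = 8" "T \<subseteq> {..<8}"
  shows "cayley_form e (nths e T) = (\<Sum>(w, s)\<in>cayley_words. if T = set w then s else 0)"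
  unfolding cayley_form_def
  using monomial_nths[OF assms(1), of _ T] assms(2,3) cayley_words_word
  by (intro sum.cong refl) (auto split: if_splits)

lemma cayley_form_nths_word:
  fixes e :: "'a::euclidean_space list"
  assumes "frame e" "DIM('a) = 8" "(w, s) \<in> cayley_words"
  shows "cayley_form e (nths e (set w)) = s"
proof -
  have "cayley_form e (nths e (set w)) = (\<Sum>p\<in>cayley_words. if p = (w, s) then s else 0)"
    unfolding cayley_form_nths[OF assms(1,2) cayley_words_word(2)[OF assms(3)]]
    using cayley_words_unique[OF assms(3)] by (intro sum.cong refl) (auto split: if_splits)
  then show ?thesis using assms(3) cayley_words_finite by simp
qed

lemma cayley_form_form:
  fixes e :: "'a::euclidean_space list"
  assumes "frame e" "DIM('a) = 8"
  shows "cayley_form e \<in> forms 4"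
proof (rule form_if_nths[OF assms(1) cayley_form_polyform])
  fix T assume T: "T \<subseteq> {..<DIM('a)}" "card T \<noteq> 4"
  then have "T \<noteq> set w" if "(w, s) \<in> cayley_words" for w s
    using cayley_words_word(3)[OF that] by auto
  then show "cayley_form e (nths e T) = 0"
    using T assms by (auto simp: cayley_form_nths intro!: sum.neutral)
qed

text \<open>
  The coefficients are supported on distinct sets, so the sum has a summand \<open>1\<close> for every word.
\<close>

lemma cayley_form_norm_sum:
  fixes e :: "'a::euclidean_space list"
  assumes "frame e" "DIM('a) = 8"
  shows "(\<Sum>T\<in>Pow {..<DIM('a)}. (cayley_form e (nths e T))\<^sup>2) = 14"
proof -
  let ?c = "\<lambda>T. cayley_form e (nths e T)"
  have "(\<Sum>T\<in>Pow {..<8}. (?c T)\<^sup>2) = (\<Sum>T\<in>Pow {..<8}. \<Sum>p\<in>cayley_words. if T = set (fst p) then snd p * ?c T else 0)"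
  proof (rule sum.cong[OF refl])
    fix T :: "nat set" assume "T \<in> Pow {..<8}"
    then have "?c T = (\<Sum>(w, s)\<in>cayley_words. if T = set w then s else 0)"
      using cayley_form_nths[OF assms] by simp
    then have "(?c T)\<^sup>2 = (\<Sum>(w, s)\<in>cayley_words. if T = set w then s else 0) * ?c T"
      by (simp add: power2_eq_square)
    also have "\<dots> = (\<Sum>p\<in>cayley_words. (if T = set (fst p) then snd p else 0) * ?c T)"
      by (simp add: sum_distrib_right case_prod_beta)
    also have "\<dots> = (\<Sum>p\<in>cayley_words. if T = set (fst p) then snd p * ?c T else 0)"
      by (intro sum.cong refl) auto
    finally show "(?c T)\<^sup>2 = (\<Sum>p\<in>cayley_words. if T = set (fst p) then snd p * ?c T else 0)" .
  qed
  also have "\<dots> = (\<Sum>p\<in>cayley_words. \<Sum>T\<in>Pow {..<8}. if T = set (fst p) then snd p * ?c T else 0)"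
    by (rule sum.swap)
  also have "\<dots> = (\<Sum>p\<in>cayley_words. 1)"
  proof (rule sum.cong[OF refl])
    fix p assume p: "p \<in> cayley_words"
    obtain w s where ws: "p = (w, s)" by (cases p)
    have "(\<Sum>T\<in>Pow {..<8}. if T = set (fst p) then snd p * ?c T else 0)
        = (if set w \<in> Pow {..<8} then snd p * ?c (set w) else 0)"
      by (simp add: ws)
    then show "(\<Sum>T\<in>Pow {..<8}. if T = set (fst p) then snd p * ?c T else 0) = 1"
      using cayley_words_word[of w s] cayley_form_nths_word[OF assms, of w s] p ws by simp
  qed
  also have "\<dots> = 14" by (simp add: cayley_words_def)
  finally show ?thesis using assms(2) by simp
qed

section \<open>Squares of spinors\<close>

context spinor_module
begin

lemma op_inner_form_norm:
  fixes \<alpha> :: "'a polyform"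
  assumes "\<alpha> \<in> polyforms"
  shows "op_inner (\<Psi> \<alpha>) (\<Psi> \<alpha>) = 16 * (form_norm \<alpha>)\<^sup>2"
proof -
  obtain e :: "'a list" where e: "frame e" using Basis_frame by blast
  show ?thesis
    using op_inner_\<Psi>[OF e assms assms] form_norm_square[OF e assms] by (simp add: power2_eq_square)
qed

text \<open>
  If \<open>\<xi>\<close> is an eigenvector of an operator with eigenvalue \<open>|\<xi>|\<^sup>2\<close> and the operator has Hilbert-Schmidt
  norm \<open>|\<xi>|\<^sup>2\<close>, then there is no room for anything besides \<open>\<xi> \<otimes> \<xi>\<^sup>*\<close>: the distance of the two operators
  vanishes.
\<close>

lemma rank_one_if_norm:
  fixes \<alpha> :: "'a polyform"
  assumes \<alpha>: "\<alpha> \<in> polyforms" and eigen: "\<Psi> \<alpha> \<xi> = (\<xi> \<bullet> \<xi>) *\<^sub>R \<xi>"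
    and norm: "16 * (form_norm \<alpha>)\<^sup>2 = (\<xi> \<bullet> \<xi>)\<^sup>2"
  shows "\<Psi> \<alpha> \<eta> = (\<xi> \<bullet> \<eta>) *\<^sub>R \<xi>"
proof -
  have lin: "linear (\<Psi> \<alpha>)" by (rule linear_\<Psi>[OF \<alpha>])
  define Q where "Q \<eta> = \<Psi> \<alpha> \<eta> - (\<xi> \<bullet> \<eta>) *\<^sub>R \<xi>" for \<eta>
  have linQ: "linear Q"
    unfolding Q_def by (intro linear_compose_sub lin linearI) (simp_all add: inner_add_right scaleR_add_left)
  have 1: "(\<Sum>b\<in>Basis. (\<xi> \<bullet> b) * (\<Psi> \<alpha> b \<bullet> \<xi>)) = (\<xi> \<bullet> \<xi>)\<^sup>2"
  proof -
    have "\<Psi> \<alpha> \<xi> = \<Psi> \<alpha> (\<Sum>b\<in>Basis. (\<xi> \<bullet> b) *\<^sub>R b)" by (simp add: euclidean_representation)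
    also have "\<dots> = (\<Sum>b\<in>Basis. (\<xi> \<bullet> b) *\<^sub>R \<Psi> \<alpha> b)"
      by (simp add: linear_sum[OF lin] linear_scale[OF lin])
    finally show ?thesis using eigen by (metis (no_types, lifting) inner_scaleR_left inner_sum_left power2_eq_square sum.cong)
  qed
  have 2: "(\<Sum>b\<in>Basis. (\<xi> \<bullet> b) * (\<xi> \<bullet> b)) = \<xi> \<bullet> \<xi>"
    by (rule euclidean_inner[symmetric])
  have "op_inner Q Q = (\<Sum>b\<in>Basis. \<Psi> \<alpha> b \<bullet> \<Psi> \<alpha> b - 2 * ((\<xi> \<bullet> b) * (\<Psi> \<alpha> b \<bullet> \<xi>)) + ((\<xi> \<bullet> b) * (\<xi> \<bullet> b)) * (\<xi> \<bullet> \<xi>))"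
    unfolding op_inner_def Q_def
    by (intro sum.cong refl) (simp add: inner_diff_left inner_diff_right inner_commute)
  also have "\<dots> = op_inner (\<Psi> \<alpha>) (\<Psi> \<alpha>) - 2 * (\<Sum>b\<in>Basis. (\<xi> \<bullet> b) * (\<Psi> \<alpha> b \<bullet> \<xi>))
      + (\<Sum>b\<in>Basis. (\<xi> \<bullet> b) * (\<xi> \<bullet> b)) * (\<xi> \<bullet> \<xi>)"
    by (simp add: sum.distrib sum_subtractf sum_distrib_left sum_distrib_right op_inner_def)
  also have "\<dots> = 0"
    unfolding 1 2 op_inner_form_norm[OF \<alpha>] norm by (simp add: power2_eq_square)
  finally have "Q \<eta> = 0" by (rule op_inner_self_eq_0[OF linQ])
  then show ?thesis by (simp add: Q_def)
qed

text \<open>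
  With \<open>\<kappa> = |\<Phi>| / sqrt 14\<close>, this is the candidate for the square of a spinor.
\<close>

definition spinor_polyform :: "real \<Rightarrow> 'a polyform \<Rightarrow> 'a polyform" where
  "spinor_polyform \<kappa> \<Phi> xs = 1 / 16 * (\<kappa> * one_form xs + \<Phi> xs + \<kappa> * \<nu> xs)"

lemma spinor_polyform_polyform:
  assumes "\<Phi> \<in> polyforms"
  shows "spinor_polyform \<kappa> \<Phi> \<in> polyforms"
proof -
  have "spinor_polyform \<kappa> \<Phi> = (\<lambda>xs. 1 / 16 * (\<kappa> * one_form xs + \<Phi> xs + \<kappa> * \<nu> xs))"
    by (simp add: fun_eq_iff spinor_polyform_def)
  then show ?thesis
    by (simp only:) (intro scale_polyform add_polyform one_form_polyform volume_form_polyform assms)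
qed

lemma \<Psi>_spinor_polyform:
  assumes "\<Phi> \<in> polyforms"
  shows "\<Psi> (spinor_polyform \<kappa> \<Phi>) \<xi> = (1 / 16) *\<^sub>R (\<kappa> *\<^sub>R \<xi> + \<Psi> \<Phi> \<xi> + \<kappa> *\<^sub>R \<Psi> \<nu> \<xi>)"
proof -
  have eq: "spinor_polyform \<kappa> \<Phi> = (\<lambda>xs. 1 / 16 * (\<kappa> * one_form xs + \<Phi> xs + \<kappa> * \<nu> xs))"
    by (simp add: fun_eq_iff spinor_polyform_def)
  have "(\<lambda>xs. \<kappa> * one_form xs + \<Phi> xs + \<kappa> * \<nu> xs) \<in> polyforms"
    by (intro add_polyform scale_polyform one_form_polyform volume_form_polyform assms)
  then have "\<Psi> (spinor_polyform \<kappa> \<Phi>) \<xi>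
      = (1 / 16) *\<^sub>R \<Psi> (\<lambda>xs. \<kappa> * one_form xs + \<Phi> xs + \<kappa> * \<nu> xs) \<xi>"
    unfolding eq by (rule \<Psi>_scale)
  then show ?thesis
    by (simp add: \<Psi>_scale \<Psi>_add \<Psi>_one add_polyform scale_polyform one_form_polyform
        volume_form_polyform assms)
qed

lemma spinor_polyform_norm:
  assumes \<Phi>: "\<Phi> \<in> forms 4"
  shows "256 * (form_norm (spinor_polyform \<kappa> \<Phi>))\<^sup>2 = 2 * \<kappa>\<^sup>2 + (form_norm \<Phi>)\<^sup>2"
proof -
  obtain e where e: "positive_frame e" by (rule positive_Basis_frame)
  have fe: "frame e" by (rule positive_frameD[OF e(1)])
  have pf: "\<Phi> \<in> polyforms" by (rule form_polyform[OF \<Phi>])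
  let ?a = "\<lambda>S. spinor_polyform \<kappa> \<Phi> (nths e S)"
  have "256 * (?a S)\<^sup>2 = (if S = {} then \<kappa>\<^sup>2 else 0) + (if S = {..<8} then \<kappa>\<^sup>2 else 0) + (\<Phi> (nths e S))\<^sup>2"
    if S: "S \<in> Pow {..<8}" for S
  proof -
    have "\<Phi> (nths e S) = 0" if "S = {} \<or> S = {..<8}"
      using that form_nths_eq_0[OF fe \<Phi>, of S] dim8 by auto
    moreover have "{} \<noteq> {..<8::nat}" by (metis lessThan_iff empty_iff zero_less_numeral)
    ultimately show ?thesis
      using S dim8 by (auto simp: spinor_polyform_def one_form_nths[OF fe] volume_nths[OF e] power_divide)
  qed
  then have "(\<Sum>S\<in>Pow {..<8}. 256 * (?a S)\<^sup>2) = (\<Sum>S\<in>Pow {..<8}.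
      (if S = {} then \<kappa>\<^sup>2 else 0) + (if S = {..<8} then \<kappa>\<^sup>2 else 0) + (\<Phi> (nths e S))\<^sup>2)"
    by (rule sum.cong[OF refl])
  then show ?thesis
    using dim8 by (simp add: form_norm_square[OF fe spinor_polyform_polyform[OF pf]]
        form_norm_square[OF fe pf] sum.distrib sum_distrib_left)
qed

text \<open>
  Monomials of even degree commute with the one of full degree eight.
\<close>

lemma volume_op_commute:
  assumes \<Phi>: "\<Phi> \<in> forms 4"
  shows "\<Psi> \<Phi> (\<Psi> \<nu> \<xi>) = \<Psi> \<nu> (\<Psi> \<Phi> \<xi>)"
proof -
  obtain e where e: "positive_frame e" by (rule positive_Basis_frame)
  have fe: "frame e" by (rule positive_frameD[OF e(1)])
  have pf: "\<Phi> \<in> polyforms" by (rule form_polyform[OF \<Phi>])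
  have "\<Phi> (nths e S) *\<^sub>R mono_op e S (mono_op e {..<8} \<xi>)
      = \<Phi> (nths e S) *\<^sub>R mono_op e {..<8} (mono_op e S \<xi>)" if S: "S \<in> Pow {..<8}" for S
  proof (cases "card S = 4")
    case True
    have fin: "finite S" using S finite_subset by auto
    have "S \<inter> {..<8} = S" using S by auto
    then have "reorder_sign S {..<8} = reorder_sign {..<8} S"
      using reorder_sign_swap[of S "{..<8}"] fin True by simp
    moreover have "sym_diff S {..<8} = sym_diff {..<8} S" by auto
    ultimately show ?thesis using S dim8 by (simp add: mono_op_mult[OF fe])
  next
    case False
    then show ?thesis using form_nths_eq_0[OF fe \<Phi>, of S] S dim8 by simp
  qed
  then have "(\<Sum>S\<in>Pow {..<8}. \<Phi> (nths e S) *\<^sub>R mono_op e S (mono_op e {..<8} \<xi>))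
      = (\<Sum>S\<in>Pow {..<8}. \<Phi> (nths e S) *\<^sub>R mono_op e {..<8} (mono_op e S \<xi>))"
    by (rule sum.cong[OF refl])
  then show ?thesis
    unfolding \<Psi>_volume[OF e] \<Psi>_expansion[OF fe pf] dim8
    by (simp add: linear_sum[OF linear_mono_op] linear_scale[OF linear_mono_op])
qed

text \<open>
  Since \<open>\<nu>\<^sup>2 = 1\<close> and \<open>\<nu> \<Phi> = \<Phi> \<nu> = \<Phi>\<close>, the square of \<open>\<kappa> + \<Phi> + \<kappa> \<nu>\<close> is
  \<open>2 \<kappa>\<^sup>2 (1 + \<nu>) + 4 \<kappa> \<Phi> + \<Phi>\<^sup>2\<close>. This is \<open>16 \<kappa> (\<kappa> + \<Phi> + \<kappa> \<nu>)\<close> exactly if \<open>\<Phi>\<^sup>2\<close> has the stated value.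
\<close>

lemma spinor_polyform_idempotent_iff:
  assumes \<Phi>: "\<Phi> \<in> self_dual_4forms ori"
  shows "(\<forall>\<xi>. \<Psi> (spinor_polyform \<kappa> \<Phi>) (\<Psi> (spinor_polyform \<kappa> \<Phi>) \<xi>) = \<kappa> *\<^sub>R \<Psi> (spinor_polyform \<kappa> \<Phi>) \<xi>)
    \<longleftrightarrow> (\<forall>\<xi>. \<Psi> \<Phi> (\<Psi> \<Phi> \<xi>) = (14 * \<kappa>\<^sup>2) *\<^sub>R (\<xi> + \<Psi> \<nu> \<xi>) + (12 * \<kappa>) *\<^sub>R \<Psi> \<Phi> \<xi>)"
proof -
  have f4: "\<Phi> \<in> forms 4" using \<Phi> by (simp add: self_dual_4forms_def)
  have pf: "\<Phi> \<in> polyforms" by (rule form_polyform[OF f4])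
  have inv: "\<Psi> \<nu> (\<Psi> \<Phi> \<xi>) = \<Psi> \<Phi> \<xi>" for \<xi>
    using \<Phi> self_dual_iff_volume_op[OF f4] by blast
  have inv': "\<Psi> \<Phi> (\<Psi> \<nu> \<xi>) = \<Psi> \<Phi> \<xi>" for \<xi>
    by (simp add: volume_op_commute[OF f4] inv)
  note lin = linear_\<Psi>[OF pf] linear_\<Psi>[OF volume_form_polyform]
  note lin_simps = lin[THEN linear_add] lin[THEN linear_scale]
  let ?E = "\<Psi> (spinor_polyform \<kappa> \<Phi>)"
  have "?E (?E \<xi>) = \<kappa> *\<^sub>R ?E \<xi>
    \<longleftrightarrow> \<Psi> \<Phi> (\<Psi> \<Phi> \<xi>) = (14 * \<kappa>\<^sup>2) *\<^sub>R (\<xi> + \<Psi> \<nu> \<xi>) + (12 * \<kappa>) *\<^sub>R \<Psi> \<Phi> \<xi>" for \<xi>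
  proof -
    have "256 *\<^sub>R (?E (?E \<xi>)) = (2 * \<kappa>\<^sup>2) *\<^sub>R (\<xi> + \<Psi> \<nu> \<xi>) + (4 * \<kappa>) *\<^sub>R \<Psi> \<Phi> \<xi> + \<Psi> \<Phi> (\<Psi> \<Phi> \<xi>)"
    proof -
      have "256 *\<^sub>R (?E (?E \<xi>)) = \<kappa> *\<^sub>R (\<kappa> *\<^sub>R \<xi> + \<Psi> \<Phi> \<xi> + \<kappa> *\<^sub>R \<Psi> \<nu> \<xi>)
        + \<Psi> \<Phi> (\<kappa> *\<^sub>R \<xi> + \<Psi> \<Phi> \<xi> + \<kappa> *\<^sub>R \<Psi> \<nu> \<xi>) + \<kappa> *\<^sub>R \<Psi> \<nu> (\<kappa> *\<^sub>R \<xi> + \<Psi> \<Phi> \<xi> + \<kappa> *\<^sub>R \<Psi> \<nu> \<xi>)"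
      proof -
        define M where "M \<eta> = \<kappa> *\<^sub>R \<eta> + \<Psi> \<Phi> \<eta> + \<kappa> *\<^sub>R \<Psi> \<nu> \<eta>" for \<eta>
        have EM: "?E \<eta> = (1 / 16) *\<^sub>R M \<eta>" for \<eta>
          unfolding M_def by (rule \<Psi>_spinor_polyform[OF pf])
        have "M (c *\<^sub>R \<eta>) = c *\<^sub>R M \<eta>" for c \<eta>
          by (simp add: M_def lin[THEN linear_scale] scaleR_add_right mult.commute)
        then have "256 *\<^sub>R (?E (?E \<xi>)) = M (M \<xi>)" by (simp add: EM)
        then show ?thesis by (simp add: M_def)
      qed
      also have "\<dots> = (\<kappa> * \<kappa>) *\<^sub>R \<xi> + \<kappa> *\<^sub>R \<Psi> \<Phi> \<xi> + (\<kappa> * \<kappa>) *\<^sub>R \<Psi> \<nu> \<xi>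
        + (\<kappa> *\<^sub>R \<Psi> \<Phi> \<xi> + \<Psi> \<Phi> (\<Psi> \<Phi> \<xi>) + \<kappa> *\<^sub>R \<Psi> \<Phi> \<xi>)
        + ((\<kappa> * \<kappa>) *\<^sub>R \<Psi> \<nu> \<xi> + \<kappa> *\<^sub>R \<Psi> \<Phi> \<xi> + (\<kappa> * \<kappa>) *\<^sub>R \<xi>)"
        by (simp add: lin_simps inv inv' volume_involution scaleR_add_right)
      finally show ?thesis
        by (simp add: power2_eq_square scaleR_add_right scaleR_2[symmetric] algebra_simps)
          (simp add: algebra_simps flip: scaleR_add_left)
    qed
    moreover have "256 *\<^sub>R (\<kappa> *\<^sub>R ?E \<xi>) = (16 * \<kappa>\<^sup>2) *\<^sub>R (\<xi> + \<Psi> \<nu> \<xi>) + (16 * \<kappa>) *\<^sub>R \<Psi> \<Phi> \<xi>"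
      by (simp add: \<Psi>_spinor_polyform[OF pf] power2_eq_square algebra_simps)
    moreover have "X = Y \<longleftrightarrow> 256 *\<^sub>R X = 256 *\<^sub>R Y" for X Y :: 's
      by simp
    moreover note this[of "?E (?E \<xi>)" "\<kappa> *\<^sub>R ?E \<xi>"]
    moreover have "(2 * \<kappa>\<^sup>2) *\<^sub>R X + (4 * \<kappa>) *\<^sub>R Y + Z = (16 * \<kappa>\<^sup>2) *\<^sub>R X + (16 * \<kappa>) *\<^sub>R Y
        \<longleftrightarrow> Z = (14 * \<kappa>\<^sup>2) *\<^sub>R X + (12 * \<kappa>) *\<^sub>R Y" for X Y Z :: 's
    proof -
      have "(16 * \<kappa>\<^sup>2) *\<^sub>R X + (16 * \<kappa>) *\<^sub>R Y
          = (2 * \<kappa>\<^sup>2) *\<^sub>R X + (4 * \<kappa>) *\<^sub>R Y + ((14 * \<kappa>\<^sup>2) *\<^sub>R X + (12 * \<kappa>) *\<^sub>R Y)"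
        by (simp add: algebra_simps flip: scaleR_add_left)
      then show ?thesis by simp
    qed
    ultimately show ?thesis by metis
  qed
  then show ?thesis by simp
qed

text \<open>
  Every nonzero value of the operator is an eigenspinor with eigenvalue \<open>\<kappa>\<close>. Scaled to \<open>|\<xi>|\<^sup>2 = \<kappa>\<close>, it
  meets the norm criterion, because the norm of the polyform is \<open>\<kappa> / 4\<close>.
\<close>

lemma spinor_of_quadratic_equation:
  assumes \<Phi>: "\<Phi> \<in> self_dual_4forms ori" and \<kappa>: "form_norm \<Phi> = sqrt 14 * \<kappa>" "0 < \<kappa>"
    and idem: "\<And>\<xi>. \<Psi> (spinor_polyform \<kappa> \<Phi>) (\<Psi> (spinor_polyform \<kappa> \<Phi>) \<xi>) = \<kappa> *\<^sub>R \<Psi> (spinor_polyform \<kappa> \<Phi>) \<xi>"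
  obtains \<xi> where "\<xi> \<noteq> 0" "\<Psi> \<nu> \<xi> = \<xi>" "\<And>\<eta>. \<Psi> (spinor_polyform \<kappa> \<Phi>) \<eta> = (\<xi> \<bullet> \<eta>) *\<^sub>R \<xi>"
proof -
  have f4: "\<Phi> \<in> forms 4" using \<Phi> by (simp add: self_dual_4forms_def)
  have pf: "\<Phi> \<in> polyforms" by (rule form_polyform[OF f4])
  let ?\<alpha> = "spinor_polyform \<kappa> \<Phi>"
  have p\<alpha>: "?\<alpha> \<in> polyforms" by (rule spinor_polyform_polyform[OF pf])
  have inv: "\<Psi> \<nu> (\<Psi> \<Phi> \<xi>) = \<Psi> \<Phi> \<xi>" for \<xi>
    using \<Phi> self_dual_iff_volume_op[OF f4] by blast
  have norm: "16 * (form_norm ?\<alpha>)\<^sup>2 = \<kappa>\<^sup>2"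
    using spinor_polyform_norm[OF f4, of \<kappa>] \<kappa> by (simp add: power_mult_distrib)
  have "\<exists>b\<in>Basis. \<Psi> ?\<alpha> b \<noteq> 0"
  proof (rule ccontr)
    assume "\<not> (\<exists>b\<in>Basis. \<Psi> ?\<alpha> b \<noteq> 0)"
    then have "op_inner (\<Psi> ?\<alpha>) (\<Psi> ?\<alpha>) = 0" by (simp add: op_inner_def)
    then show False using op_inner_form_norm[OF p\<alpha>] norm \<kappa>(2) by simp
  qed
  then obtain b where b: "\<Psi> ?\<alpha> b \<noteq> 0" by blast
  define t where "t = sqrt \<kappa> / norm (\<Psi> ?\<alpha> b)"
  define \<xi> where "\<xi> = t *\<^sub>R \<Psi> ?\<alpha> b"
  have t: "0 < t" using b \<kappa>(2) by (simp add: t_def)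
  have "\<xi> \<bullet> \<xi> = (t * norm (\<Psi> ?\<alpha> b))\<^sup>2"
    by (simp add: \<xi>_def power_mult_distrib power2_norm_eq_inner) (simp add: power2_eq_square)
  also have "t * norm (\<Psi> ?\<alpha> b) = sqrt \<kappa>" using b by (simp add: t_def)
  finally have sq: "\<xi> \<bullet> \<xi> = \<kappa>" using \<kappa>(2) by simp
  have eigen: "\<Psi> ?\<alpha> \<xi> = (\<xi> \<bullet> \<xi>) *\<^sub>R \<xi>"
    unfolding sq by (simp add: \<xi>_def linear_scale[OF linear_\<Psi>[OF p\<alpha>]] idem)
  have "\<Psi> \<nu> (\<Psi> ?\<alpha> b) = \<Psi> ?\<alpha> b"
    by (simp add: \<Psi>_spinor_polyform[OF pf] linear_scale[OF linear_\<Psi>[OF volume_form_polyform]]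
        linear_add[OF linear_\<Psi>[OF volume_form_polyform]] inv volume_involution algebra_simps)
  then have "\<Psi> \<nu> \<xi> = \<xi>" by (simp add: \<xi>_def linear_scale[OF linear_\<Psi>[OF volume_form_polyform]])
  moreover have "\<xi> \<noteq> 0" using sq \<kappa>(2) by auto
  moreover have "\<Psi> ?\<alpha> \<eta> = (\<xi> \<bullet> \<eta>) *\<^sub>R \<xi>" for \<eta>
    by (rule rank_one_if_norm[OF p\<alpha> eigen]) (simp add: norm sq)
  ultimately show ?thesis using that by blast
qed

text \<open>Signed monomials that fix a spinor form a group.\<close>

lemma mono_op_eigen_mult:
  assumes e: "frame e" and "S \<subseteq> {..<8}" "T \<subseteq> {..<8}"
    and S: "mono_op e S \<xi> = s *\<^sub>R \<xi>" and T: "mono_op e T \<xi> = t *\<^sub>R \<xi>"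
    and R: "R = sym_diff S T" and r: "r = reorder_sign S T * (s * t)"
  shows "mono_op e R \<xi> = r *\<^sub>R \<xi>"
proof -
  have "(s * t) *\<^sub>R \<xi> = reorder_sign S T *\<^sub>R mono_op e R \<xi>"
    using mono_op_mult[OF e, of S T \<xi>] assms dim8
    by (simp add: linear_scale[OF linear_mono_op] mult.commute)
  then have "reorder_sign S T *\<^sub>R ((s * t) *\<^sub>R \<xi>) = (reorder_sign S T * reorder_sign S T) *\<^sub>R mono_op e R \<xi>"
    by simp
  then show ?thesis by (simp add: r)
qed

text \<open>
  The conditions on the spinor are for four generators of the group of signed monomials; the others
  follow in \<open>adapted_words\<close>.
\<close>

definition adapted :: "'a list \<Rightarrow> 's \<Rightarrow> bool" where
  "adapted e \<xi> \<longleftrightarrow> positive_frame e \<and> mono_op e {0,1,2,3} \<xi> = -1 *\<^sub>R \<xi> \<and>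
     mono_op e {0,1,4,5} \<xi> = -1 *\<^sub>R \<xi> \<and> mono_op e {0,2,4,6} \<xi> = -1 *\<^sub>R \<xi> \<and> \<Psi> \<nu> \<xi> = \<xi>"

lemma adapted_words:
  assumes ad: "adapted e \<xi>" and w: "(w, s) \<in> cayley_words"
  shows "mono_op e (set w) \<xi> = s *\<^sub>R \<xi>"
proof -
  have e: "positive_frame e" and fe: "frame e" using ad by (auto simp: adapted_def positive_frame_def)
  have U: "{..<8} = {0,1,2,3,4,5,6,7::nat}" by auto
  note mult = mono_op_eigen_mult[OF fe]
  have a: "mono_op e {0,1,2,3} \<xi> = -1 *\<^sub>R \<xi>" and b: "mono_op e {0,1,4,5} \<xi> = -1 *\<^sub>R \<xi>"
    and c: "mono_op e {0,2,4,6} \<xi> = -1 *\<^sub>R \<xi>" and u: "mono_op e {0,1,2,3,4,5,6,7} \<xi> = 1 *\<^sub>R \<xi>"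
    using ad \<Psi>_volume[OF e] unfolding adapted_def U by simp_all
  have ab: "mono_op e {2,3,4,5} \<xi> = -1 *\<^sub>R \<xi>"
    by (rule mult[OF _ _ a b]) (auto simp: reorder_sign_def)
  have ac: "mono_op e {1,3,4,6} \<xi> = 1 *\<^sub>R \<xi>"
    by (rule mult[OF _ _ a c]) (auto simp: reorder_sign_def)
  have bc: "mono_op e {1,2,5,6} \<xi> = 1 *\<^sub>R \<xi>"
    by (rule mult[OF _ _ b c]) (auto simp: reorder_sign_def)
  have abc: "mono_op e {0,3,5,6} \<xi> = 1 *\<^sub>R \<xi>"
    by (rule mult[OF _ _ ab c]) (auto simp: reorder_sign_def)
  have "mono_op e {4,5,6,7} \<xi> = -1 *\<^sub>R \<xi>"
    by (rule mult[OF _ _ u a]) (auto simp: reorder_sign_def)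
  moreover have "mono_op e {2,3,6,7} \<xi> = -1 *\<^sub>R \<xi>"
    by (rule mult[OF _ _ u b]) (auto simp: reorder_sign_def)
  moreover have "mono_op e {1,3,5,7} \<xi> = -1 *\<^sub>R \<xi>"
    by (rule mult[OF _ _ u c]) (auto simp: reorder_sign_def)
  moreover have "mono_op e {0,1,6,7} \<xi> = -1 *\<^sub>R \<xi>"
    by (rule mult[OF _ _ u ab]) (auto simp: reorder_sign_def)
  moreover have "mono_op e {0,2,5,7} \<xi> = 1 *\<^sub>R \<xi>"
    by (rule mult[OF _ _ u ac]) (auto simp: reorder_sign_def)
  moreover have "mono_op e {0,3,4,7} \<xi> = 1 *\<^sub>R \<xi>"
    by (rule mult[OF _ _ u bc]) (auto simp: reorder_sign_def)
  moreover have "mono_op e {1,2,4,7} \<xi> = 1 *\<^sub>R \<xi>"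
    by (rule mult[OF _ _ u abc]) (auto simp: reorder_sign_def)
  ultimately show ?thesis
    using w a b c ab ac bc abc by (auto simp: cayley_words_def)
qed

lemma cayley_form_norm:
  fixes e :: "'a list"
  assumes "frame e" "0 \<le> \<kappa>"
  shows "form_norm (\<lambda>xs. \<kappa> * cayley_form e xs) = sqrt 14 * \<kappa>"
proof -
  have "(form_norm (\<lambda>xs. \<kappa> * cayley_form e xs))\<^sup>2 = (sqrt 14 * \<kappa>)\<^sup>2"
    using cayley_form_norm_sum[OF assms(1) dim8]
    by (simp add: form_norm_square[OF assms(1) scale_polyform[OF cayley_form_polyform]]
        power_mult_distrib flip: sum_distrib_left)
  then show ?thesis
    using form_norm_nonneg[OF scale_polyform[OF cayley_form_polyform], of \<kappa> e] assms(2)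
    by (simp add: power2_eq_iff_nonneg)
qed

text \<open>
  Each of the sixteen signed monomials of \<open>1 + cayley_form e + \<nu>\<close> fixes an adapted spinor, so this
  polyform acts on it by sixteen; its norm is four.
\<close>

lemma adapted_square:
  assumes ad: "adapted e \<xi>"
  shows "\<Psi> (spinor_polyform (\<xi> \<bullet> \<xi>) (\<lambda>xs. (\<xi> \<bullet> \<xi>) * cayley_form e xs)) \<eta> = (\<xi> \<bullet> \<eta>) *\<^sub>R \<xi>"
proof (rule rank_one_if_norm)
  let ?\<kappa> = "\<xi> \<bullet> \<xi>"
  let ?\<Phi> = "\<lambda>xs. ?\<kappa> * cayley_form e xs"
  have e: "positive_frame e" and fe: "frame e" using ad by (auto simp: adapted_def positive_frame_def)
  have f4: "?\<Phi> \<in> forms 4"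
    using cayley_form_form[OF fe dim8] by (auto simp: forms_def intro: scale_polyform)
  have pf: "?\<Phi> \<in> polyforms" by (rule form_polyform[OF f4])
  show "spinor_polyform ?\<kappa> ?\<Phi> \<in> polyforms" by (rule spinor_polyform_polyform[OF pf])
  show "16 * (form_norm (spinor_polyform ?\<kappa> ?\<Phi>))\<^sup>2 = ?\<kappa>\<^sup>2"
    using spinor_polyform_norm[OF f4, of ?\<kappa>] by (simp add: cayley_form_norm[OF fe] power_mult_distrib)
  have "\<Psi> (cayley_form e) \<xi> = (\<Sum>p\<in>cayley_words. snd p *\<^sub>R \<Psi> (monomial e (fst p)) \<xi>)"
  proof -
    have "cayley_form e = (\<lambda>xs. \<Sum>p\<in>cayley_words. snd p * monomial e (fst p) xs)"
      by (simp add: cayley_form_def fun_eq_iff case_prod_beta)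
    then show ?thesis by (simp only:) (rule \<Psi>_sum[OF monomial_polyform])
  qed
  also have "\<dots> = (\<Sum>p\<in>cayley_words. \<xi>)"
  proof (rule sum.cong[OF refl])
    fix p assume "p \<in> cayley_words"
    then obtain w s where p: "p = (w, s)" "(w, s) \<in> cayley_words" by (cases p) auto
    have "sorted_list_of_set (set w) = w"
      using cayley_words_word(1)[OF p(2)] by (simp add: sorted_list_of_set.idem_if_sorted_distinct strict_sorted_iff)
    then have "\<Psi> (monomial e w) \<xi> = s *\<^sub>R \<xi>"
      using adapted_words[OF ad p(2)] by (simp add: mono_op_def)
    then show "snd p *\<^sub>R \<Psi> (monomial e (fst p)) \<xi> = \<xi>"
      using cayley_words_word(4)[OF p(2)] p(1) by simp
  qed
  also have "\<dots> = 14 *\<^sub>R \<xi>"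
    by (simp add: cayley_words_def scaleR_conv_of_real sum_constant_scaleR)
  finally have "\<Psi> (cayley_form e) \<xi> = 14 *\<^sub>R \<xi>" .
  then have "\<Psi> ?\<Phi> \<xi> = (14 * ?\<kappa>) *\<^sub>R \<xi>" by (simp add: \<Psi>_scale[OF cayley_form_polyform])
  moreover have "\<Psi> \<nu> \<xi> = \<xi>" using ad by (simp add: adapted_def)
  ultimately show "\<Psi> (spinor_polyform ?\<kappa> ?\<Phi>) \<xi> = ?\<kappa> *\<^sub>R \<xi>"
    by (simp add: \<Psi>_spinor_polyform[OF pf] flip: scaleR_add_left)
qed

text \<open>
  A spinor can be moved into the \<open>s\<close>-eigenspace of a monomial: project it there, or, if the projection
  vanishes, apply a monomial that anticommutes with the given one. Neither affects the eigenspaces of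
  monomials that commute with both.
\<close>

lemma mono_op_eigenspinor:
  assumes e: "frame e" and S: "S \<subseteq> {..<8}" and T: "T \<subseteq> {..<8}" and \<xi>: "\<xi> \<noteq> 0"
    and sq: "reorder_sign S S = 1" and anti: "reorder_sign S T = - reorder_sign T S" and s: "s * s = 1"
  obtains \<xi>' where "\<xi>' \<noteq> 0" "mono_op e S \<xi>' = s *\<^sub>R \<xi>'"
    "\<And>R r. R \<subseteq> {..<8} \<Longrightarrow> reorder_sign R S = reorder_sign S R \<Longrightarrow> reorder_sign R T = reorder_sign T R
      \<Longrightarrow> mono_op e R \<xi> = r *\<^sub>R \<xi> \<Longrightarrow> mono_op e R \<xi>' = r *\<^sub>R \<xi>'"
proof -
  have comm: "mono_op e R (mono_op e Q \<xi>) = r *\<^sub>R mono_op e Q \<xi>"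
    if "R \<subseteq> {..<8}" "Q \<subseteq> {..<8}" "reorder_sign R Q = reorder_sign Q R" "mono_op e R \<xi> = r *\<^sub>R \<xi>" for R Q r
  proof -
    have "sym_diff R Q = sym_diff Q R" by auto
    then have "mono_op e R (mono_op e Q \<xi>) = mono_op e Q (mono_op e R \<xi>)"
      using that(1-3) mono_op_mult[OF e, of R Q \<xi>] mono_op_mult[OF e, of Q R \<xi>] dim8 by simp
    then show ?thesis using that by (simp add: linear_scale[OF linear_mono_op])
  qed
  show ?thesis
  proof (cases "\<xi> + s *\<^sub>R mono_op e S \<xi> = 0")
    case False
    show ?thesis
    proof (rule that[OF False])
      have "mono_op e S (mono_op e S \<xi>) = \<xi>"
        using mono_op_mult[OF e, of S S \<xi>] S sq dim8 by (simp add: mono_op_empty)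
      then show "mono_op e S (\<xi> + s *\<^sub>R mono_op e S \<xi>) = s *\<^sub>R (\<xi> + s *\<^sub>R mono_op e S \<xi>)"
        using s by (simp add: linear_add[OF linear_mono_op] linear_scale[OF linear_mono_op] scaleR_add_right)
      fix R r assume "R \<subseteq> {..<8}" "reorder_sign R S = reorder_sign S R" "mono_op e R \<xi> = r *\<^sub>R \<xi>"
      then show "mono_op e R (\<xi> + s *\<^sub>R mono_op e S \<xi>) = r *\<^sub>R (\<xi> + s *\<^sub>R mono_op e S \<xi>)"
        using comm[of R S r] S
        by (simp add: linear_add[OF linear_mono_op] linear_scale[OF linear_mono_op] scaleR_add_right)
    qed
  next
    case True
    have "mono_op e S \<xi> = (s * s) *\<^sub>R mono_op e S \<xi>" using s by simp
    also have "\<dots> = s *\<^sub>R (s *\<^sub>R mono_op e S \<xi>)" by simp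
    also have "s *\<^sub>R mono_op e S \<xi> = - \<xi>" using True by (simp add: eq_neg_iff_add_eq_0 add.commute)
    finally have eig: "mono_op e S \<xi> = - s *\<^sub>R \<xi>" by simp
    show ?thesis
    proof (rule that[of "mono_op e T \<xi>"])
      have "mono_op e T (mono_op e T \<xi>) = reorder_sign T T *\<^sub>R \<xi>"
        using mono_op_mult[OF e, of T T \<xi>] T dim8 by (simp add: mono_op_empty)
      moreover have "reorder_sign T T \<noteq> 0" using reorder_sign_cases[of T T] by auto
      ultimately show "mono_op e T \<xi> \<noteq> 0" using \<xi> linear_0[OF linear_mono_op[of e T]] by auto
      have "sym_diff S T = sym_diff T S" by auto
      then have "mono_op e S (mono_op e T \<xi>) = - mono_op e T (mono_op e S \<xi>)"
        using S T dim8 anti by (simp add: mono_op_mult[OF e])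
      then show "mono_op e S (mono_op e T \<xi>) = s *\<^sub>R mono_op e T \<xi>"
        unfolding eig by (simp add: linear_scale[OF linear_mono_op] linear_neg[OF linear_mono_op])
      fix R r assume "R \<subseteq> {..<8}" "reorder_sign R T = reorder_sign T R" "mono_op e R \<xi> = r *\<^sub>R \<xi>"
      then show "mono_op e R (mono_op e T \<xi>) = r *\<^sub>R mono_op e T \<xi>" using comm[of R T r] T by simp
    qed
  qed
qed

text \<open>
  The generators are imposed one after the other. The anticommuting monomials are those of \<open>{0}\<close>,
  \<open>{0, 4}\<close>, \<open>{0, 2}\<close> and \<open>{0, 1}\<close>; each of the last three meets its generator in an odd and the earlier
  generators in an even number of indices.
\<close>

lemma adapted_spinor_exists:
  assumes e: "positive_frame e" and \<kappa>: "0 < \<kappa>"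
  obtains \<xi> where "adapted e \<xi>" "\<xi> \<bullet> \<xi> = \<kappa>"
proof -
  have fe: "frame e" by (rule positive_frameD[OF e])
  have U: "{..<8} = {0,1,2,3,4,5,6,7::nat}" by auto
  have step: "\<exists>\<xi>'. \<xi>' \<noteq> 0 \<and> mono_op e S \<xi>' = s *\<^sub>R \<xi>' \<and>
      (\<forall>R r. R \<subseteq> {..<8} \<longrightarrow> reorder_sign R S = reorder_sign S R \<longrightarrow> reorder_sign R T = reorder_sign T R
        \<longrightarrow> mono_op e R \<xi> = r *\<^sub>R \<xi> \<longrightarrow> mono_op e R \<xi>' = r *\<^sub>R \<xi>')"
    if "S \<subseteq> {..<8}" "T \<subseteq> {..<8}" "\<xi> \<noteq> 0" "reorder_sign S S = 1"
      "reorder_sign S T = - reorder_sign T S" "s * s = 1" for S T \<xi> s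
    by (rule mono_op_eigenspinor[OF fe that]) blast
  let ?a = "{0,1,2,3::nat}" and ?b = "{0,1,4,5::nat}" and ?c = "{0,2,4,6::nat}" and ?u = "{0,1,2,3,4,5,6,7::nat}"
  have sub: "?a \<subseteq> {..<8}" "?b \<subseteq> {..<8}" "?c \<subseteq> {..<8}" "?u \<subseteq> {..<8}"
    "{0} \<subseteq> {..<8::nat}" "{0,4} \<subseteq> {..<8::nat}" "{0,2} \<subseteq> {..<8::nat}" "{0,1} \<subseteq> {..<8::nat}" by auto
  have sq: "reorder_sign ?a ?a = 1" "reorder_sign ?b ?b = 1" "reorder_sign ?c ?c = 1" "reorder_sign ?u ?u = 1"
    by (simp_all add: reorder_sign_def)
  have anti: "reorder_sign ?u {0} = - reorder_sign {0} ?u" "reorder_sign ?a {0,4} = - reorder_sign {0,4} ?a"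
    "reorder_sign ?b {0,2} = - reorder_sign {0,2} ?b" "reorder_sign ?c {0,1} = - reorder_sign {0,1} ?c"
    by (simp_all add: reorder_sign_def)
  have comm: "reorder_sign ?u ?a = reorder_sign ?a ?u" "reorder_sign ?u {0,4} = reorder_sign {0,4} ?u"
    "reorder_sign ?u ?b = reorder_sign ?b ?u" "reorder_sign ?u {0,2} = reorder_sign {0,2} ?u"
    "reorder_sign ?a ?b = reorder_sign ?b ?a" "reorder_sign ?a {0,2} = reorder_sign {0,2} ?a"
    "reorder_sign ?u ?c = reorder_sign ?c ?u" "reorder_sign ?u {0,1} = reorder_sign {0,1} ?u"
    "reorder_sign ?a ?c = reorder_sign ?c ?a" "reorder_sign ?a {0,1} = reorder_sign {0,1} ?a"
    "reorder_sign ?b ?c = reorder_sign ?c ?b" "reorder_sign ?b {0,1} = reorder_sign {0,1} ?b"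
    by (simp_all add: reorder_sign_def)
  have signs: "1 * 1 = (1::real)" "-1 * -1 = (1::real)" by simp_all
  obtain \<xi>0 :: 's where 0: "\<xi>0 \<noteq> 0"
    using dim16 by (metis DIM_positive nonempty_Basis nonzero_Basis equals0I)
  obtain \<xi>1 where 1: "\<xi>1 \<noteq> 0" "mono_op e ?u \<xi>1 = 1 *\<^sub>R \<xi>1"
    by (rule mono_op_eigenspinor[OF fe sub(4,5) 0 sq(4) anti(1) signs(1)])
  obtain \<xi>2 where 2: "\<xi>2 \<noteq> 0" "mono_op e ?a \<xi>2 = -1 *\<^sub>R \<xi>2"
    and keep2: "\<forall>R r. R \<subseteq> {..<8} \<longrightarrow> reorder_sign R ?a = reorder_sign ?a R \<longrightarrow> reorder_sign R {0,4} = reorder_sign {0,4} R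
      \<longrightarrow> mono_op e R \<xi>1 = r *\<^sub>R \<xi>1 \<longrightarrow> mono_op e R \<xi>2 = r *\<^sub>R \<xi>2"
    using step[OF sub(1,6) 1(1) sq(1) anti(2) signs(2)] by (elim exE conjE) (rule that)
  obtain \<xi>3 where 3: "\<xi>3 \<noteq> 0" "mono_op e ?b \<xi>3 = -1 *\<^sub>R \<xi>3"
    and keep3: "\<forall>R r. R \<subseteq> {..<8} \<longrightarrow> reorder_sign R ?b = reorder_sign ?b R \<longrightarrow> reorder_sign R {0,2} = reorder_sign {0,2} R
      \<longrightarrow> mono_op e R \<xi>2 = r *\<^sub>R \<xi>2 \<longrightarrow> mono_op e R \<xi>3 = r *\<^sub>R \<xi>3"
    using step[OF sub(2,7) 2(1) sq(2) anti(3) signs(2)] by (elim exE conjE) (rule that)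
  obtain \<xi>4 where 4: "\<xi>4 \<noteq> 0" "mono_op e ?c \<xi>4 = -1 *\<^sub>R \<xi>4"
    and keep4: "\<forall>R r. R \<subseteq> {..<8} \<longrightarrow> reorder_sign R ?c = reorder_sign ?c R \<longrightarrow> reorder_sign R {0,1} = reorder_sign {0,1} R
      \<longrightarrow> mono_op e R \<xi>3 = r *\<^sub>R \<xi>3 \<longrightarrow> mono_op e R \<xi>4 = r *\<^sub>R \<xi>4"
    using step[OF sub(3,8) 3(1) sq(3) anti(4) signs(2)] by (elim exE conjE) (rule that)
  note u2 = keep2[rule_format, OF sub(4) comm(1,2) 1(2)]
  note u3 = keep3[rule_format, OF sub(4) comm(3,4) u2] and a3 = keep3[rule_format, OF sub(1) comm(5,6) 2(2)]
  note u4 = keep4[rule_format, OF sub(4) comm(7,8) u3] and a4 = keep4[rule_format, OF sub(1) comm(9,10) a3]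
    and b4 = keep4[rule_format, OF sub(2) comm(11,12) 3(2)]
  define t where "t = sqrt \<kappa> / norm \<xi>4"
  have scaled: "mono_op e S (t *\<^sub>R \<xi>4) = s *\<^sub>R (t *\<^sub>R \<xi>4)" if "mono_op e S \<xi>4 = s *\<^sub>R \<xi>4" for S s
    using that by (simp add: linear_scale[OF linear_mono_op])
  have "adapted e (t *\<^sub>R \<xi>4)"
    unfolding adapted_def \<Psi>_volume[OF e] U
    using e scaled[OF 4(2)] scaled[OF b4] scaled[OF a4] scaled[OF u4] by simp
  moreover have "(t *\<^sub>R \<xi>4) \<bullet> (t *\<^sub>R \<xi>4) = (t * norm \<xi>4)\<^sup>2"
    by (simp add: power_mult_distrib power2_norm_eq_inner) (simp add: power2_eq_square)
  moreover have "t * norm \<xi>4 = sqrt \<kappa>" using 4(1) by (simp add: t_def)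
  ultimately show ?thesis using that \<kappa> by simp
qed

end

section \<open>Frames adapted to a spinor\<close>

lemma orthonormal_list_snoc:
  "orthonormal_list (xs @ [v]) \<longleftrightarrow> orthonormal_list xs \<and> v \<bullet> v = 1 \<and> (\<forall>x\<in>set xs. v \<bullet> x = 0)"
  unfolding orthonormal_list_altdef
  by (auto simp: inner_commute)

lemma orthonormal_list_extend:
  fixes xs :: "'a::euclidean_space list"
  assumes "orthonormal_list xs" "length xs < DIM('a)"
  obtains v where "orthonormal_list (xs @ [v])"
proof -
  have "dim (set xs) < DIM('a)"
    using assms(2) dim_le_card'[of "set xs"] card_length[of xs] by simp
  then obtain x where x: "x \<noteq> 0" "\<And>y. y \<in> span (set xs) \<Longrightarrow> orthogonal x y"
    by (rule orthogonal_to_subspace_exists) blast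
  have "orthonormal_list (xs @ [(1 / norm x) *\<^sub>R x])"
    using assms(1) x span_base[of _ "set xs"]
    by (auto simp: orthonormal_list_snoc orthogonal_def dot_square_norm power2_eq_square)
  then show ?thesis using that by blast
qed

lemma covector_add: "covector (v + w) = (\<lambda>xs. covector v xs + covector w xs)"
  by (auto simp: covector_def inner_add_left split: list.splits)

lemma covector_scale: "covector (a *\<^sub>R v) = (\<lambda>xs. a * covector v xs)"
  by (auto simp: covector_def split: list.splits)

context spinor_module
begin

definition \<gamma> :: "'a \<Rightarrow> 's \<Rightarrow> 's" where "\<gamma> v = \<Psi> (covector v)"

lemma covector_polyform: "covector v \<in> polyforms"
  by (rule form_polyform[OF covector_form])

lemma linear_\<gamma>: "linear (\<gamma> v)"
  unfolding \<gamma>_def by (rule linear_\<Psi>[OF covector_polyform])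

lemma linear_\<gamma>_left: "linear (\<lambda>v. \<gamma> v \<xi>)"
  unfolding \<gamma>_def
  by (rule linearI) (simp_all add: covector_add covector_scale \<Psi>_add \<Psi>_scale covector_polyform)

lemma \<gamma>_symmetric: "\<gamma> v \<xi> \<bullet> \<eta> = \<xi> \<bullet> \<gamma> v \<eta>"
  unfolding \<gamma>_def by (rule covector_symmetric)

lemma \<gamma>_square: "\<gamma> v (\<gamma> v \<xi>) = (v \<bullet> v) *\<^sub>R \<xi>"
proof -
  have "gp (covector v) (covector v) = (\<lambda>xs. (v \<bullet> v) * one_form xs)"
  proof
    fix xs :: "'a list"
    have "wedge (covector v) (covector v) xs = 0"
    proof (cases "length xs = 2")
      case True
      then obtain x y where "xs = [x, y]" by (auto simp: numeral_2_eq_2 length_Suc_conv)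
      then show ?thesis by (simp add: wedge_Cons interior_prod_def covector_def)
    next
      case False
      then show ?thesis using form_eq_0[OF wedge_form[OF covector_form covector_form], of xs] by simp
    qed
    then show "gp (covector v) (covector v) xs = (v \<bullet> v) * one_form xs"
      by (simp add: gp_covector[OF covector_polyform] interior_prod_def one_form_def)
        (auto simp: covector_def split: list.splits)
  qed
  then have "\<Psi> (gp (covector v) (covector v)) \<xi> = (v \<bullet> v) *\<^sub>R \<xi>"
    by (simp add: \<Psi>_scale one_form_polyform \<Psi>_one)
  then show ?thesis by (simp add: \<gamma>_def \<Psi>_gp covector_polyform)
qed

lemma \<gamma>_clifford: "\<gamma> v (\<gamma> w \<xi>) + \<gamma> w (\<gamma> v \<xi>) = (2 * (v \<bullet> w)) *\<^sub>R \<xi>"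
proof -
  have "\<gamma> (v + w) (\<gamma> (v + w) \<xi>) = \<gamma> v (\<gamma> v \<xi>) + \<gamma> w (\<gamma> w \<xi>) + (\<gamma> v (\<gamma> w \<xi>) + \<gamma> w (\<gamma> v \<xi>))"
    by (simp add: linear_add[OF linear_\<gamma>_left] linear_add[OF linear_\<gamma>] add.assoc add.left_commute)
  then have "((v + w) \<bullet> (v + w)) *\<^sub>R \<xi> = (v \<bullet> v + w \<bullet> w) *\<^sub>R \<xi> + (\<gamma> v (\<gamma> w \<xi>) + \<gamma> w (\<gamma> v \<xi>))"
    by (simp add: \<gamma>_square scaleR_add_left)
  moreover have "(v + w) \<bullet> (v + w) = (v \<bullet> v + w \<bullet> w) + 2 * (v \<bullet> w)"
    by (simp add: inner_add_left inner_add_right inner_commute)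
  ultimately show ?thesis by (simp add: scaleR_add_left)
qed

lemma \<gamma>_anticommute: "v \<bullet> w = 0 \<Longrightarrow> \<gamma> v (\<gamma> w \<xi>) = - \<gamma> w (\<gamma> v \<xi>)"
  using \<gamma>_clifford[of v w \<xi>] by (simp add: eq_neg_iff_add_eq_0)

lemma \<gamma>_inner: "\<gamma> v \<xi> \<bullet> \<gamma> w \<xi> = (v \<bullet> w) * (\<xi> \<bullet> \<xi>)"
proof -
  have "\<xi> \<bullet> (\<gamma> v (\<gamma> w \<xi>) + \<gamma> w (\<gamma> v \<xi>)) = 2 * ((v \<bullet> w) * (\<xi> \<bullet> \<xi>))"
    by (simp add: \<gamma>_clifford)
  moreover have "\<xi> \<bullet> \<gamma> v (\<gamma> w \<xi>) = \<gamma> v \<xi> \<bullet> \<gamma> w \<xi>" "\<xi> \<bullet> \<gamma> w (\<gamma> v \<xi>) = \<gamma> v \<xi> \<bullet> \<gamma> w \<xi>"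
    using \<gamma>_symmetric by (metis inner_commute)+
  ultimately show ?thesis by (simp add: inner_add_right)
qed

lemma mono_op_frame: "frame e \<Longrightarrow> i < 8 \<Longrightarrow> mono_op e {i} = \<gamma> (e ! i)"
  using mono_op_singleton dim8 by (simp add: \<gamma>_def)

lemma mono_op_insert_min:
  assumes e: "frame e" and i: "i < 8" and S: "S \<subseteq> {i<..<8}"
  shows "mono_op e (insert i S) \<xi> = \<gamma> (e ! i) (mono_op e S \<xi>)"
proof -
  have sub: "S \<subseteq> {..<DIM('a)}" "i < DIM('a)" using S i dim8 by auto
  have "reorder_sign {i} S = 1" using S by (intro reorder_sign_below) auto
  moreover have "sym_diff {i} S = insert i S" using S by auto
  ultimately show ?thesis
    using \<Psi>_covector_mono_op[OF e sub(2,1), of \<xi>] by (simp add: \<gamma>_def)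
qed

lemma \<gamma>_volume: "\<Psi> \<nu> (\<gamma> v \<xi>) = - \<gamma> v (\<Psi> \<nu> \<xi>)"
proof -
  obtain e where e: "positive_frame e" by (rule positive_Basis_frame)
  have fe: "frame e" by (rule positive_frameD[OF e])
  have frame_vector: "\<Psi> \<nu> (\<gamma> (e ! i) \<xi>) = - \<gamma> (e ! i) (\<Psi> \<nu> \<xi>)" if i: "i < 8" for i
  proof -
    have "{..<8} \<inter> {i} = {i}" using i by auto
    then have "reorder_sign {..<8} {i} = - reorder_sign {i} {..<8}"
      using reorder_sign_swap[of "{..<8}" "{i}"] by simp
    moreover have "sym_diff {..<8} {i} = sym_diff {i} {..<8}" by auto
    ultimately show ?thesis
      using mono_op_mult[OF fe, of "{i}" "{..<8}" \<xi>] mono_op_mult[OF fe, of "{..<8}" "{i}" \<xi>] i dim8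
      by (simp add: \<Psi>_volume[OF e] mono_op_frame[OF fe])
  qed
  have v: "v = (\<Sum>i<8. (v \<bullet> e ! i) *\<^sub>R e ! i)" using frame_expansion[OF fe, of v] dim8 by simp
  have expand: "\<gamma> v \<eta> = (\<Sum>i<8. (v \<bullet> e ! i) *\<^sub>R \<gamma> (e ! i) \<eta>)" for \<eta>
    by (subst v) (simp add: linear_sum[OF linear_\<gamma>_left] linear_scale[OF linear_\<gamma>_left])
  note lin = linear_\<Psi>[OF volume_form_polyform]
  have "\<Psi> \<nu> (\<gamma> v \<xi>) = (\<Sum>i<8. (v \<bullet> e ! i) *\<^sub>R \<Psi> \<nu> (\<gamma> (e ! i) \<xi>))"
    unfolding expand by (simp add: linear_sum[OF lin] linear_scale[OF lin])
  also have "\<dots> = - \<gamma> v (\<Psi> \<nu> \<xi>)"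
    unfolding expand by (simp add: frame_vector sum_negf)
  finally show ?thesis .
qed

text \<open>
  A nonzero positive spinor identifies vectors with negative spinors: \<open>v \<mapsto> \<gamma> v \<xi>\<close> is injective, and
  both spaces have dimension eight.
\<close>

lemma \<gamma>_surj:
  assumes \<xi>: "\<xi> \<noteq> 0" "\<Psi> \<nu> \<xi> = \<xi>" and \<eta>: "\<Psi> \<nu> \<eta> = - \<eta>"
  obtains v where "\<gamma> v \<xi> = \<eta>"
proof -
  let ?W = "range (\<lambda>v. \<gamma> v \<xi>)"
  let ?P = "{x. \<Psi> \<nu> x = x}" and ?M = "{x. \<Psi> \<nu> x = - x}"
  note lin = linear_\<Psi>[OF volume_form_polyform]
  have subP: "subspace ?P" and subM: "subspace ?M"
    by (auto simp: subspace_def linear_0[OF lin] linear_add[OF lin] linear_scale[OF lin])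
  have subW: "subspace ?W" by (rule linear_subspace_image[OF linear_\<gamma>_left subspace_UNIV])
  have inj: "inj (\<lambda>v. \<gamma> v \<xi>)"
  proof (rule injI)
    fix v w assume "\<gamma> v \<xi> = \<gamma> w \<xi>"
    then have "\<gamma> (v - w) \<xi> = 0" by (simp add: linear_diff[OF linear_\<gamma>_left])
    then have "((v - w) \<bullet> (v - w)) * (\<xi> \<bullet> \<xi>) = 0" using \<gamma>_inner[of "v - w" \<xi> "v - w"] by simp
    then show "v = w" using \<xi>(1) by simp
  qed
  have dimW: "dim ?W = 8"
    using dim_image_eq[OF linear_\<gamma>_left, of \<xi> UNIV] inj dim8 by simp
  obtain u :: 'a where u: "u \<in> Basis" using nonempty_Basis by blast
  have uu: "u \<bullet> u = 1" using u by (simp add: inner_Basis)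
  have WM: "?W \<subseteq> ?M" using \<xi>(2) by (auto simp: \<gamma>_volume)
  have "\<gamma> u ` ?W \<subseteq> ?P" using \<xi>(2) by (auto simp: \<gamma>_volume linear_neg[OF linear_\<gamma>])
  moreover have "dim (\<gamma> u ` ?W) = 8"
  proof -
    have "inj (\<gamma> u)"
      by (rule inj_on_inverseI[where g = "\<gamma> u"]) (simp add: \<gamma>_square uu)
    then show ?thesis using dim_image_eq[OF linear_\<gamma>, of u ?W] dimW by (simp add: inj_on_subset)
  qed
  ultimately have dimP: "8 \<le> dim ?P" by (metis dim_subset)
  have "?P \<inter> ?M = {0}"
  proof -
    have "x = 0" if "x = - x" for x :: 's
    proof -
      have "2 *\<^sub>R x = x + x" by (rule scaleR_2)
      also have "\<dots> = 0" using that by (metis add.right_inverse)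
      finally show ?thesis by simp
    qed
    then show ?thesis using linear_0[OF lin] by auto
  qed
  then have "dim {x + y |x y. x \<in> ?P \<and> y \<in> ?M} = dim ?P + dim ?M"
    using dim_sums_Int[OF subP subM] by simp
  moreover have "dim {x + y |x y. x \<in> ?P \<and> y \<in> ?M} \<le> 16"
    using dim_subset_UNIV[of "{x + y |x y. x \<in> ?P \<and> y \<in> ?M}"] dim16 by simp
  ultimately have "dim ?M \<le> dim ?W" using dimP dimW by simp
  then have "?W = ?M" by (rule subspace_dim_equal[OF subW subM WM])
  then have "\<eta> \<in> ?W" using \<eta> by simp
  then show ?thesis using that by auto
qed

text \<open>The triple cross product of the \<open>Spin(7)\<close> structure defined by \<open>\<xi>\<close>.\<close>

lemma triple_cross_product:
  assumes \<xi>: "\<xi> \<noteq> 0" "\<Psi> \<nu> \<xi> = \<xi>"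
    and unit: "x \<bullet> x = 1" "y \<bullet> y = 1" "z \<bullet> z = 1" and orth: "x \<bullet> y = 0" "x \<bullet> z = 0" "y \<bullet> z = 0"
  obtains w where "\<gamma> w \<xi> = \<gamma> x (\<gamma> y (\<gamma> z \<xi>))" "w \<bullet> w = 1" "w \<bullet> x = 0" "w \<bullet> y = 0" "w \<bullet> z = 0"
proof -
  have "\<Psi> \<nu> (\<gamma> x (\<gamma> y (\<gamma> z \<xi>))) = - \<gamma> x (\<gamma> y (\<gamma> z \<xi>))"
    by (simp add: \<gamma>_volume linear_neg[OF linear_\<gamma>] \<xi>(2))
  then obtain w where w: "\<gamma> w \<xi> = \<gamma> x (\<gamma> y (\<gamma> z \<xi>))" by (rule \<gamma>_surj[OF \<xi>])
  have pos: "\<xi> \<bullet> \<xi> \<noteq> 0" using \<xi>(1) by simp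
  have isometry: "\<gamma> u \<eta> \<bullet> \<gamma> u \<eta>' = \<eta> \<bullet> \<eta>'" if "u \<bullet> u = 1" for u \<eta> \<eta>'
    by (simp add: \<gamma>_symmetric \<gamma>_square that)
  have "(w \<bullet> w) * (\<xi> \<bullet> \<xi>) = \<xi> \<bullet> \<xi>"
    unfolding \<gamma>_inner[symmetric] w by (simp add: isometry unit)
  moreover have "(w \<bullet> x) * (\<xi> \<bullet> \<xi>) = 0"
  proof -
    have "(w \<bullet> x) * (\<xi> \<bullet> \<xi>) = \<gamma> y (\<gamma> z \<xi>) \<bullet> \<xi>"
      unfolding \<gamma>_inner[symmetric] w by (rule isometry[OF unit(1)])
    also have "\<dots> = \<gamma> z \<xi> \<bullet> \<gamma> y \<xi>" by (rule \<gamma>_symmetric)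
    finally show ?thesis using orth by (simp add: \<gamma>_inner inner_commute)
  qed
  moreover have "(w \<bullet> y) * (\<xi> \<bullet> \<xi>) = 0"
  proof -
    have "(w \<bullet> y) * (\<xi> \<bullet> \<xi>) = - (\<gamma> y (\<gamma> x (\<gamma> z \<xi>)) \<bullet> \<gamma> y \<xi>)"
      unfolding \<gamma>_inner[symmetric] w by (simp add: \<gamma>_anticommute[OF orth(1)])
    also have "\<gamma> y (\<gamma> x (\<gamma> z \<xi>)) \<bullet> \<gamma> y \<xi> = \<gamma> x (\<gamma> z \<xi>) \<bullet> \<xi>" by (rule isometry[OF unit(2)])
    also have "\<gamma> x (\<gamma> z \<xi>) \<bullet> \<xi> = \<gamma> z \<xi> \<bullet> \<gamma> x \<xi>" by (rule \<gamma>_symmetric)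
    finally show ?thesis using orth by (simp add: \<gamma>_inner inner_commute)
  qed
  moreover have "(w \<bullet> z) * (\<xi> \<bullet> \<xi>) = 0"
  proof -
    have "(w \<bullet> z) * (\<xi> \<bullet> \<xi>) = \<gamma> z (\<gamma> x (\<gamma> y \<xi>)) \<bullet> \<gamma> z \<xi>"
      unfolding \<gamma>_inner[symmetric] w
      by (simp add: \<gamma>_anticommute[OF orth(3)] \<gamma>_anticommute[OF orth(2)] linear_neg[OF linear_\<gamma>])
    also have "\<dots> = \<gamma> x (\<gamma> y \<xi>) \<bullet> \<xi>" by (rule isometry[OF unit(3)])
    also have "\<dots> = \<gamma> y \<xi> \<bullet> \<gamma> x \<xi>" by (rule \<gamma>_symmetric)
    finally show ?thesis using orth by (simp add: \<gamma>_inner inner_commute)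
  qed
  ultimately show ?thesis using that w pos by simp
qed

text \<open>
  The four-fold product \<open>\<langle>\<gamma> x \<gamma> y \<gamma> z \<xi>, \<gamma> u \<xi>\<rangle>\<close> is antisymmetric on orthogonal vectors, as exchanging \<open>z\<close> with \<open>u\<close>
  amounts to exchanging anticommuting operators.
\<close>

lemma triple_product_swap:
  assumes "x \<bullet> z = 0" "y \<bullet> z = 0" "x \<bullet> u = 0" "y \<bullet> u = 0" "z \<bullet> u = 0"
  shows "\<gamma> x (\<gamma> y (\<gamma> z \<xi>)) \<bullet> \<gamma> u \<xi> = - (\<gamma> x (\<gamma> y (\<gamma> u \<xi>)) \<bullet> \<gamma> z \<xi>)"
proof -
  have move: "\<gamma> x (\<gamma> y (\<gamma> v \<xi>)) = \<gamma> v (\<gamma> x (\<gamma> y \<xi>))" if "x \<bullet> v = 0" "y \<bullet> v = 0" for v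
    by (simp add: \<gamma>_anticommute[OF that(1)] \<gamma>_anticommute[OF that(2)] linear_neg[OF linear_\<gamma>])
  have "\<gamma> x (\<gamma> y (\<gamma> z \<xi>)) \<bullet> \<gamma> u \<xi> = \<gamma> x (\<gamma> y \<xi>) \<bullet> \<gamma> z (\<gamma> u \<xi>)"
    unfolding move[OF assms(1,2)] by (rule \<gamma>_symmetric)
  also have "\<dots> = - (\<gamma> x (\<gamma> y \<xi>) \<bullet> \<gamma> u (\<gamma> z \<xi>))" by (simp add: \<gamma>_anticommute[OF assms(5)])
  also have "\<gamma> x (\<gamma> y \<xi>) \<bullet> \<gamma> u (\<gamma> z \<xi>) = \<gamma> u (\<gamma> x (\<gamma> y \<xi>)) \<bullet> \<gamma> z \<xi>" by (rule \<gamma>_symmetric[symmetric])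
  finally show ?thesis unfolding move[OF assms(3,4)] .
qed

lemma triple_product_square:
  assumes "x \<bullet> x = 1" "y \<bullet> y = 1" "z \<bullet> z = 1" "x \<bullet> y = 0" "x \<bullet> z = 0" "y \<bullet> z = 0"
  shows "\<gamma> x (\<gamma> y (\<gamma> z (\<gamma> x (\<gamma> y (\<gamma> z \<xi>))))) = - \<xi>"
proof -
  have 1: "\<gamma> z (\<gamma> x \<eta>) = - \<gamma> x (\<gamma> z \<eta>)" "\<gamma> y (\<gamma> x \<eta>) = - \<gamma> x (\<gamma> y \<eta>)" "\<gamma> z (\<gamma> y \<eta>) = - \<gamma> y (\<gamma> z \<eta>)" for \<eta>
    using assms by (auto intro!: \<gamma>_anticommute simp: inner_commute)
  show ?thesis
    by (simp add: 1 linear_neg[OF linear_\<gamma>] \<gamma>_square assms)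
qed

text \<open>
  Negating a vector reverses the sign of every form of top degree.
\<close>

lemma frame_negate_last:
  assumes "frame (xs @ [t])"
  shows "positive_frame (xs @ [t]) \<or> positive_frame (xs @ [- t])"
proof -
  obtain \<omega> where \<omega>: "\<omega> \<in> forms 8" "\<And>ys. ys \<in> ori \<longleftrightarrow> 0 < \<omega> ys" "\<omega> \<noteq> (\<lambda>_. 0)"
    using ori dim8 by (auto simp: orientation_def)
  have "\<omega> (xs @ [t]) \<noteq> 0"
    using \<omega>(3) form8_eq[OF assms \<omega>(1)] by (metis mult_zero_left)
  moreover have "\<omega> (xs @ [- t]) = - \<omega> (xs @ [t])"
    using linear_neg[OF polyform_linear_Cons[OF append_polyform[OF form_polyform[OF \<omega>(1)], of xs], of "[]"], of t]
    by simp
  ultimately have "0 < \<omega> (xs @ [t]) \<or> 0 < \<omega> (xs @ [- t])" by linarith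
  moreover have "frame (xs @ [- t])"
    using assms by (auto simp: frame_def orthonormal_list_snoc)
  ultimately show ?thesis
    using assms unfolding positive_frame_def \<omega>(2) by blast
qed

text \<open>
  Three orthonormal vectors \<open>a\<close>, \<open>b\<close>, \<open>c\<close> determine their cross product \<open>d\<close>; together with a unit
  vector \<open>p\<close> orthogonal to these, the cross products of \<open>p\<close> with \<open>a\<close>, \<open>b\<close> and with \<open>a\<close>, \<open>c\<close> are two
  more frame vectors, and the last one is fixed by the orientation.
\<close>

lemma adapted_frame_exists:
  assumes \<xi>: "\<xi> \<noteq> 0" "\<Psi> \<nu> \<xi> = \<xi>"
  obtains e where "adapted e \<xi>"
proof -
  have pos: "\<xi> \<bullet> \<xi> \<noteq> 0" using \<xi>(1) by simp
  have isometry: "\<gamma> u \<eta> \<bullet> \<gamma> u \<eta>' = \<eta> \<bullet> \<eta>'" if "u \<bullet> u = 1" for u \<eta> \<eta>'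
    by (simp add: \<gamma>_symmetric \<gamma>_square that)
  have orthI: "v \<bullet> w = 0" if "\<gamma> v \<xi> \<bullet> \<gamma> w \<xi> = 0" for v w
    using that pos by (simp add: \<gamma>_inner)
  have on0: "orthonormal_list ([] :: 'a list)" by (simp add: orthonormal_list_def)
  obtain a :: 'a where "orthonormal_list ([] @ [a])" by (rule orthonormal_list_extend[OF on0]) (simp add: dim8)
  then have on1: "orthonormal_list [a]" by simp
  obtain b where "orthonormal_list ([a] @ [b])" by (rule orthonormal_list_extend[OF on1]) (simp add: dim8)
  then have on2: "orthonormal_list [a, b]" by simp
  obtain c where on3: "orthonormal_list ([a, b] @ [c])" by (rule orthonormal_list_extend[OF on2]) (simp add: dim8)
  have "a \<bullet> a = 1" using on1 orthonormal_list_snoc[of "[]" a] by simp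
  moreover have "b \<bullet> b = 1" "b \<bullet> a = 0" using on2 orthonormal_list_snoc[of "[a]" b] by simp_all
  moreover have "c \<bullet> c = 1" "c \<bullet> a = 0" "c \<bullet> b = 0" using on3 unfolding orthonormal_list_snoc by simp_all
  ultimately have u_abc: "a \<bullet> a = 1" "b \<bullet> b = 1" "c \<bullet> c = 1" and o_abc: "a \<bullet> b = 0" "a \<bullet> c = 0" "b \<bullet> c = 0"
    by (simp_all add: inner_commute)
  obtain d where d: "\<gamma> d \<xi> = \<gamma> a (\<gamma> b (\<gamma> c \<xi>))" and u_d: "d \<bullet> d = 1"
    and o_d: "d \<bullet> a = 0" "d \<bullet> b = 0" "d \<bullet> c = 0"
    by (rule triple_cross_product[OF \<xi> u_abc o_abc])
  have on4: "orthonormal_list [a, b, c, d]"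
    using orthonormal_list_snoc[of "[a, b, c]" d] on3 u_d o_d by simp
  obtain p where on5: "orthonormal_list ([a, b, c, d] @ [p])" by (rule orthonormal_list_extend[OF on4]) (simp add: dim8)
  have u_p: "p \<bullet> p = 1" and o_p: "p \<bullet> a = 0" "p \<bullet> b = 0" "p \<bullet> c = 0" "p \<bullet> d = 0"
    using on5 unfolding orthonormal_list_snoc by auto
  have o_p': "a \<bullet> p = 0" "b \<bullet> p = 0" "c \<bullet> p = 0" "d \<bullet> p = 0" using o_p by (simp_all add: inner_commute)
  have o_ba: "b \<bullet> a = 0" "c \<bullet> a = 0" "c \<bullet> b = 0" using o_abc by (simp_all add: inner_commute)
  obtain q where q: "\<gamma> q \<xi> = \<gamma> a (\<gamma> b (\<gamma> p \<xi>))" and u_q: "q \<bullet> q = 1"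
    and o_q: "q \<bullet> a = 0" "q \<bullet> b = 0" "q \<bullet> p = 0"
    by (rule triple_cross_product[OF \<xi> u_abc(1,2) u_p o_abc(1) o_p'(1,2)])
  have "q \<bullet> c = 0"
    using triple_product_swap[OF o_p'(1,2) o_abc(2,3) o_p(3), of \<xi>] o_p'(4)
    by (intro orthI) (simp add: q d[symmetric] \<gamma>_inner)
  moreover have "q \<bullet> d = 0"
    using o_p(3) by (intro orthI) (simp add: q d isometry u_abc \<gamma>_inner)
  ultimately have on6: "orthonormal_list [a, b, c, d, p, q]"
    using orthonormal_list_snoc[of "[a, b, c, d, p]" q] on5 u_q o_q by simp
  obtain r where r: "\<gamma> r \<xi> = \<gamma> a (\<gamma> c (\<gamma> p \<xi>))" and u_r: "r \<bullet> r = 1"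
    and o_r: "r \<bullet> a = 0" "r \<bullet> c = 0" "r \<bullet> p = 0"
    by (rule triple_cross_product[OF \<xi> u_abc(1,3) u_p o_abc(2) o_p'(1,3)])
  have d': "\<gamma> a (\<gamma> c (\<gamma> b \<xi>)) = - \<gamma> d \<xi>"
    by (simp add: d \<gamma>_anticommute[OF o_ba(3)] linear_neg[OF linear_\<gamma>])
  have "r \<bullet> b = 0"
    using triple_product_swap[OF o_p'(1,3) o_abc(1) o_ba(3) o_p(2), of \<xi>] o_p'(4)
    by (intro orthI) (simp add: r d' \<gamma>_inner)
  moreover have "r \<bullet> d = 0"
  proof (rule orthI)
    have "\<gamma> d \<xi> = - \<gamma> a (\<gamma> c (\<gamma> b \<xi>))" using d' by simp
    then show "\<gamma> r \<xi> \<bullet> \<gamma> d \<xi> = 0" using o_p(2) by (simp add: r isometry u_abc \<gamma>_inner)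
  qed
  moreover have "r \<bullet> q = 0"
  proof (rule orthI)
    have "\<gamma> r \<xi> \<bullet> \<gamma> q \<xi> = \<gamma> p (\<gamma> c \<xi>) \<bullet> \<gamma> p (\<gamma> b \<xi>)"
      by (simp add: r q isometry u_abc \<gamma>_anticommute[OF o_p'(3)] \<gamma>_anticommute[OF o_p'(2)])
    then show "\<gamma> r \<xi> \<bullet> \<gamma> q \<xi> = 0" using o_ba(3) by (simp add: isometry u_p \<gamma>_inner)
  qed
  ultimately have on7: "orthonormal_list [a, b, c, d, p, q, r]"
    using orthonormal_list_snoc[of "[a, b, c, d, p, q]" r] on6 u_r o_r by simp
  obtain t where "orthonormal_list ([a, b, c, d, p, q, r] @ [t])"
    by (rule orthonormal_list_extend[OF on7]) (simp add: dim8)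
  then have "frame ([a, b, c, d, p, q, r] @ [t])" by (simp add: frame_def dim8)
  then obtain t' where pf: "positive_frame [a, b, c, d, p, q, r, t']"
    using frame_negate_last[of "[a, b, c, d, p, q, r]" t] by auto
  define e where "e = [a, b, c, d, p, q, r, t']"
  have e: "positive_frame e" and fe: "frame e" using pf positive_frameD by (auto simp: e_def)
  have four: "mono_op e {i, j, k, l} \<xi> = \<gamma> (e ! i) (\<gamma> (e ! j) (\<gamma> (e ! k) (\<gamma> (e ! l) \<xi>)))"
    if "i < j" "j < k" "k < l" "l < 8" for i j k l
    using that by (simp add: mono_op_insert_min[OF fe] mono_op_frame[OF fe])
  have "adapted e \<xi>"
    unfolding adapted_def
  proof (intro conjI e \<xi>(2))
    show "mono_op e {0, 1, 2, 3} \<xi> = - 1 *\<^sub>R \<xi>"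
      using triple_product_square[OF u_abc o_abc, of \<xi>] by (subst four) (simp_all add: e_def d)
    show "mono_op e {0, 1, 4, 5} \<xi> = - 1 *\<^sub>R \<xi>"
      using triple_product_square[OF u_abc(1,2) u_p o_abc(1) o_p'(1,2), of \<xi>]
      by (subst four) (simp_all add: e_def q)
    show "mono_op e {0, 2, 4, 6} \<xi> = - 1 *\<^sub>R \<xi>"
      using triple_product_square[OF u_abc(1,3) u_p o_abc(2) o_p'(1,3), of \<xi>]
      by (subst four) (simp_all add: e_def r)
  qed
  then show ?thesis by (rule that)
qed

end

section \<open>Diagonalising a second inner product\<close>

text \<open>
  Maximise the norm of \<open>f v\<close> over the unit sphere orthogonal to the vectors found so far; the first
  variation at a maximum \<open>x\<close> says that \<open>f x\<close> is orthogonal to the images of the vectors orthogonal to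
  \<open>x\<close>.
\<close>

lemma orthonormal_image_orthogonal_exists:
  fixes f :: "'a::euclidean_space \<Rightarrow> 'b::euclidean_space"
  assumes f: "linear f" and n: "n \<le> DIM('a)"
  shows "\<exists>d. length d = n \<and> orthonormal_list d \<and> (\<forall>x\<in>set d. \<forall>y. x \<bullet> y = 0 \<longrightarrow> f x \<bullet> f y = 0)"
  using n
proof (induction n)
  case 0
  show ?case by (intro exI[of _ "[]"]) (simp add: orthonormal_list_def)
next
  case (Suc n)
  then obtain d where d: "length d = n" "orthonormal_list d"
    and orth: "\<And>x y. x \<in> set d \<Longrightarrow> x \<bullet> y = 0 \<Longrightarrow> f x \<bullet> f y = 0" by auto
  let ?S = "{v. norm v = 1 \<and> (\<forall>p\<in>set d. v \<bullet> p = 0)}"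
  have "?S = sphere 0 1 \<inter> (\<Inter>p\<in>set d. {v. v \<bullet> p = 0})" by auto
  moreover have "closed (\<Inter>p\<in>set d. {v. v \<bullet> p = 0})"
    by (intro closed_INT ballI closed_Collect_eq continuous_intros)
  ultimately have compact: "compact ?S" by (simp add: compact_Int_closed)
  obtain v where "orthonormal_list (d @ [v])"
    by (rule orthonormal_list_extend[OF d(2)]) (use d(1) Suc.prems in simp)
  then have "v \<in> ?S" by (simp add: orthonormal_list_snoc norm_eq_1)
  then have nonempty: "?S \<noteq> {}" by blast
  have "continuous_on ?S (\<lambda>v. norm (f v))"
    by (intro continuous_intros linear_continuous_on linear_conv_bounded_linear[THEN iffD1] f)
  then obtain x where x: "x \<in> ?S" and max: "\<And>v. v \<in> ?S \<Longrightarrow> norm (f v) \<le> norm (f x)"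
    using continuous_attains_sup[OF compact nonempty] by blast
  have xx: "x \<bullet> x = 1" using x by (simp add: norm_eq_1)
  define M where "M = f x \<bullet> f x"
  have bound: "f v \<bullet> f v \<le> M * (v \<bullet> v)" if v: "\<And>p. p \<in> set d \<Longrightarrow> v \<bullet> p = 0" for v
  proof (cases "v = 0")
    case True
    then show ?thesis by (simp add: linear_0[OF f])
  next
    case False
    then have "(1 / norm v) *\<^sub>R v \<in> ?S" using v by simp
    then have "norm (f ((1 / norm v) *\<^sub>R v)) \<le> norm (f x)" by (rule max)
    then have "norm (f v) \<le> norm (f x) * norm v"
      using False by (simp add: linear_scale[OF f] field_simps)
    then have "(norm (f v))\<^sup>2 \<le> (norm (f x) * norm v)\<^sup>2" by (rule power_mono) simp
    then show ?thesis by (simp add: M_def power_mult_distrib power2_norm_eq_inner)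
  qed
  have crit: "f x \<bullet> f y = 0" if y: "\<And>p. p \<in> set d \<Longrightarrow> y \<bullet> p = 0" "x \<bullet> y = 0" for y
  proof (rule ccontr)
    define b where "b = f x \<bullet> f y"
    define C where "C = f y \<bullet> f y - M * (y \<bullet> y)"
    assume "f x \<bullet> f y \<noteq> 0"
    then have b: "b \<noteq> 0" by (simp add: b_def)
    (* The bound along the line through x in the direction of y. *)
    have ineq: "2 * t * b + t * t * C \<le> 0" for t
    proof -
      have "f (x + t *\<^sub>R y) \<bullet> f (x + t *\<^sub>R y) \<le> M * ((x + t *\<^sub>R y) \<bullet> (x + t *\<^sub>R y))"
        using x y(1) by (intro bound) (simp add: inner_add_left)
      then show ?thesis
        using y(2) xx
        by (simp add: linear_add[OF f] linear_scale[OF f] inner_add_left inner_add_right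
            inner_commute b_def C_def M_def algebra_simps)
    qed
    (* At t = b / D the linear term dominates the quadratic one. *)
    define D where "D = 1 + \<bar>C\<bar>"
    have D: "0 < D" "0 < 2 * D + C" by (auto simp: D_def)
    have "2 * (b / D) * b + b / D * (b / D) * C = (b / D)\<^sup>2 * (2 * D + C)"
      using D by (simp add: field_simps power2_eq_square)
    moreover have "0 < (b / D)\<^sup>2 * (2 * D + C)" using b D by (intro mult_pos_pos) auto
    ultimately show False using ineq[of "b / D"] by simp
  qed
  have new: "f x \<bullet> f y = 0" if y: "x \<bullet> y = 0" for y
  proof -
    define u where "u = (\<Sum>p\<in>set d. (y \<bullet> p) *\<^sub>R p)"
    have dd: "p \<bullet> q = (if p = q then 1 else 0)" if "p \<in> set d" "q \<in> set d" for p q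
      using d(2) that by (simp add: orthonormal_list_altdef)
    have "u \<bullet> q = y \<bullet> q" if q: "q \<in> set d" for q
    proof -
      have "u \<bullet> q = (\<Sum>p\<in>set d. if p = q then y \<bullet> p else 0)"
        unfolding u_def inner_sum_left using q by (intro sum.cong refl) (simp add: dd)
      then show ?thesis using q by simp
    qed
    then have 1: "(y - u) \<bullet> q = 0" if "q \<in> set d" for q
      using that by (simp add: inner_diff_left)
    have xp: "x \<bullet> p = 0" if "p \<in> set d" for p using x that by simp
    then have "x \<bullet> u = 0" by (simp add: u_def inner_sum_right)
    then have "f x \<bullet> f (y - u) = 0" using y 1 by (intro crit) (simp_all add: inner_diff_right)
    moreover have "f x \<bullet> f u = 0"
      using orth xp unfolding u_def linear_sum[OF f] linear_scale[OF f] inner_sum_right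
      by (intro sum.neutral) (auto simp: inner_commute)
    ultimately show ?thesis by (simp add: linear_diff[OF f] inner_diff_right)
  qed
  have "orthonormal_list (d @ [x])" using d(2) x xx by (simp add: orthonormal_list_snoc)
  then show ?case using d(1) orth new by (intro exI[of _ "d @ [x]"]) auto
qed

section \<open>Pulling back the model form\<close>

text \<open>
  The coordinate that belongs to the position \<open>p\<close> in a frame; position 7 belongs to the eighth
  coordinate, which has the index \<open>8 = 0\<close>.
\<close>

definition coord :: "nat \<Rightarrow> 8" where "coord p = of_nat (Suc p)"

lemma coord_surj: "\<exists>p<8. x = coord p"
proof (induct x)
  case (of_int z)
  then have z: "0 \<le> z" "z < 8" by simp_all
  show ?case
  proof (cases "z = 0")
    case True
    then show ?thesis by (intro exI[of _ 7]) (simp add: coord_def)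
  next
    case False
    then have "int (Suc (nat (z - 1))) = z" using z by simp
    then have "coord (nat (z - 1)) = of_int z" unfolding coord_def by (metis of_int_of_nat_eq)
    then show ?thesis using z False by (intro exI[of _ "nat (z - 1)"]) auto
  qed
qed

lemma coord_bij: "bij_betw coord {..<8} UNIV"
proof -
  have img: "coord ` {..<8} = UNIV" using coord_surj by auto
  then have "inj_on coord {..<8}" by (intro eq_card_imp_inj_on) simp_all
  then show ?thesis using img by (simp add: bij_betw_def)
qed

lemma inner_coord: "v \<bullet> w = (\<Sum>p<8. v $ coord p * w $ coord p)" for v w :: "real ^ 8"
  unfolding inner_vec_def using sum.reindex_bij_betw[OF coord_bij, of "\<lambda>i. v $ i * w $ i"] by simp

lemma pullback_wedge: "pullback f (wedge \<alpha> \<beta>) = wedge (pullback f \<alpha>) (pullback f \<beta>)"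
  by (simp add: pullback_def wedge_def fun_eq_iff nths_map)

lemma pullback_std_form:
  fixes e :: "'a::euclidean_space list"
  assumes f: "\<And>v p. p < 8 \<Longrightarrow> f v $ coord p = r * (v \<bullet> e ! p)" and w: "set w \<subseteq> {..<8}"
  shows "pullback f (std_form (map coord w)) = (\<lambda>xs. r ^ length w * monomial e w xs)"
  using w
proof (induction w)
  case Nil
  then show ?case
    by (auto simp: std_form_def monomial_def pullback_def one_form_def)
next
  case (Cons p w)
  have 1: "pullback f (coord_form (coord p)) = (\<lambda>xs. r * covector (e ! p) xs)"
    using Cons.prems f[of p]
    by (auto simp: pullback_def coord_form_def covector_def fun_eq_iff inner_commute split: list.splits)
  have 2: "std_form (map coord (p # w)) = wedge (coord_form (coord p)) (std_form (map coord w))"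
    by (simp add: std_form_def)
  have 3: "pullback f (std_form (map coord w)) = (\<lambda>xs. r ^ length w * monomial e w xs)"
    using Cons by simp
  show ?case
    unfolding 2 pullback_wedge 1 3
    by (simp add: fun_eq_iff wedge_scale_left wedge_scale_right monomial_def)
qed

lemma pullback_spin7_model:
  fixes e :: "'a::euclidean_space list"
  assumes f: "\<And>v p. p < 8 \<Longrightarrow> f v $ coord p = r * (v \<bullet> e ! p)"
  shows "pullback f spin7_model = (\<lambda>xs. r ^ 4 * cayley_form e xs)"
proof
  fix xs
  have std: "std_form (map coord w) (map f xs) = r ^ 4 * monomial e w xs"
    if "set w \<subseteq> {..<8}" "length w = 4" for w
    using fun_cong[OF pullback_std_form[OF f that(1)], of xs] that(2) by (simp add: pullback_def)
  have model: "spin7_model = (\<lambda>xs. - (std_form (map coord [0,1,2,3]) xs + std_form (map coord [0,1,4,5]) xs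
     + std_form (map coord [0,1,6,7]) xs + std_form (map coord [0,2,4,6]) xs - std_form (map coord [0,2,5,7]) xs
     - std_form (map coord [0,3,4,7]) xs - std_form (map coord [0,3,5,6]) xs + std_form (map coord [4,5,6,7]) xs
     + std_form (map coord [2,3,6,7]) xs + std_form (map coord [2,3,4,5]) xs + std_form (map coord [1,3,5,7]) xs
     - std_form (map coord [1,3,4,6]) xs - std_form (map coord [1,2,4,7]) xs - std_form (map coord [1,2,5,6]) xs))"
    by (simp add: fun_eq_iff spin7_model_def Phi0_def coord_def)
  have "pullback f spin7_model xs = - (r ^ 4 * (monomial e [0,1,2,3] xs + monomial e [0,1,4,5] xs
     + monomial e [0,1,6,7] xs + monomial e [0,2,4,6] xs - monomial e [0,2,5,7] xs
     - monomial e [0,3,4,7] xs - monomial e [0,3,5,6] xs + monomial e [4,5,6,7] xs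
     + monomial e [2,3,6,7] xs + monomial e [2,3,4,5] xs + monomial e [1,3,5,7] xs
     - monomial e [1,3,4,6] xs - monomial e [1,2,4,7] xs - monomial e [1,2,5,6] xs))"
    unfolding pullback_def model by (simp add: std algebra_simps del: list.map)
  then show "pullback f spin7_model xs = r ^ 4 * cayley_form e xs"
    by (simp add: cayley_form_def cayley_words_def algebra_simps)
qed

text \<open>
  The frame consists of the rescaled preimages of the coordinate axes.
\<close>

lemma conformal_map_frame:
  fixes f :: "'a::euclidean_space \<Rightarrow> real ^ 8"
  assumes dim8: "DIM('a) = 8" and f: "linear f" "bij f" and c: "0 < c" and conf: "\<And>v w. f v \<bullet> f w = c * (v \<bullet> w)"
  obtains e where "frame e" "\<And>v p. p < 8 \<Longrightarrow> f v $ coord p = sqrt c * (v \<bullet> e ! p)"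
proof -
  define b where "b p = sqrt c *\<^sub>R inv f (axis (coord p) 1)" for p
  have fb: "f (b p) = sqrt c *\<^sub>R axis (coord p) 1" for p
    unfolding b_def by (simp add: linear_scale[OF f(1)] bij_is_surj[OF f(2)] surj_f_inv_f)
  define e where "e = map b [0..<8]"
  have e: "e ! p = b p" if "p < 8" for p using that by (simp add: e_def del: upt_rec_numeral)
  have comp: "f v $ coord p = sqrt c * (v \<bullet> b p)" for v p
  proof -
    have "sqrt c * (f v $ coord p) = f v \<bullet> f (b p)" by (simp add: fb inner_axis)
    also have "\<dots> = sqrt c * (sqrt c * (v \<bullet> b p))" using c by (simp add: conf)
    finally show ?thesis using c by simp
  qed
  have inj: "coord p = coord q \<longleftrightarrow> p = q" if "p < 8" "q < 8" for p q
    using coord_bij that by (auto simp: bij_betw_def inj_on_def)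
  have "b p \<bullet> b q = (if p = q then 1 else 0)" if pq: "p < 8" "q < 8" for p q
  proof -
    have "sqrt c * (b p \<bullet> b q) = sqrt c * (if p = q then 1 else 0)"
      unfolding comp[symmetric] fb using inj[OF pq] inj[OF pq(2,1)] by (auto simp: axis_def)
    then show ?thesis using c by simp
  qed
  then have "frame e"
    using dim8 by (simp add: frame_def orthonormal_list_def e) (simp add: e_def)
  then show ?thesis using that comp e by metis
qed

lemma conformal_map_bij:
  fixes f :: "'a::euclidean_space \<Rightarrow> 'b::euclidean_space"
  assumes dims: "DIM('a) = DIM('b)" and f: "linear f" and c: "c \<noteq> 0" and conf: "\<And>v w. f v \<bullet> f w = c * (v \<bullet> w)"
  shows "bij f"
proof -
  have "inj f"
  proof (rule injI)
    fix v w assume "f v = f w"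
    then have "f (v - w) \<bullet> f (v - w) = 0" by (simp add: linear_diff[OF f])
    then show "v = w" unfolding conf using c by simp
  qed
  moreover have "surj f"
  proof -
    have "dim (range f) = DIM('b)"
      using dim_image_eq[OF f, of UNIV] \<open>inj f\<close> dims by simp
    then have "span (range f) = UNIV" by (simp only: dim_eq_full)
    then show ?thesis using linear_subspace_image[OF f subspace_UNIV] by (metis span_eq_iff)
  qed
  ultimately show ?thesis by (simp add: bij_def)
qed

lemma scaled_frame_map:
  fixes e :: "'a::euclidean_space list"
  assumes dim8: "DIM('a) = 8" and e: "frame e" and r: "0 < r"
  obtains f :: "'a \<Rightarrow> real ^ 8" where "linear f" "bij f" "\<And>v p. p < 8 \<Longrightarrow> f v $ coord p = r * (v \<bullet> e ! p)"
    "\<And>v w. f v \<bullet> f w = r\<^sup>2 * (v \<bullet> w)"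
proof -
  define f :: "'a \<Rightarrow> real ^ 8" where "f v = (\<Sum>p<8. (r * (v \<bullet> e ! p)) *\<^sub>R axis (coord p) 1)" for v
  have lin: "linear f"
    unfolding f_def
    by (rule linearI) (simp_all add: inner_add_left distrib_left scaleR_add_left sum.distrib
        scaleR_sum_right mult.left_commute)
  have inj: "coord p = coord q \<longleftrightarrow> p = q" if "p < 8" "q < 8" for p q
    using coord_bij that by (auto simp: bij_betw_def inj_on_def)
  have comp: "f v $ coord q = r * (v \<bullet> e ! q)" if q: "q < 8" for v q
  proof -
    have "f v $ coord q = (\<Sum>p<8. if p = q then r * (v \<bullet> e ! p) else 0)"
      unfolding f_def sum_component using inj[OF q] by (intro sum.cong refl) (auto simp: axis_def)
    then show ?thesis using q by simp
  qed
  have inner: "f v \<bullet> f w = r\<^sup>2 * (v \<bullet> w)" for v w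
    unfolding inner_coord frame_inner_sum[OF e, of v w] dim8 sum_distrib_left
    by (intro sum.cong refl) (simp add: comp power2_eq_square)
  have "bij f"
    using r by (intro conformal_map_bij[OF _ lin _ inner]) (simp_all add: dim8)
  then show ?thesis using that lin comp inner by blast
qed

lemma polyform_scaled_vectors:
  assumes "\<alpha> \<in> polyforms"
  shows "\<alpha> (map (\<lambda>i. c i *\<^sub>R b i) is) = (\<Prod>i\<leftarrow>is. c i) * \<alpha> (map b is)"
  using assms
proof (induction "is" arbitrary: \<alpha>)
  case (Cons i "is")
  have "\<alpha> (map (\<lambda>i. c i *\<^sub>R b i) (i # is)) = c i * \<alpha> (b i # map (\<lambda>i. c i *\<^sub>R b i) is)"
    using linear_scale[OF polyform_linear_Cons[OF Cons.prems]] by simp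
  also have "\<alpha> (b i # map (\<lambda>i. c i *\<^sub>R b i) is) = (\<Prod>i\<leftarrow>is. c i) * \<alpha> (b i # map b is)"
    using Cons.IH[OF interior_prod_polyform[OF Cons.prems, of "b i"]] by (simp add: interior_prod_def)
  finally show ?case by simp
qed simp

lemma polyform_nths_scaled:
  assumes \<alpha>: "\<alpha> \<in> polyforms" and len: "length d = n" and S: "S \<subseteq> {..<n}"
    and g: "\<And>i. i < n \<Longrightarrow> g (d ! i) = c i *\<^sub>R d ! i"
  shows "\<alpha> (map g (nths d S)) = (\<Prod>i\<in>S. c i) * \<alpha> (nths d S)"
proof -
  let ?is = "nths [0..<n] S"
  have set: "set ?is = S"
  proof
    show "S \<subseteq> set ?is" using S by (auto simp: set_nths intro!: exI)
  qed (use S in \<open>auto simp: set_nths\<close>)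
  then have prod: "(\<Prod>i\<leftarrow>?is. c i) = (\<Prod>i\<in>S. c i)"
    by (simp add: prod.distinct_set_conv_list[symmetric])
  have d: "nths d S = map ((!) d) ?is" using len by (metis map_nth nths_map)
  have "g (d ! i) = c i *\<^sub>R d ! i" if "i \<in> set ?is" for i
    using that S g unfolding set by auto
  then have "map g (nths d S) = map (\<lambda>i. c i *\<^sub>R d ! i) ?is"
    unfolding d by simp
  then show ?thesis using polyform_scaled_vectors[OF \<alpha>, of c "(!) d" ?is] by (simp only: d prod)
qed

section \<open>The metric of a \<open>Spin(7)\<close> form\<close>

text \<open>
  A weight on the four-element subsets of an eight-element set that is equidistributed over the
  triples forces a function with prescribed sum over the support to be constant: average the sum
  over all supporting sets through a given element.
\<close>

lemma equidistributed_weight_constant: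
  fixes w :: "nat set \<Rightarrow> real" and \<mu> :: "nat \<Rightarrow> real"
  assumes eq: "\<And>i j k. i < 8 \<Longrightarrow> j < 8 \<Longrightarrow> k < 8 \<Longrightarrow>
      (\<Sum>l<8. if card {i, j, k, l} = 4 then w {i, j, k, l} else 0) = (if card {i, j, k} = 3 then 1 else 0)"
    and sum: "\<And>S. S \<subseteq> {..<8} \<Longrightarrow> card S = 4 \<Longrightarrow> w S \<noteq> 0 \<Longrightarrow> (\<Sum>i\<in>S. \<mu> i) = K"
    and i: "i < 8"
  shows "24 * \<mu> i = 42 * K - 18 * (\<Sum>j<8. \<mu> j)"
proof -
  define \<phi> where "\<phi> j k l = (if card {i, j, k, l} = 4 then w {i, j, k, l} else 0)" for j k l
  define M where "M = (\<Sum>j<8. \<mu> j)"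
  have sym: "\<phi> j k l = \<phi> k j l" "\<phi> j k l = \<phi> l k j" for j k l
    by (simp_all add: \<phi>_def insert_commute)
  have N: "(\<Sum>k<8. \<Sum>l<8. \<phi> j k l) = (if j = i then 0 else 6)" if j: "j < 8" for j
  proof -
    have "(\<Sum>k<8. \<Sum>l<8. \<phi> j k l) = (\<Sum>k<8. if card {i, j, k} = 3 then 1 else 0)"
      unfolding \<phi>_def using i j by (intro sum.cong refl eq) auto
    also have "\<dots> = (\<Sum>k<8. if k \<in> {..<8} - {i, j} \<and> j \<noteq> i then 1 else 0)"
      by (intro sum.cong refl) (auto simp: card_insert_if)
    also have "\<dots> = (if j = i then 0 else real (card ({..<8} - {i, j})))"
      by (cases "j = i") (auto simp: sum.If_cases intro!: arg_cong[of _ _ card])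
    also have "\<dots> = (if j = i then 0 else 6)"
    proof (cases "j = i")
      case False
      then have "card ({..<8} - {i, j}) = 6" using i j by (subst card_Diff_subset) auto
      then show ?thesis by simp
    qed simp
    finally show ?thesis .
  qed
  have S1: "(\<Sum>j<8. \<Sum>k<8. \<Sum>l<8. \<phi> j k l * \<mu> j) = 6 * (M - \<mu> i)"
  proof -
    have "(\<Sum>j<8. \<Sum>k<8. \<Sum>l<8. \<phi> j k l * \<mu> j) = (\<Sum>j<8. (\<Sum>k<8. \<Sum>l<8. \<phi> j k l) * \<mu> j)"
      by (simp add: sum_distrib_right)
    also have "\<dots> = (\<Sum>j<8. 6 * \<mu> j - (if j = i then 6 * \<mu> i else 0))"
      by (intro sum.cong refl) (simp add: N)
    also have "\<dots> = 6 * (M - \<mu> i)"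
      using i by (simp add: sum_subtractf M_def right_diff_distrib flip: sum_distrib_left)
    finally show ?thesis .
  qed
  have S2: "(\<Sum>j<8. \<Sum>k<8. \<Sum>l<8. \<phi> j k l * \<mu> k) = 6 * (M - \<mu> i)"
  proof -
    have "(\<Sum>j<8. \<Sum>k<8. \<Sum>l<8. \<phi> j k l * \<mu> k) = (\<Sum>k<8. \<Sum>j<8. \<Sum>l<8. \<phi> k j l * \<mu> k)"
      by (subst sum.swap) (simp only: sym(1))
    then show ?thesis using S1 by simp
  qed
  have S3: "(\<Sum>j<8. \<Sum>k<8. \<Sum>l<8. \<phi> j k l * \<mu> l) = 6 * (M - \<mu> i)"
  proof -
    have "(\<Sum>j<8. \<Sum>k<8. \<Sum>l<8. \<phi> j k l * \<mu> l) = (\<Sum>k<8. \<Sum>j<8. \<Sum>l<8. \<phi> j k l * \<mu> l)"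
      by (rule sum.swap)
    also have "\<dots> = (\<Sum>k<8. \<Sum>l<8. \<Sum>j<8. \<phi> j k l * \<mu> l)"
      by (intro sum.cong refl sum.swap)
    also have "\<dots> = (\<Sum>k<8. \<Sum>l<8. \<Sum>j<8. \<phi> l k j * \<mu> l)"
      by (intro sum.cong refl arg_cong2[where f = "(*)"] sym(2))
    also have "\<dots> = (\<Sum>l<8. \<Sum>k<8. \<Sum>j<8. \<phi> l k j * \<mu> l)"
      by (rule sum.swap)
    finally show ?thesis using S1 by simp
  qed
  have S0: "(\<Sum>j<8. \<Sum>k<8. \<Sum>l<8. \<phi> j k l) = 42"
  proof -
    have "(\<Sum>j<8. \<Sum>k<8. \<Sum>l<8. \<phi> j k l) = (\<Sum>j<8. 6 - (if j = i then 6 else 0))"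
      by (intro sum.cong refl) (simp add: N)
    then show ?thesis using i by (simp add: sum_subtractf)
  qed
  have zero: "\<phi> j k l * (\<mu> i + \<mu> j + \<mu> k + \<mu> l - K) = 0" if "j < 8" "k < 8" "l < 8" for j k l
  proof (cases "card {i, j, k, l} = 4 \<and> w {i, j, k, l} \<noteq> 0")
    case True
    then have "i \<noteq> j" "i \<noteq> k" "i \<noteq> l" "j \<noteq> k" "j \<noteq> l" "k \<noteq> l"
      by (auto simp: card_insert_if split: if_splits)
    then have "(\<Sum>x\<in>{i, j, k, l}. \<mu> x) = \<mu> i + \<mu> j + \<mu> k + \<mu> l" by simp
    then show ?thesis using sum[of "{i, j, k, l}"] True that i by simp
  next
    case False
    then show ?thesis by (auto simp: \<phi>_def)
  qed
  have "0 = (\<Sum>j<8. \<Sum>k<8. \<Sum>l<8. \<phi> j k l * (\<mu> i + \<mu> j + \<mu> k + \<mu> l - K))"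
    by (simp add: zero)
  also have "\<dots> = (\<Sum>j<8. \<Sum>k<8. \<Sum>l<8. (\<mu> i - K) * \<phi> j k l + \<phi> j k l * \<mu> j + \<phi> j k l * \<mu> k + \<phi> j k l * \<mu> l)"
    by (intro sum.cong refl) (simp add: algebra_simps)
  also have "\<dots> = (\<mu> i - K) * 42 + 6 * (M - \<mu> i) + 6 * (M - \<mu> i) + 6 * (M - \<mu> i)"
    unfolding sum.distrib S1 S2 S3 sum_distrib_left[symmetric] S0 ..
  finally show ?thesis by (simp add: M_def algebra_simps)
qed

context spinor_module
begin

text \<open>A form that is the square of a positive spinor is self-dual, as the spinor is fixed by \<open>\<nu>\<close>.\<close>

lemma cayley_form_self_dual:
  assumes e: "positive_frame e"
  shows "(\<lambda>xs. \<kappa> * cayley_form e xs) \<in> self_dual_4forms ori"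
proof -
  have fe: "frame e" by (rule positive_frameD[OF e])
  have c4: "(\<lambda>xs. \<kappa> * cayley_form e xs) \<in> forms 4" for \<kappa>
    using cayley_form_form[OF fe dim8] by (auto simp: forms_def intro: scale_polyform)
  obtain \<xi> where \<xi>: "adapted e \<xi>" "\<xi> \<bullet> \<xi> = 1" by (rule adapted_spinor_exists[OF e]) auto
  note lin = linear_\<Psi>[OF volume_form_polyform]
  have "\<Psi> \<nu> (\<Psi> (cayley_form e) \<eta>) = \<Psi> (cayley_form e) \<eta>" for \<eta>
  proof -
    have sq: "(1 / 16) *\<^sub>R (\<eta> + \<Psi> (cayley_form e) \<eta> + \<Psi> \<nu> \<eta>) = (\<xi> \<bullet> \<eta>) *\<^sub>R \<xi>"
      using adapted_square[OF \<xi>(1), of \<eta>] \<xi>(2) by (simp add: \<Psi>_spinor_polyform[OF cayley_form_polyform])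
    have "\<Psi> \<nu> ((1 / 16) *\<^sub>R (\<eta> + \<Psi> (cayley_form e) \<eta> + \<Psi> \<nu> \<eta>)) = (1 / 16) *\<^sub>R (\<eta> + \<Psi> (cayley_form e) \<eta> + \<Psi> \<nu> \<eta>)"
      unfolding sq using \<xi>(1) by (simp add: linear_scale[OF lin] adapted_def)
    then have "\<Psi> \<nu> (\<eta> + \<Psi> (cayley_form e) \<eta> + \<Psi> \<nu> \<eta>) = \<eta> + \<Psi> (cayley_form e) \<eta> + \<Psi> \<nu> \<eta>"
      unfolding linear_scale[OF lin] by simp
    then show ?thesis by (simp add: linear_add[OF lin] volume_involution)
  qed
  then show ?thesis
    unfolding self_dual_iff_volume_op[OF c4]
    by (simp add: \<Psi>_scale[OF cayley_form_polyform] linear_scale[OF lin])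
qed

text \<open>
  The triple products \<open>d\<^sub>i d\<^sub>j d\<^sub>k \<xi>\<close> are negative unit spinors, whose components in the orthonormal
  system of the \<open>d\<^sub>l \<xi>\<close> are, up to sign, the coefficients of the form.
\<close>

lemma cayley_form_equidistributed:
  assumes e: "positive_frame e" and d: "positive_frame d" and ijk: "i < 8" "j < 8" "k < 8"
  shows "(\<Sum>l<8. if card {i, j, k, l} = 4 then (cayley_form e (nths d {i, j, k, l}))\<^sup>2 else 0)
    = (if card {i, j, k} = 3 then 1 else 0)"
proof -
  have fe: "frame e" and fd: "frame d" using e d by (auto simp: positive_frame_def)
  obtain \<xi> where \<xi>: "adapted e \<xi>" "\<xi> \<bullet> \<xi> = 1" by (rule adapted_spinor_exists[OF e]) auto
  have \<xi>0: "\<xi> \<noteq> 0" "\<Psi> \<nu> \<xi> = \<xi>" using \<xi> by (auto simp: adapted_def)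
  define A where "A = {i, j, k}"
  have A: "A \<subseteq> {..<8}" "finite A" using ijk by (auto simp: A_def)
  have ins: "{i, j, k, l} = insert l A" for l by (auto simp: A_def)
  have c: "cayley_form e (nths d S) = \<xi> \<bullet> mono_op d S \<xi>" if S: "S \<subseteq> {..<8}" "card S = 4" for S
  proof -
    let ?\<alpha> = "spinor_polyform 1 (\<lambda>xs. 1 * cayley_form e xs)"
    have p: "?\<alpha> \<in> polyforms" by (rule spinor_polyform_polyform[OF scale_polyform[OF cayley_form_polyform]])
    have "S \<noteq> {}" "S \<noteq> {..<8}" using S by auto
    then have "?\<alpha> (nths d S) = 1 / 16 * cayley_form e (nths d S)"
      using S dim8 by (simp add: spinor_polyform_def one_form_nths[OF fd] volume_nths[OF d])
    then have "cayley_form e (nths d S) = op_inner (\<Psi> ?\<alpha>) (mono_op d S)"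
      using op_inner_\<Psi>_mono_op[OF fd p, of S] S dim8 by simp
    also have "\<dots> = (\<Sum>b\<in>Basis. (\<xi> \<bullet> b) * (\<xi> \<bullet> mono_op d S b))"
      using adapted_square[OF \<xi>(1)] \<xi>(2) by (simp add: op_inner_def)
    also have "\<dots> = \<xi> \<bullet> mono_op d S (\<Sum>b\<in>Basis. (\<xi> \<bullet> b) *\<^sub>R b)"
      by (simp add: linear_sum[OF linear_mono_op] linear_scale[OF linear_mono_op] inner_sum_right
          del: euclidean_representation)
    finally show ?thesis by (simp add: euclidean_representation)
  qed
  show ?thesis
  proof (cases "card A = 3")
    case True
    have "{..<8} \<inter> A = A" using A by auto
    then have "reorder_sign {..<8} A = - reorder_sign A {..<8}"
      using reorder_sign_swap[of "{..<8}" A] A True by simp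
    moreover have "sym_diff {..<8} A = sym_diff A {..<8}" by auto
    ultimately have "\<Psi> \<nu> (mono_op d A \<xi>) = - mono_op d A (\<Psi> \<nu> \<xi>)"
      using mono_op_mult[OF fd, of "{..<8}" A \<xi>] mono_op_mult[OF fd, of A "{..<8}" \<xi>] A dim8
      by (simp add: \<Psi>_volume[OF d])
    then have "\<Psi> \<nu> (mono_op d A \<xi>) = - mono_op d A \<xi>" by (simp add: \<xi>0)
    then obtain v where v: "\<gamma> v \<xi> = mono_op d A \<xi>" by (rule \<gamma>_surj[OF \<xi>0])
    have sub: "A \<subseteq> {..<DIM('a)}" using A dim8 by simp
    have "mono_op d A \<xi> \<bullet> mono_op d A \<xi> = 1"
      using \<xi>(2) by (simp add: mono_op_adjoint[OF fd sub] mono_op_mult[OF fd sub sub] mono_op_empty)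
    then have "v \<bullet> v = 1" using \<gamma>_inner[of v \<xi> v] \<xi>(2) v by simp
    then have "(\<Sum>l<8. (v \<bullet> d ! l)\<^sup>2) = 1"
      using frame_inner_sum[OF fd, of v v] dim8 by (simp add: power2_eq_square)
    moreover have "(v \<bullet> d ! l)\<^sup>2 = (if card {i, j, k, l} = 4 then (cayley_form e (nths d {i, j, k, l}))\<^sup>2 else 0)"
      if l: "l \<in> {..<8}" for l
    proof -
      have "v \<bullet> d ! l = mono_op d A \<xi> \<bullet> mono_op d {l} \<xi>"
        using \<gamma>_inner[of v \<xi> "d ! l"] \<xi>(2) v l by (simp add: mono_op_frame[OF fd])
      also have "\<dots> = reorder_sign A A * (reorder_sign A {l} * (\<xi> \<bullet> mono_op d (sym_diff A {l}) \<xi>))"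
        using l dim8 by (simp add: mono_op_adjoint[OF fd sub] mono_op_mult[OF fd sub])
      finally have "(v \<bullet> d ! l)\<^sup>2 = (reorder_sign A A * reorder_sign A A)
          * (reorder_sign A {l} * reorder_sign A {l}) * (\<xi> \<bullet> mono_op d (sym_diff A {l}) \<xi>)\<^sup>2"
        by (simp only: power2_eq_square mult_ac)
      then have sq: "(v \<bullet> d ! l)\<^sup>2 = (\<xi> \<bullet> mono_op d (sym_diff A {l}) \<xi>)\<^sup>2" by simp
      show ?thesis
      proof (cases "l \<in> A")
        case False
        then have "sym_diff A {l} = insert l A" "card (insert l A) = 4" using A True by auto
        then show ?thesis using sq c[of "insert l A"] A l unfolding ins by simp
      next
        case True
        then have B: "sym_diff A {l} = A - {l}" "card (A - {l}) = 2" using A \<open>card A = 3\<close> by auto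
        have "A - {l} \<subseteq> {..<DIM('a)}" using sub by auto
        moreover have "reorder_sign (A - {l}) (A - {l}) = -1"
          using A B(2) by (simp add: reorder_sign_self)
        ultimately have "\<xi> \<bullet> mono_op d (A - {l}) \<xi> = - (\<xi> \<bullet> mono_op d (A - {l}) \<xi>)"
          using mono_op_adjoint[OF fd, of "A - {l}" \<xi> \<xi>] by (simp add: inner_commute)
        moreover have "insert l A = A" using True by auto
        ultimately show ?thesis using sq \<open>card A = 3\<close> unfolding ins B(1) by simp
      qed
    qed
    ultimately show ?thesis using True by (simp add: A_def)
  next
    case False
    have "card A \<le> 3" unfolding A_def by (metis card_insert_le_m1 card_length list.set length_Cons list.size(3) numeral_3_eq_3)
    then have "card A \<le> 2" using False by simp
    then have "card {i, j, k, l} \<noteq> 4" for l unfolding ins using A(2) by (simp add: card_insert_if)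
    then show ?thesis using False by (simp add: A_def)
  qed
qed

lemma top_form_inverse:
  assumes "frame e" "frame b"
  shows "top_form e b * top_form b e = 1"
  using fun_cong[OF form8_eq[OF assms(2) top_form_form[OF assms(1)]], of e] top_form_self[OF assms(1)]
  by simp

lemma std_orientation_iff:
  assumes f: "\<And>v p. p < 8 \<Longrightarrow> f v $ coord p = r * (v \<bullet> e ! p)" and r: "0 < r"
  shows "map f xs \<in> std_orientation \<longleftrightarrow> 0 < top_form e xs"
proof -
  have "[1, 2, 3, 4, 5, 6, 7, 8] = map coord [0..<8]" by (simp add: coord_def upt_rec)
  then have "std_form [1, 2, 3, 4, 5, 6, 7, 8] (map f xs) = r ^ 8 * top_form e xs"
    using fun_cong[OF pullback_std_form[OF f, of "[0..<8]"], of xs]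
    by (simp add: pullback_def atLeast0LessThan del: upt_rec_numeral)
  then show ?thesis using r by (simp add: std_orientation_def zero_less_mult_iff)
qed

text \<open>
  The standard volume form pulls back to a positive multiple of the top form of the frame.
\<close>

lemma positive_frame_iff_oriented:
  assumes f: "\<And>v p. p < 8 \<Longrightarrow> f v $ coord p = r * (v \<bullet> e ! p)" and r: "0 < r" and e: "frame e"
  shows "positive_frame e \<longleftrightarrow> (\<forall>xs\<in>ori. map f xs \<in> std_orientation)"
proof
  assume "positive_frame e"
  then show "\<forall>xs\<in>ori. map f xs \<in> std_orientation"
    using std_orientation_iff[OF f r] ori_iff by simp
next
  assume *: "\<forall>xs\<in>ori. map f xs \<in> std_orientation"
  obtain b where b: "positive_frame b" by (rule positive_Basis_frame)
  then have "0 < top_form e b" using * std_orientation_iff[OF f r] by (auto simp: positive_frame_def)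
  then have "0 < top_form b e"
    using top_form_inverse[OF e positive_frameD[OF b]] by (metis zero_less_mult_pos zero_less_one)
  then show "positive_frame e" using positive_frame_iff[OF b e] by simp
qed

lemma cayley_form_norm_frame:
  fixes e d :: "'a list"
  assumes "frame e" "frame d"
  shows "(\<Sum>S\<in>Pow {..<8}. (cayley_form e (nths d S))\<^sup>2) = 14"
  using form_norm_square[OF assms(2) cayley_form_polyform, of e] form_norm_square[OF assms(1) cayley_form_polyform, of e]
    cayley_form_norm_sum[OF assms(1) dim8] dim8 by simp

text \<open>
  In a frame \<open>d\<close> that is orthogonal for both inner products, let \<open>\<sigma> i\<close> be the lengths for the second
  one. Self-duality for both inner products and the two norms give that the product of the \<open>\<sigma> i\<close> is
  \<open>\<kappa>\<close> over each set of indices in the support of the form; the equidistribution over triples makes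
  them all equal.
\<close>

lemma cayley_form_metric:
  assumes e: "positive_frame e" and \<kappa>: "0 < \<kappa>" and f: "oriented_iso ori f"
    and model: "pullback f spin7_model = (\<lambda>xs. \<kappa> * cayley_form e xs)"
  shows "\<exists>c>0. \<forall>v w. f v \<bullet> f w = c * (v \<bullet> w)"
proof -
  let ?U = "{..<8::nat}"
  have lin: "linear f" and bij: "bij f" and f_ori: "\<And>xs. xs \<in> ori \<Longrightarrow> map f xs \<in> std_orientation"
    using f by (auto simp: oriented_iso_def)
  have fe: "frame e" by (rule positive_frameD[OF e])
  obtain d0 where d0: "length d0 = 8" "orthonormal_list d0"
    and d0_orth: "\<And>x y. x \<in> set d0 \<Longrightarrow> x \<bullet> y = 0 \<Longrightarrow> f x \<bullet> f y = 0"
    using orthonormal_image_orthogonal_exists[OF lin, of 8] dim8 by auto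
  obtain ds t where ds: "d0 = ds @ [t]" using d0(1) by (cases d0 rule: rev_cases) auto
  have "frame (ds @ [t])" using d0 ds dim8 by (simp add: frame_def)
  then obtain d where d: "positive_frame d" and d_cases: "d = ds @ [t] \<or> d = ds @ [- t]"
    using frame_negate_last by blast
  have fd: "frame d" by (rule positive_frameD[OF d])
  have len: "length d = 8" using frame_length[OF fd] dim8 by simp
  have d_orth: "f x \<bullet> f y = 0" if "x \<in> set d" "x \<bullet> y = 0" for x y
  proof (cases "x \<in> set d0")
    case False
    then have "- x \<in> set d0" using that d_cases ds by auto
    then show ?thesis using d0_orth[of "- x" y] that by (simp add: linear_neg[OF lin])
  qed (use d0_orth that in simp)
  (* The lengths for the second inner product. *)
  define \<sigma> where "\<sigma> i = norm (f (d ! i))" for i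
  have \<sigma>: "0 < \<sigma> i" if "i < 8" for i
  proof -
    have "d ! i \<noteq> 0" using frame_inner[OF fd, of i i] that dim8 by auto
    then have "f (d ! i) \<noteq> 0" using bij linear_0[OF lin] by (metis bij_is_inj injD)
    then show ?thesis by (simp add: \<sigma>_def)
  qed
  have \<sigma>_nz: "\<sigma> i \<noteq> 0" if "i < 8" for i using \<sigma>[OF that] by simp
  have fdd: "f (d ! i) \<bullet> f (d ! j) = (if i = j then (\<sigma> i)\<^sup>2 else 0)" if "i < 8" "j < 8" for i j
    using that d_orth[of "d ! i" "d ! j"] frame_inner[OF fd, of i j] dim8 len
    by (auto simp: \<sigma>_def power2_norm_eq_inner)
  (* The isometry that agrees with f up to scaling the vectors of d. *)
  define g where "g v = (\<Sum>i<8. ((v \<bullet> d ! i) / \<sigma> i) *\<^sub>R f (d ! i))" for v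
  have lin_g: "linear g"
    unfolding g_def
    by (rule linearI) (simp_all add: inner_add_left add_divide_distrib scaleR_add_left sum.distrib scaleR_sum_right)
  have gd: "g (\<sigma> i *\<^sub>R d ! i) = f (d ! i)" if i: "i < 8" for i
  proof -
    have "g (\<sigma> i *\<^sub>R d ! i) = (\<Sum>j<8. if j = i then f (d ! i) else 0)"
      unfolding g_def using frame_inner[OF fd, of i] \<sigma>[OF i] i dim8 by (intro sum.cong refl) auto
    then show ?thesis using i by simp
  qed
  have iso: "g v \<bullet> g w = 1 * (v \<bullet> w)" for v w
  proof -
    have "g v \<bullet> g w = (\<Sum>i<8. \<Sum>j<8. if j = i then (v \<bullet> d ! i) * (w \<bullet> d ! i) else 0)"
      unfolding g_def inner_sum_left inner_sum_right
      by (intro sum.cong refl) (auto simp: fdd \<sigma>_nz power2_eq_square)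
    also have "\<dots> = (\<Sum>i<8. (v \<bullet> d ! i) * (w \<bullet> d ! i))" by simp
    finally show ?thesis using frame_inner_sum[OF fd, of v w] dim8 by simp
  qed
  have bij_g: "bij g" by (rule conformal_map_bij[OF _ lin_g _ iso]) (simp_all add: dim8)
  obtain e' where fe': "frame e'" and e': "\<And>v p. p < 8 \<Longrightarrow> g v $ coord p = sqrt 1 * (v \<bullet> e' ! p)"
    using conformal_map_frame[OF dim8 lin_g bij_g _ iso] by auto
  have model': "pullback g spin7_model = cayley_form e'"
    using pullback_spin7_model[OF e'] by simp
  define h where "h v = inv g (f v)" for v
  have gh: "g (h v) = f v" for v by (simp add: h_def bij_is_surj[OF bij_g] surj_f_inv_f)
  have hd: "h (d ! i) = \<sigma> i *\<^sub>R d ! i" if "i < 8" for i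
    unfolding h_def gd[OF that, symmetric] by (rule inv_f_f[OF bij_is_inj[OF bij_g]])
  define c where "c S = cayley_form e (nths d S)" for S
  define c' where "c' S = cayley_form e' (nths d S)" for S
  have scaling: "\<kappa> * c S = (\<Prod>i\<in>S. \<sigma> i) * c' S" if S: "S \<subseteq> ?U" for S
  proof -
    have "\<kappa> * c S = pullback f spin7_model (nths d S)" by (simp add: model c_def)
    also have "\<dots> = cayley_form e' (map h (nths d S))"
      unfolding model'[symmetric] by (simp add: pullback_def gh o_def)
    also have "\<dots> = (\<Prod>i\<in>S. \<sigma> i) * c' S"
      unfolding c'_def by (rule polyform_nths_scaled[OF cayley_form_polyform len S hd])
    finally show ?thesis .
  qed
  have prod_pos: "0 < (\<Prod>i\<in>S. \<sigma> i)" if "S \<subseteq> ?U" for S using that \<sigma> by (intro prod_pos) auto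
  have pe': "positive_frame e'"
  proof -
    have "map g (map h d) = map f d" by (simp add: gh)
    also have "map f d \<in> std_orientation" using f_ori[of d] d by (simp add: positive_frame_def)
    finally have "map g (map h d) \<in> std_orientation" .
    then have "0 < top_form e' (map h (nths d ?U))"
      using std_orientation_iff[OF e', of "map h d"] len by (simp add: nths_full del: map_map)
    also have "top_form e' (map h (nths d ?U)) = (\<Prod>i\<in>?U. \<sigma> i) * top_form e' (nths d ?U)"
      by (rule polyform_nths_scaled[OF monomial_polyform len subset_refl hd])
    finally have "0 < top_form e' d"
      using prod_pos[of ?U] len by (simp add: nths_full zero_less_mult_iff)
    then have "0 < top_form d e'"
      using top_form_inverse[OF fe' fd] by (metis zero_less_mult_pos zero_less_one)
    then show ?thesis using positive_frame_iff[OF d fe'] by simp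
  qed
  have dual: "c S = reorder_sign (?U - S) S * c (?U - S)" "c' S = reorder_sign (?U - S) S * c' (?U - S)"
    if S: "S \<subseteq> ?U" "card S = 4" for S
    using self_dual_nths[OF d cayley_form_self_dual[OF e, of 1] S]
      self_dual_nths[OF d cayley_form_self_dual[OF pe', of 1] S] by (simp_all add: c_def c'_def)
  define L where "L = (\<Prod>i\<in>?U. \<sigma> i)"
  have square: "\<kappa>\<^sup>2 * (c S)\<^sup>2 = L * (c' S)\<^sup>2" if S: "S \<in> Pow ?U" for S
  proof (cases "card S = 4")
    case True
    have SU: "S \<subseteq> ?U" using S by simp
    let ?s = "reorder_sign (?U - S) S"
    have "\<kappa>\<^sup>2 * (c S)\<^sup>2 = (\<kappa> * c S) * (?s * (\<kappa> * c (?U - S)))"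
      using dual(1)[OF SU True] by (simp add: power2_eq_square mult_ac)
    also have "\<dots> = ((\<Prod>i\<in>S. \<sigma> i) * c' S) * (?s * ((\<Prod>i\<in>?U - S. \<sigma> i) * c' (?U - S)))"
      using scaling[OF SU] scaling[of "?U - S"] by simp
    also have "\<dots> = ((\<Prod>i\<in>?U - S. \<sigma> i) * (\<Prod>i\<in>S. \<sigma> i)) * (c' S * (?s * c' (?U - S)))" by (simp add: mult_ac)
    also have "(\<Prod>i\<in>?U - S. \<sigma> i) * (\<Prod>i\<in>S. \<sigma> i) = L"
      unfolding L_def by (rule prod.subset_diff[OF SU finite_lessThan, symmetric])
    finally show ?thesis using dual(2)[OF SU True] by (simp add: power2_eq_square)
  next
    case False
    then have "c S = 0" "c' S = 0"
      using form_nths_eq_0[OF fd cayley_form_form[OF fe dim8], of S]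
        form_nths_eq_0[OF fd cayley_form_form[OF fe' dim8], of S] S dim8 by (auto simp: c_def c'_def)
    then show ?thesis by simp
  qed
  have "\<kappa>\<^sup>2 * 14 = L * 14"
  proof -
    have "\<kappa>\<^sup>2 * (\<Sum>S\<in>Pow ?U. (c S)\<^sup>2) = L * (\<Sum>S\<in>Pow ?U. (c' S)\<^sup>2)"
      unfolding sum_distrib_left by (rule sum.cong[OF refl square])
    then show ?thesis using cayley_form_norm_frame[OF fe fd] cayley_form_norm_frame[OF fe' fd]
      by (simp add: c_def c'_def)
  qed
  then have L: "L = \<kappa>\<^sup>2" by simp
  have support: "(\<Prod>i\<in>S. \<sigma> i) = \<kappa>" if S: "S \<subseteq> ?U" and nz: "c S \<noteq> 0" for S
  proof -
    have eq: "(c S)\<^sup>2 = (c' S)\<^sup>2" using square[of S] S \<kappa> by (simp add: L)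
    have "\<kappa>\<^sup>2 * (c S)\<^sup>2 = (\<Prod>i\<in>S. \<sigma> i)\<^sup>2 * (c' S)\<^sup>2"
      using scaling[OF S] by (metis power_mult_distrib)
    then have "\<kappa>\<^sup>2 = (\<Prod>i\<in>S. \<sigma> i)\<^sup>2" using nz unfolding eq[symmetric] by simp
    then show ?thesis using \<kappa> prod_pos[OF S] by (simp add: power2_eq_iff_nonneg)
  qed
  have support_sum: "(\<Sum>i\<in>S. ln (\<sigma> i)) = ln \<kappa>" if S: "S \<subseteq> ?U" "card S = 4" "(c S)\<^sup>2 \<noteq> 0" for S
  proof -
    have "finite S" using S finite_subset by blast
    moreover have "\<And>i. i \<in> S \<Longrightarrow> \<sigma> i \<noteq> 0" using S \<sigma>_nz by auto
    ultimately have "ln (\<Prod>i\<in>S. \<sigma> i) = (\<Sum>i\<in>S. ln (\<sigma> i))" by (intro ln_prod)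
    then show ?thesis using support[of S] S by simp
  qed
  have const: "24 * ln (\<sigma> i) = 42 * ln \<kappa> - 18 * (\<Sum>j<8. ln (\<sigma> j))" if "i < 8" for i
    by (rule equidistributed_weight_constant[where w = "\<lambda>S. (c S)\<^sup>2", OF _ support_sum that])
      (unfold c_def, rule cayley_form_equidistributed[OF e d])
  have same: "\<sigma> i = \<sigma> 0" if "i < 8" for i
  proof -
    have "ln (\<sigma> i) = ln (\<sigma> 0)" using const[OF that] const[of 0] by simp
    then show ?thesis using \<sigma>[OF that] \<sigma>[of 0] by simp
  qed
  have "f v \<bullet> f w = (\<sigma> 0)\<^sup>2 * (v \<bullet> w)" for v w
  proof -
    have fdd0: "f (d ! i) \<bullet> f (d ! j) = (if i = j then (\<sigma> 0)\<^sup>2 else 0)" if "i < 8" "j < 8" for i j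
      using fdd[OF that] unfolding same[OF that(1)] .
    have expand: "f x = (\<Sum>i<8. (x \<bullet> d ! i) *\<^sub>R f (d ! i))" for x
      using arg_cong[OF frame_expansion[OF fd, of x], of f] dim8
      by (simp add: linear_sum[OF lin] linear_scale[OF lin])
    have "f v \<bullet> f w = (\<Sum>i<8. \<Sum>j<8. if j = i then (\<sigma> 0)\<^sup>2 * ((v \<bullet> d ! i) * (w \<bullet> d ! i)) else 0)"
      unfolding expand[of v] expand[of w] inner_sum_left inner_sum_right
      by (intro sum.cong refl) (auto simp: fdd0)
    also have "\<dots> = (\<sigma> 0)\<^sup>2 * (\<Sum>i<8. (v \<bullet> d ! i) * (w \<bullet> d ! i))" by (simp add: sum_distrib_left)
    finally show ?thesis using frame_inner_sum[OF fd, of v w] dim8 by simp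
  qed
  then show ?thesis using \<sigma>[of 0] by (intro exI[of _ "(\<sigma> 0)\<^sup>2"]) simp
qed

section \<open>The equivalences\<close>

text \<open>
  The metric of a \<open>Spin(7)\<close> form is defined by an unspecified map. In the direction from right to left
  its conformality therefore has to be known for every map that pulls the model back to \<open>\<Phi>\<close>.
\<close>

lemma conformal_spin7_pos_form_iff:
  "conformal_spin7_pos_form ori \<Phi> \<longleftrightarrow> (\<exists>\<kappa>>0. \<exists>e. positive_frame e \<and> \<Phi> = (\<lambda>xs. \<kappa> * cayley_form e xs))"
proof
  assume conf: "conformal_spin7_pos_form ori \<Phi>"
  define f where "f = (SOME f. oriented_iso ori f \<and> \<Phi> = pullback f spin7_model)"
  have "\<exists>f. oriented_iso ori f \<and> \<Phi> = pullback f spin7_model"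
    using conf by (simp add: conformal_spin7_pos_form_def spin7_pos_form_def)
  then have f: "oriented_iso ori f" "\<Phi> = pullback f spin7_model"
    unfolding f_def by (metis (mono_tags, lifting) someI_ex)+
  obtain c where c: "0 < c" "\<And>v w. f v \<bullet> f w = c * (v \<bullet> w)"
    using conf by (auto simp: conformal_spin7_pos_form_def spin7_metric_def f_def Let_def)
  obtain e where e: "frame e" "\<And>v p. p < 8 \<Longrightarrow> f v $ coord p = sqrt c * (v \<bullet> e ! p)"
    using f(1) by (auto simp: oriented_iso_def intro: conformal_map_frame[OF dim8 _ _ c])
  have "positive_frame e"
    using positive_frame_iff_oriented[OF e(2) _ e(1)] f(1) c(1) by (simp add: oriented_iso_def)
  moreover have "\<Phi> = (\<lambda>xs. sqrt c ^ 4 * cayley_form e xs)"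
    unfolding f(2) by (rule pullback_spin7_model[OF e(2)])
  moreover have "0 < sqrt c ^ 4" using c(1) by simp
  ultimately show "\<exists>\<kappa>>0. \<exists>e. positive_frame e \<and> \<Phi> = (\<lambda>xs. \<kappa> * cayley_form e xs)" by blast
next
  assume "\<exists>\<kappa>>0. \<exists>e. positive_frame e \<and> \<Phi> = (\<lambda>xs. \<kappa> * cayley_form e xs)"
  then obtain \<kappa> e where \<kappa>: "0 < \<kappa>" and e: "positive_frame e" and \<Phi>: "\<Phi> = (\<lambda>xs. \<kappa> * cayley_form e xs)" by blast
  define r where "r = root 4 \<kappa>"
  have r: "0 < r" "r ^ 4 = \<kappa>" using \<kappa> by (auto simp: r_def)
  have fe: "frame e" by (rule positive_frameD[OF e])
  obtain f where f: "linear f" "bij f" "\<And>v p. p < 8 \<Longrightarrow> f v $ coord p = r * (v \<bullet> e ! p)"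
    by (rule scaled_frame_map[OF dim8 fe r(1)]) blast
  have "oriented_iso ori f"
    using positive_frame_iff_oriented[OF f(3) r(1) fe] e f by (simp add: oriented_iso_def)
  moreover have "\<Phi> = pullback f spin7_model"
    using pullback_spin7_model[OF f(3)] r(2) by (simp add: \<Phi>)
  ultimately have ex: "\<exists>f. oriented_iso ori f \<and> \<Phi> = pullback f spin7_model" by blast
  define f' where "f' = (SOME f. oriented_iso ori f \<and> \<Phi> = pullback f spin7_model)"
  have f': "oriented_iso ori f'" "\<Phi> = pullback f' spin7_model"
    using someI_ex[OF ex] by (simp_all add: f'_def)
  then obtain c where "0 < c" "\<And>v w. f' v \<bullet> f' w = c * (v \<bullet> w)"
    using cayley_form_metric[OF e \<kappa> f'(1)] \<Phi> by auto
  then show "conformal_spin7_pos_form ori \<Phi>"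
    using ex unfolding conformal_spin7_pos_form_def spin7_pos_form_def spin7_metric_def f'_def Let_def by blast
qed

text \<open>
  The spinor has an adapted frame, whose form gives the same square; comparing the parts of degree four
  identifies the two forms.
\<close>

lemma cayley_multiple_of_square:
  assumes \<Phi>: "\<Phi> \<in> forms 4" and \<xi>: "\<xi> \<noteq> 0" "\<Psi> \<nu> \<xi> = \<xi>"
    and sq: "\<And>\<eta>. \<Psi> (spinor_polyform \<kappa> \<Phi>) \<eta> = (\<xi> \<bullet> \<eta>) *\<^sub>R \<xi>"
  shows "\<exists>\<kappa>>0. \<exists>e. positive_frame e \<and> \<Phi> = (\<lambda>xs. \<kappa> * cayley_form e xs)"
proof -
  obtain e where ad: "adapted e \<xi>" by (rule adapted_frame_exists[OF \<xi>])
  have e: "positive_frame e" using ad by (simp add: adapted_def)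
  let ?\<Phi>' = "\<lambda>xs. (\<xi> \<bullet> \<xi>) * cayley_form e xs"
  have \<Phi>': "?\<Phi>' \<in> forms 4" using cayley_form_self_dual[OF e] by (simp add: self_dual_4forms_def)
  have eq: "spinor_polyform \<kappa> \<Phi> = spinor_polyform (\<xi> \<bullet> \<xi>) ?\<Phi>'"
    by (rule \<Psi>_inj) (simp_all add: spinor_polyform_polyform form_polyform[OF \<Phi>] form_polyform[OF \<Phi>'] sq adapted_square[OF ad])
  have "\<Phi> = ?\<Phi>'"
  proof (rule form_eqI[OF positive_frameD[OF e] \<Phi> \<Phi>'])
    fix T assume T: "T \<subseteq> {..<DIM('a)}" "card T = 4"
    then have "T \<noteq> {}" "T \<noteq> {..<8}" by auto
    then show "\<Phi> (nths e T) = ?\<Phi>' (nths e T)"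
      using fun_cong[OF eq, of "nths e T"] T dim8
      by (simp add: spinor_polyform_def one_form_nths[OF positive_frameD[OF e]] volume_nths[OF e])
  qed
  moreover have "0 < \<xi> \<bullet> \<xi>" using \<xi>(1) by simp
  ultimately show ?thesis using e by blast
qed

text \<open>
  The operator \<open>\<xi> \<otimes> \<xi>\<^sup>*\<close> is in the image of the representation, being the operator of a polyform in an
  adapted frame; so the inverse in the definition of the square is a genuine one.
\<close>

lemma positive_square_iff:
  assumes "\<alpha> \<in> polyforms" and \<xi>: "\<xi> \<noteq> 0" "\<Psi> \<nu> \<xi> = \<xi>"
  shows "\<alpha> = positive_square \<Psi> \<xi> \<longleftrightarrow> (\<forall>\<eta>. \<Psi> \<alpha> \<eta> = (\<xi> \<bullet> \<eta>) *\<^sub>R \<xi>)"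
proof -
  obtain e where ad: "adapted e \<xi>" by (rule adapted_frame_exists[OF \<xi>])
  let ?\<beta> = "spinor_polyform (\<xi> \<bullet> \<xi>) (\<lambda>xs. (\<xi> \<bullet> \<xi>) * cayley_form e xs)"
  have \<beta>: "?\<beta> \<in> polyforms" by (rule spinor_polyform_polyform[OF scale_polyform[OF cayley_form_polyform]])
  have inj: "inj_on \<Psi> polyforms" using \<Psi>_inj by (auto simp: inj_on_def)
  have sq: "\<Psi> ?\<beta> = (\<lambda>\<eta>. (\<xi> \<bullet> \<eta>) *\<^sub>R \<xi>)" using adapted_square[OF ad] by auto
  have "positive_square \<Psi> \<xi> = ?\<beta>"
    unfolding positive_square_def sq[symmetric] by (rule inv_into_f_f[OF inj \<beta>])
  moreover have "\<alpha> = ?\<beta> \<longleftrightarrow> (\<forall>\<eta>. \<Psi> \<alpha> \<eta> = \<Psi> ?\<beta> \<eta>)" using \<Psi>_inj[OF assms(1) \<beta>] by auto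
  ultimately show ?thesis by (simp add: sq)
qed

lemma cayley_multiple_square:
  assumes e: "positive_frame e" and \<kappa>: "0 < \<kappa>"
  obtains \<xi> where "\<xi> \<noteq> 0" "\<Psi> \<nu> \<xi> = \<xi>"
    "\<And>\<eta>. \<Psi> (spinor_polyform \<kappa> (\<lambda>xs. \<kappa> * cayley_form e xs)) \<eta> = (\<xi> \<bullet> \<eta>) *\<^sub>R \<xi>" "\<xi> \<bullet> \<xi> = \<kappa>"
proof -
  obtain \<xi> where \<xi>: "adapted e \<xi>" "\<xi> \<bullet> \<xi> = \<kappa>" by (rule adapted_spinor_exists[OF e \<kappa>])
  show ?thesis
    using that[of \<xi>] \<xi> adapted_square[OF \<xi>(1)] \<kappa> by (auto simp: adapted_def)
qed

end

theorem theorem3p22: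
  fixes ori :: "'a::euclidean_space list set"
    and gp :: "'a polyform \<Rightarrow> 'a polyform \<Rightarrow> 'a polyform"
    and \<Psi> :: "'a polyform \<Rightarrow> 's::euclidean_space \<Rightarrow> 's"
  assumes "DIM('a) = 8"
    and "orientation ori"
    and "geometric_product gp"
    and "clifford_module gp \<Psi>"
    and "irreducible_module \<Psi>"
    and "DIM('s) = 16"
    and "covectors_symmetric \<Psi>"
  shows "(\<forall>\<Phi> \<in> self_dual_4forms ori. \<Phi> \<noteq> (\<lambda>_. 0) \<longrightarrow>
      (conformal_spin7_pos_form ori \<Phi> \<longleftrightarrow>
        (\<exists>\<xi> \<in> positive_chirality ori \<Psi> - {0}.
          (\<lambda>xs. 1 / 16 * (1 / sqrt 14 * form_norm \<Phi> * one_form xs + \<Phi> xs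
                 + 1 / sqrt 14 * form_norm \<Phi> * volume_form ori xs))
          = positive_square \<Psi> \<xi>)) \<and>
      (conformal_spin7_pos_form ori \<Phi> \<longleftrightarrow>
        (\<lambda>xs. sqrt 14 * Delta2 \<Phi> \<Phi> xs + 12 * form_norm \<Phi> * \<Phi> xs) = (\<lambda>_. 0))) \<and>
      {\<Phi>. conformal_spin7_pos_form ori \<Phi>} =
      {\<Phi> \<in> self_dual_4forms ori. \<Phi> \<noteq> (\<lambda>_. 0) \<and>
        (\<lambda>xs. sqrt 14 * Delta2 \<Phi> \<Phi> xs + 12 * form_norm \<Phi> * \<Phi> xs) = (\<lambda>_. 0)}"
proof -
  interpret spinor_module ori gp \<Psi>
    using assms by unfold_locales
  define C where "C \<Phi> \<longleftrightarrow> (\<exists>\<kappa>>0. \<exists>e. positive_frame e \<and> \<Phi> = (\<lambda>xs. \<kappa> * cayley_form e xs))"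
    for \<Phi> :: "'a polyform"
  define E where "E \<Phi> \<longleftrightarrow> (\<lambda>xs. sqrt 14 * Delta2 \<Phi> \<Phi> xs + 12 * form_norm \<Phi> * \<Phi> xs) = (\<lambda>_. 0)"
    for \<Phi> :: "'a polyform"
  define B where "B \<Phi> \<longleftrightarrow> (\<exists>\<xi> \<in> positive_chirality ori \<Psi> - {0}.
      (\<lambda>xs. 1 / 16 * (1 / sqrt 14 * form_norm \<Phi> * one_form xs + \<Phi> xs
             + 1 / sqrt 14 * form_norm \<Phi> * volume_form ori xs)) = positive_square \<Psi> \<xi>)"
    for \<Phi> :: "'a polyform"
  define k where "k \<Phi> = 1 / sqrt 14 * form_norm \<Phi>" for \<Phi> :: "'a polyform"
  define Q where "Q \<Phi> \<xi> \<longleftrightarrow> \<xi> \<noteq> 0 \<and> \<Psi> (volume_form ori) \<xi> = \<xi> \<and>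
      (\<forall>\<eta>. \<Psi> (spinor_polyform (k \<Phi>) \<Phi>) \<eta> = (\<xi> \<bullet> \<eta>) *\<^sub>R \<xi>)" for \<Phi> \<xi>
  have conformal: "conformal_spin7_pos_form ori \<Phi> \<longleftrightarrow> C \<Phi>" for \<Phi>
    unfolding C_def by (rule conformal_spin7_pos_form_iff)
  have norm: "form_norm \<Phi> = sqrt 14 * k \<Phi>" for \<Phi>
    by (simp add: k_def)
  have E_iff: "E \<Phi> \<longleftrightarrow> (\<forall>\<xi>. \<Psi> (spinor_polyform (k \<Phi>) \<Phi>) (\<Psi> (spinor_polyform (k \<Phi>) \<Phi>) \<xi>)
      = k \<Phi> *\<^sub>R \<Psi> (spinor_polyform (k \<Phi>) \<Phi>) \<xi>)" if "\<Phi> \<in> self_dual_4forms ori" for \<Phi>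
    unfolding E_def quadratic_equation_iff[OF that norm] spinor_polyform_idempotent_iff[OF that] ..
  have forward: "\<Phi> \<in> self_dual_4forms ori \<and> \<Phi> \<noteq> (\<lambda>_. 0) \<and> E \<Phi> \<and> (\<exists>\<xi>. Q \<Phi> \<xi>)" if "C \<Phi>" for \<Phi>
  proof -
    obtain \<kappa> e where \<kappa>: "0 < \<kappa>" and e: "positive_frame e" and \<Phi>: "\<Phi> = (\<lambda>xs. \<kappa> * cayley_form e xs)"
      using \<open>C \<Phi>\<close> unfolding C_def by blast
    have sd: "\<Phi> \<in> self_dual_4forms ori" unfolding \<Phi> by (rule cayley_form_self_dual[OF e])
    have norm_\<kappa>: "form_norm \<Phi> = sqrt 14 * \<kappa>"
      unfolding \<Phi> using \<kappa> by (intro cayley_form_norm positive_frameD[OF e]) simp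
    then have k: "k \<Phi> = \<kappa>" by (simp add: k_def)
    have "form_norm (\<lambda>_ :: 'a list. 0) = 0" by (simp add: form_norm_def form_inner_def)
    then have nz: "\<Phi> \<noteq> (\<lambda>_. 0)" using norm_\<kappa> \<kappa> by auto
    obtain \<xi> where \<xi>: "\<xi> \<noteq> 0" "\<Psi> (volume_form ori) \<xi> = \<xi>" "\<xi> \<bullet> \<xi> = \<kappa>"
      and sq: "\<And>\<eta>. \<Psi> (spinor_polyform \<kappa> \<Phi>) \<eta> = (\<xi> \<bullet> \<eta>) *\<^sub>R \<xi>"
      unfolding \<Phi> by (rule cayley_multiple_square[OF e \<kappa>]) blast
    have "E \<Phi>" unfolding E_iff[OF sd] k by (simp add: sq \<xi>(3))
    moreover have "Q \<Phi> \<xi>" unfolding Q_def k using \<xi> sq by blast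
    ultimately show ?thesis using sd nz by blast
  qed
  have Q_C: "C \<Phi>" if "\<Phi> \<in> self_dual_4forms ori" "Q \<Phi> \<xi>" for \<Phi> \<xi>
    unfolding C_def
    by (rule cayley_multiple_of_square) (use that in \<open>auto simp: Q_def self_dual_4forms_def\<close>)
  have E_C: "C \<Phi>" if sd: "\<Phi> \<in> self_dual_4forms ori" and nz: "\<Phi> \<noteq> (\<lambda>_. 0)" and "E \<Phi>" for \<Phi>
  proof -
    have pf: "\<Phi> \<in> polyforms" using sd by (simp add: self_dual_4forms_def forms_def)
    have "form_norm \<Phi> \<noteq> 0"
    proof
      assume 0: "form_norm \<Phi> = 0"
      obtain e :: "'a list" where e: "frame e" using Basis_frame by blast
      have "\<Phi> (nths e S) = 0" if "S \<subseteq> {..<DIM('a)}" for S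
        using form_norm_square[OF e pf] 0 that by (simp add: sum_nonneg_eq_0_iff)
      then have "\<Phi> = (\<lambda>_. 0)" by (intro polyform_eqI[OF e pf zero_polyform]) simp
      then show False using nz by simp
    qed
    then have pos: "0 < k \<Phi>" using form_norm_nonneg[OF pf] by (simp add: k_def)
    have idem: "\<And>\<xi>. \<Psi> (spinor_polyform (k \<Phi>) \<Phi>) (\<Psi> (spinor_polyform (k \<Phi>) \<Phi>) \<xi>)
        = k \<Phi> *\<^sub>R \<Psi> (spinor_polyform (k \<Phi>) \<Phi>) \<xi>"
      using \<open>E \<Phi>\<close> unfolding E_iff[OF sd] by blast
    obtain \<xi> where \<xi>: "\<xi> \<noteq> 0" "\<Psi> (volume_form ori) \<xi> = \<xi>"
      and sq: "\<And>\<eta>. \<Psi> (spinor_polyform (k \<Phi>) \<Phi>) \<eta> = (\<xi> \<bullet> \<eta>) *\<^sub>R \<xi>"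
      by (rule spinor_of_quadratic_equation[OF sd norm pos idem]) blast
    have "Q \<Phi> \<xi>" unfolding Q_def using \<xi> sq by blast
    then show ?thesis by (rule Q_C[OF sd])
  qed
  have square: "B \<Phi> \<longleftrightarrow> (\<exists>\<xi>. Q \<Phi> \<xi>)" if "\<Phi> \<in> self_dual_4forms ori" for \<Phi>
  proof -
    have pf: "\<Phi> \<in> polyforms" using that by (simp add: self_dual_4forms_def forms_def)
    have "(\<lambda>xs. 1 / 16 * (1 / sqrt 14 * form_norm \<Phi> * one_form xs + \<Phi> xs
        + 1 / sqrt 14 * form_norm \<Phi> * volume_form ori xs)) = spinor_polyform (k \<Phi>) \<Phi>"
      by (simp add: spinor_polyform_def k_def fun_eq_iff)
    then show ?thesis
      using positive_square_iff[OF spinor_polyform_polyform[OF pf, of "k \<Phi>"]]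
      by (auto simp: B_def positive_chirality_def Q_def)
  qed
  have "(\<forall>\<Phi> \<in> self_dual_4forms ori. \<Phi> \<noteq> (\<lambda>_. 0) \<longrightarrow> (C \<Phi> \<longleftrightarrow> B \<Phi>) \<and> (C \<Phi> \<longleftrightarrow> E \<Phi>)) \<and>
      {\<Phi>. C \<Phi>} = {\<Phi> \<in> self_dual_4forms ori. \<Phi> \<noteq> (\<lambda>_. 0) \<and> E \<Phi>}"
    using forward Q_C E_C square by blast
  then show ?thesis
    unfolding conformal B_def E_def .
qed

end
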